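(* Let $g\ge1$ and let $\Sigma_g$ be the compact, connected, orientable smooth surface of genus $g$ without boundary. There exist a closed $1$-form $A$ on $\Sigma_g$ and a sequence $h_n$ of Riemannian metrics on $\Sigma_g$ such that $$\lim_{n\to\infty}|h_n|\,\lambda_1(\Sigma_g,h_n,A)=+\infty .$$
   Context: For a smooth real $1$-form $A$ on a compact Riemannian manifold $(M,h)$ without boundary, $\lambda_1(M,h,A)$ denotes the lowest eigenvalue of the magnetic Laplacian $\Delta_A=(d^A)^*d^A$, where $d^Au=du-iuA$; i.e. $$\lambda_1(M,h,A)=\min_{0\neq u\in C^\infty(M,\mathbb C)}\frac{\int_M|du-iuA|_h^2\,dv_h}{\int_M|u|^2dv_h}.$$ $|h|$ is the volume (area) of $(\Sigma_g,h)$. *)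

theory Defs
  imports "HOL-Analysis.Analysis"
begin

section \<open>Smooth maps between normed spaces\<close>

text \<open>Both predicates are meant for open domains \<open>S\<close>.\<close>

primrec times_differentiable_on ::
  "nat \<Rightarrow> ('a::real_normed_vector \<Rightarrow> 'b::real_normed_vector) \<Rightarrow> 'a set \<Rightarrow> bool" where
  "times_differentiable_on 0 f S \<longleftrightarrow> continuous_on S f"
| "times_differentiable_on (Suc k) f S \<longleftrightarrow>
     (\<forall>x\<in>S. f differentiable (at x)) \<and>
     (\<forall>v. times_differentiable_on k (\<lambda>x. frechet_derivative f (at x) v) S)"

definition smooth_map_on ::
  "('a::real_normed_vector \<Rightarrow> 'b::real_normed_vector) \<Rightarrow> 'a set \<Rightarrow> bool" where
  "smooth_map_on f S \<longleftrightarrow> (\<forall>k. times_differentiable_on k f S)"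


section \<open>Smooth surfaces\<close>

text \<open>
  A chart is a pair \<open>(U, \<phi>)\<close> of an open set and a homeomorphism of \<open>U\<close> onto an open subset of the
  plane. Since charts have open range in the plane, surfaces are without boundary.
\<close>

type_synonym 'a chart = "'a set \<times> ('a \<Rightarrow> real^2)"

abbreviation chart_dom :: "'a chart \<Rightarrow> 'a set" where
  "chart_dom c \<equiv> fst c"

abbreviation chart_map :: "'a chart \<Rightarrow> 'a \<Rightarrow> real^2" where
  "chart_map c \<equiv> snd c"

definition chart_range :: "'a chart \<Rightarrow> (real^2) set" where
  "chart_range c = chart_map c ` chart_dom c"

definition chart_inv :: "'a chart \<Rightarrow> real^2 \<Rightarrow> 'a" where
  "chart_inv c = inv_into (chart_dom c) (chart_map c)"

definition transition :: "'a chart \<Rightarrow> 'a chart \<Rightarrow> real^2 \<Rightarrow> real^2" where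
  "transition c d = chart_map d \<circ> chart_inv c"

definition transition_jacobian :: "'a chart \<Rightarrow> 'a chart \<Rightarrow> 'a \<Rightarrow> real^2^2" where
  "transition_jacobian c d p = jacobian (transition c d) (at (chart_map c p))"

definition smooth_atlas :: "'a topology \<Rightarrow> 'a chart set \<Rightarrow> bool" where
  "smooth_atlas X \<A> \<longleftrightarrow>
     (\<forall>c\<in>\<A>. openin X (chart_dom c) \<and> open (chart_range c) \<and>
        homeomorphic_map (subtopology X (chart_dom c)) (top_of_set (chart_range c)) (chart_map c)) \<and>
     (\<Union>c\<in>\<A>. chart_dom c) = topspace X \<and>
     (\<forall>c\<in>\<A>. \<forall>d\<in>\<A>.
        smooth_map_on (transition c d) (chart_map c ` (chart_dom c \<inter> chart_dom d)))"

definition smooth_surface :: "'a topology \<Rightarrow> 'a chart set \<Rightarrow> bool" where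
  "smooth_surface X \<A> \<longleftrightarrow> Hausdorff_space X \<and> second_countable X \<and> smooth_atlas X \<A>"

definition orientable :: "'a topology \<Rightarrow> 'a chart set \<Rightarrow> bool" where
  "orientable X \<A> \<longleftrightarrow>
     (\<exists>\<B>. smooth_atlas X \<B> \<and> smooth_atlas X (\<A> \<union> \<B>) \<and>
        (\<forall>c\<in>\<B>. \<forall>d\<in>\<B>. \<forall>p\<in>chart_dom c \<inter> chart_dom d. det (transition_jacobian c d p) > 0))"

definition smooth_function ::
  "'a chart set \<Rightarrow> ('a \<Rightarrow> 'b::real_normed_vector) \<Rightarrow> bool" where
  "smooth_function \<A> u \<longleftrightarrow> (\<forall>c\<in>\<A>. smooth_map_on (u \<circ> chart_inv c) (chart_range c))"


section \<open>The genus\<close>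

text \<open>
  The standard surface of genus \<open>g\<close>, that is, the sphere with \<open>g\<close> handles. Let \<open>D\<close> be the closed
  disc of radius \<open>3g + 2\<close> about the origin with the \<open>g\<close> open unit discs about \<open>(3k, 0)\<close>,
  \<open>1 \<le> k \<le> g\<close>, removed. These holes have disjoint closures contained in the interior of the large
  disc, so the polynomial below is nonnegative exactly on \<open>D\<close>, and it vanishes exactly on the
  boundary of \<open>D\<close>, where its gradient is nonzero. Hence \<open>z\<^sup>2 = standard_polynomial g x y\<close> is a
  regular level set in 3-space: two copies of \<open>D\<close> glued along their boundary circles, i.e.
  the boundary of a solid handlebody with \<open>g\<close> handles.
\<close>

definition standard_polynomial :: "nat \<Rightarrow> real \<Rightarrow> real \<Rightarrow> real" where
  "standard_polynomial g x y =
     ((3 * real g + 2)\<^sup>2 - x\<^sup>2 - y\<^sup>2) * (\<Prod>k=1..g. (x - 3 * real k)\<^sup>2 + y\<^sup>2 - 1)"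

definition standard_surface :: "nat \<Rightarrow> (real^3) set" where
  "standard_surface g = {v. (v $ 3)\<^sup>2 = standard_polynomial g (v $ 1) (v $ 2)}"

text \<open>
  A closed surface has genus \<open>g\<close> if it is diffeomorphic to the standard one. As
  \<open>standard_surface g\<close> is an embedded submanifold of 3-space, a diffeomorphism onto it is the
  same as a smooth immersion into 3-space that is a homeomorphism onto \<open>standard_surface g\<close>.
\<close>

definition has_genus :: "'a topology \<Rightarrow> 'a chart set \<Rightarrow> nat \<Rightarrow> bool" where
  "has_genus X \<A> g \<longleftrightarrow>
     (\<exists>F :: 'a \<Rightarrow> real^3.
        homeomorphic_map X (top_of_set (standard_surface g)) F \<and>
        smooth_function \<A> F \<and>
        (\<forall>c\<in>\<A>. \<forall>y\<in>chart_range c. inj (frechet_derivative (F \<circ> chart_inv c) (at y))))"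


section \<open>One-forms and Riemannian metrics\<close>

text \<open>
  Tensor fields are given by their components in all charts of the atlas: if \<open>x\<^sub>1, x\<^sub>2\<close> are the
  coordinates of the chart \<open>c\<close>, then \<open>A c p $ i\<close> is the value of the one-form at \<open>p\<close> on the
  i-th coordinate vector, and \<open>h c p $ i $ j\<close> is the inner product of the i-th and j-th coordinate
  vectors at \<open>p\<close>. Only \<open>c \<in> \<A>\<close> and \<open>p \<in> chart_dom c\<close> matter. With \<open>J\<close> the Jacobian matrix of
  the coordinate change from \<open>c\<close> to \<open>d\<close>, pulling back gives the transformation laws below.
\<close>

type_synonym 'a one_form = "'a chart \<Rightarrow> 'a \<Rightarrow> real^2"

type_synonym 'a metric_tensor = "'a chart \<Rightarrow> 'a \<Rightarrow> real^2^2"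

definition smooth_one_form :: "'a chart set \<Rightarrow> 'a one_form \<Rightarrow> bool" where
  "smooth_one_form \<A> A \<longleftrightarrow>
     (\<forall>c\<in>\<A>. smooth_map_on (A c \<circ> chart_inv c) (chart_range c)) \<and>
     (\<forall>c\<in>\<A>. \<forall>d\<in>\<A>. \<forall>p\<in>chart_dom c \<inter> chart_dom d.
        A c p = transpose (transition_jacobian c d p) *v A d p)"

definition partial_deriv :: "2 \<Rightarrow> (real^2 \<Rightarrow> 'b::real_normed_vector) \<Rightarrow> real^2 \<Rightarrow> 'b" where
  "partial_deriv i f y = frechet_derivative f (at y) (axis i 1)"

definition closed_one_form :: "'a chart set \<Rightarrow> 'a one_form \<Rightarrow> bool" where
  "closed_one_form \<A> A \<longleftrightarrow> smooth_one_form \<A> A \<and>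
     (\<forall>c\<in>\<A>. \<forall>y\<in>chart_range c.
        partial_deriv 1 (\<lambda>x. A c (chart_inv c x) $ 2) y =
        partial_deriv 2 (\<lambda>x. A c (chart_inv c x) $ 1) y)"

definition riemannian_metric :: "'a chart set \<Rightarrow> 'a metric_tensor \<Rightarrow> bool" where
  "riemannian_metric \<A> h \<longleftrightarrow>
     (\<forall>c\<in>\<A>. smooth_map_on (h c \<circ> chart_inv c) (chart_range c)) \<and>
     (\<forall>c\<in>\<A>. \<forall>p\<in>chart_dom c. transpose (h c p) = h c p \<and> (\<forall>v. v \<noteq> 0 \<longrightarrow> v \<bullet> (h c p *v v) > 0)) \<and>
     (\<forall>c\<in>\<A>. \<forall>d\<in>\<A>. \<forall>p\<in>chart_dom c \<inter> chart_dom d.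
        h c p = transpose (transition_jacobian c d p) ** h d p ** transition_jacobian c d p)"

text \<open>
  The Riemannian measure is the unique Borel measure with density \<open>\<surd>det h\<close> with respect to
  Lebesgue measure in every chart; the local formulas agree on overlaps by the change of variables
  formula, and second countability gives existence and uniqueness.
\<close>

definition is_riemannian_measure ::
  "'a topology \<Rightarrow> 'a chart set \<Rightarrow> 'a metric_tensor \<Rightarrow> 'a measure \<Rightarrow> bool" where
  "is_riemannian_measure X \<A> h \<mu> \<longleftrightarrow>
     space \<mu> = topspace X \<and>
     sets \<mu> = sigma_sets (topspace X) {U. openin X U} \<and>
     (\<forall>c\<in>\<A>. \<forall>E\<in>sets \<mu>. E \<subseteq> chart_dom c \<longrightarrow>
        emeasure \<mu> E = (\<integral>\<^sup>+ y. ennreal (sqrt (det (h c (chart_inv c y)))) *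
                               indicator (chart_map c ` E) y \<partial>lborel))"

definition riemannian_measure ::
  "'a topology \<Rightarrow> 'a chart set \<Rightarrow> 'a metric_tensor \<Rightarrow> 'a measure" where
  "riemannian_measure X \<A> h = (THE \<mu>. is_riemannian_measure X \<A> h \<mu>)"

definition area :: "'a topology \<Rightarrow> 'a chart set \<Rightarrow> 'a metric_tensor \<Rightarrow> real" where
  "area X \<A> h = measure (riemannian_measure X \<A> h) (topspace X)"


section \<open>The first magnetic eigenvalue\<close>

text \<open>Components at \<open>p\<close>, in the chart \<open>c\<close>, of \<open>d\<^sup>A u = du - iuA\<close>.\<close>

definition magnetic_differential ::
  "'a one_form \<Rightarrow> ('a \<Rightarrow> complex) \<Rightarrow> 'a chart \<Rightarrow> 'a \<Rightarrow> complex^2" where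
  "magnetic_differential A u c p =
     (\<chi> i. partial_deriv i (u \<circ> chart_inv c) (chart_map c p) -
            \<i> * u p * complex_of_real (A c p $ i))"

text \<open>Squared Hermitian norm of a complex covector, for the metric with Gram matrix \<open>H\<close>.\<close>

definition covector_norm_sq :: "real^2^2 \<Rightarrow> complex^2 \<Rightarrow> real" where
  "covector_norm_sq H \<omega> =
     (\<Sum>j\<in>UNIV. \<Sum>k\<in>UNIV. matrix_inv H $ j $ k * Re (\<omega> $ j * cnj (\<omega> $ k)))"

text \<open>The value below does not depend on the choice of the chart around \<open>p\<close>.\<close>

definition magnetic_energy_density ::
  "'a chart set \<Rightarrow> 'a metric_tensor \<Rightarrow> 'a one_form \<Rightarrow> ('a \<Rightarrow> complex) \<Rightarrow> 'a \<Rightarrow> real" where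
  "magnetic_energy_density \<A> h A u p =
     (let c = (SOME c. c \<in> \<A> \<and> p \<in> chart_dom c)
      in covector_norm_sq (h c p) (magnetic_differential A u c p))"

definition magnetic_rayleigh_quotient ::
  "'a topology \<Rightarrow> 'a chart set \<Rightarrow> 'a metric_tensor \<Rightarrow> 'a one_form \<Rightarrow> ('a \<Rightarrow> complex) \<Rightarrow> real" where
  "magnetic_rayleigh_quotient X \<A> h A u =
     (LINT p|riemannian_measure X \<A> h. magnetic_energy_density \<A> h A u p) /
     (LINT p|riemannian_measure X \<A> h. (cmod (u p))\<^sup>2)"

text \<open>
  On a compact surface the infimum is attained, by a lowest eigenfunction of the magnetic
  Laplacian, so it equals the minimum of the Rayleigh quotient.
\<close>

definition magnetic_lambda1 ::
  "'a topology \<Rightarrow> 'a chart set \<Rightarrow> 'a metric_tensor \<Rightarrow> 'a one_form \<Rightarrow> real" where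
  "magnetic_lambda1 X \<A> h A =
     (INF u\<in>{u. smooth_function \<A> u \<and> (\<exists>p\<in>topspace X. u p \<noteq> 0)}.
        magnetic_rayleigh_quotient X \<A> h A u)"

end

theory Submission
  imports Defs
begin

text \<open>
  Work on the model surface in 3-space, with plane coordinates \<open>(x, y)\<close> centred at the first hole and
  \<open>r = x\<^sup>2 + y\<^sup>2\<close>. The field is half of the angular form, \<open>A = (x dy - y dx) / (2 r)\<close>, whose holonomy
  around the hole is \<open>-1\<close>; the metrics are \<open>h\<^sub>n = F\<^sup>*(eucl) + e\<^sub>n(r) dr\<^sup>2\<close> with
  \<open>e\<^sub>n(r) = exp (n (r - 2) (3 - r))\<close>. For \<open>2 < r < 3\<close> the surface consists of two annuli, which are
  stretched in the radial direction, so the area tends to infinity, while for other \<open>r\<close> the factor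
  \<open>e\<^sub>n\<close> stays in \<open>[0, 1]\<close>.

  It remains to bound \<open>\<integral>|u|\<^sup>2\<close> by a constant, independent of \<open>n\<close>, times the energy of \<open>u\<close>. On the
  annuli the circles \<open>r = const\<close> are not affected by the stretching, and the bound follows from
  the holonomy on each of these circles. Call an open set good if such a bound holds on it. Away from
  the annuli the metrics are uniformly comparable in \<open>n\<close>, and translating a ball along a segment in a
  chart shows that a point close to a good ball has a good neighbourhood. So the union of the good
  open sets is open and closed, hence everything, and compactness gives a uniform bound.
\<close>

section \<open>Calculus of smooth maps\<close>

text \<open>In dimension two, area times lambda_1 does not change under scaling, so rescaling a
  metric gains nothing. A long cylinder normally produces small eigenvalues, from functions varying
  slowly along its axis; a flux outside 2 pi Z forbids this, because no function is nearly
  covariantly constant along any of the circles, and half a flux quantum is farthest from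
  gauge-trivial. Positive genus provides a hole for the flux: the surface misses the axis on which
  the angular form is singular.

  The window \<open>2 < r < 3\<close> lies well inside \<open>1 < r < 4\<close>, the ring around the
  hole that meets neither its rim nor another hole nor the outer circle; over it the surface is a
  pair of graphs. The exponential keeps the metric smooth and positive without cut-off functions.

  The obstacle is uniformity in \<open>n\<close>. The area density is comparable to a function of
  \<open>r\<close>, which is constant along the circles and therefore can be carried through the
  circle estimate however large it is. Elsewhere only bounds for the metric enter, and these come
  from the factors 0 and 1.\<close>

lemma frechet_derivative_eq:
  "(f has_derivative f') (at x) \<Longrightarrow> frechet_derivative f (at x) = f'"
  using frechet_derivative_at by metis

lemma has_frechet_derivative:
  "f differentiable (at x) \<Longrightarrow> (f has_derivative frechet_derivative f (at x)) (at x)"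
  by (simp add: frechet_derivative_works)

text \<open>Since \<open>S\<close> is open, two functions that agree on \<open>S\<close> have the
  same germ at each of its points, hence the same derivative there, and the directional derivatives
  again agree on \<open>S\<close>.\<close>

lemma times_differentiable_on_cong:
  assumes "open S" "\<And>x. x \<in> S \<Longrightarrow> f x = g x" "times_differentiable_on k f S"
  shows "times_differentiable_on k g S"
  using assms(2,3)
proof (induction k arbitrary: f g)
  case 0
  then show ?case by (simp cong: continuous_on_cong)
next
  case (Suc k)
  have hd: "(g has_derivative frechet_derivative f (at x)) (at x)" if "x \<in> S" for x
    using Suc.prems(2) has_derivative_transform_within_open[OF has_frechet_derivative assms(1) that Suc.prems(1)] that
    by auto
  have "frechet_derivative f (at x) v = frechet_derivative g (at x) v" if "x \<in> S" for x v
    using frechet_derivative_eq[OF hd[OF that]] by simp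
  then have "times_differentiable_on k (\<lambda>x. frechet_derivative g (at x) v) S" for v
    using Suc.IH Suc.prems(2) by (metis (no_types, lifting) times_differentiable_on.simps(2))
  then show ?case
    using hd differentiableI by (auto simp: differentiable_def)
qed

text \<open>\<open>frechet_derivative\<close> is defined by choice; this rule lets the closure
  proofs name the derivative \<open>D\<close> explicitly.\<close>

lemma times_differentiable_on_SucI:
  assumes "open S" "\<And>x. x \<in> S \<Longrightarrow> (f has_derivative D x) (at x)"
    and "\<And>v. times_differentiable_on k (\<lambda>x. D x v) S"
  shows "times_differentiable_on (Suc k) f S"
proof -
  have "times_differentiable_on k (\<lambda>x. frechet_derivative f (at x) v) S" for v
    by (rule times_differentiable_on_cong[OF assms(1) _ assms(3)[of v]])
      (simp add: frechet_derivative_eq[OF assms(2)])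
  then show ?thesis
    using assms(2) by (auto simp: differentiable_def)
qed

text \<open>Product and chain rules contain undifferentiated factors, for which the inductions need
  one order less than the hypothesis provides.\<close>

lemma times_differentiable_on_SucD:
  "times_differentiable_on (Suc k) f S \<Longrightarrow> times_differentiable_on k f S"
proof (induction k arbitrary: f)
  case 0
  then show ?case
    by (auto intro!: continuous_at_imp_continuous_on differentiable_imp_continuous_within)
next
  case (Suc k)
  have "f differentiable (at x)" if "x \<in> S" for x
    using Suc.prems that by (subst (asm) times_differentiable_on.simps) blast
  moreover have "times_differentiable_on k (\<lambda>x. frechet_derivative f (at x) v) S" for v
    using Suc.prems by (intro Suc.IH) (subst (asm) times_differentiable_on.simps, blast)
  ultimately show ?case by simp
qed

lemma times_differentiable_on_const: "times_differentiable_on k (\<lambda>x. c) S"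
  by (induction k arbitrary: c) auto

lemma times_differentiable_on_bounded_linear:
  assumes "open S" "bounded_linear L" "times_differentiable_on k f S"
  shows "times_differentiable_on k (\<lambda>x. L (f x)) S"
  using assms(3)
proof (induction k arbitrary: f)
  case 0
  then show ?case
    using assms(2) by (simp add: bounded_linear.continuous_on)
next
  case (Suc k)
  let ?D = "\<lambda>x v. L (frechet_derivative f (at x) v)"
  have hd: "((\<lambda>x. L (f x)) has_derivative ?D x) (at x)"
    if "x \<in> S" for x
    using Suc.prems that by (auto intro!: bounded_linear.has_derivative[OF assms(2)] has_frechet_derivative)
  have td: "times_differentiable_on k (\<lambda>x. L (frechet_derivative f (at x) v)) S" for v
    using Suc by simp
  show ?case
    by (rule times_differentiable_on_SucI[OF assms(1), where D = ?D]) (erule hd, rule td)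
qed

lemma times_differentiable_on_add:
  assumes "open S" "times_differentiable_on k f S" "times_differentiable_on k g S"
  shows "times_differentiable_on k (\<lambda>x. f x + g x) S"
  using assms(2,3)
proof (induction k arbitrary: f g)
  case 0
  then show ?case by (simp add: continuous_on_add)
next
  case (Suc k)
  let ?D = "\<lambda>x v. frechet_derivative f (at x) v + frechet_derivative g (at x) v"
  have hd: "((\<lambda>x. f x + g x) has_derivative ?D x) (at x)" if "x \<in> S" for x
    using Suc.prems that by (auto intro!: has_derivative_add has_frechet_derivative)
  have td: "times_differentiable_on k (\<lambda>x. frechet_derivative f (at x) v + frechet_derivative g (at x) v) S" for v
    using Suc by simp
  show ?case
    by (rule times_differentiable_on_SucI[OF assms(1), where D = ?D]) (erule hd, rule td)
qed

text \<open>The induction runs over both arguments, since each summand of the product rule is again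
  a value of \<open>B\<close> with one argument differentiated.\<close>

lemma times_differentiable_on_bilinear:
  assumes "open S" "bounded_bilinear B" "times_differentiable_on k f S" "times_differentiable_on k g S"
  shows "times_differentiable_on k (\<lambda>x. B (f x) (g x)) S"
  using assms(3,4)
proof (induction k arbitrary: f g)
  case 0
  then show ?case using assms(2) by (simp add: bounded_bilinear.continuous_on)
next
  case (Suc k)
  let ?D = "\<lambda>x v. B (f x) (frechet_derivative g (at x) v) + B (frechet_derivative f (at x) v) (g x)"
  have hd: "((\<lambda>x. B (f x) (g x)) has_derivative ?D x) (at x)"
    if "x \<in> S" for x
    using Suc.prems that by (auto intro!: bounded_bilinear.FDERIV[OF assms(2)] has_frechet_derivative)
  have "times_differentiable_on k f S" "times_differentiable_on k g S"
    using Suc.prems times_differentiable_on_SucD by auto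
  then have td: "times_differentiable_on k
      (\<lambda>x. B (f x) (frechet_derivative g (at x) v) + B (frechet_derivative f (at x) v) (g x)) S" for v
    using Suc by (intro times_differentiable_on_add assms(1) Suc.IH) auto
  show ?case
    by (rule times_differentiable_on_SucI[OF assms(1), where D = ?D]) (erule hd, rule td)
qed

text \<open>The derivative contains \<open>exp (f x)\<close> itself, so \<open>f\<close> stays fixed
  and the induction hypothesis is fed back into a product.\<close>

lemma times_differentiable_on_exp:
  fixes f :: "'a::real_normed_vector \<Rightarrow> real"
  assumes "open S" "times_differentiable_on k f S"
  shows "times_differentiable_on k (\<lambda>x. exp (f x)) S"
  using assms(2)
proof (induction k)
  case 0
  then show ?case by (simp add: continuous_on_exp)
next
  case (Suc k)
  let ?D = "\<lambda>x v. frechet_derivative f (at x) v * exp (f x)"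
  have hd: "((\<lambda>x. exp (f x)) has_derivative ?D x) (at x)"
    if "x \<in> S" for x
    using Suc.prems that by (auto intro!: has_derivative_exp has_frechet_derivative)
  have td: "times_differentiable_on k (\<lambda>x. frechet_derivative f (at x) v * exp (f x)) S" for v
    using Suc times_differentiable_on_SucD
    by (intro times_differentiable_on_bilinear[OF assms(1) bounded_bilinear_mult]) auto
  show ?case
    by (rule times_differentiable_on_SucI[OF assms(1), where D = ?D]) (erule hd, rule td)
qed

lemma times_differentiable_on_inverse:
  fixes f :: "'a::real_normed_vector \<Rightarrow> real"
  assumes "open S" "times_differentiable_on k f S" "\<And>x. x \<in> S \<Longrightarrow> f x \<noteq> 0"
  shows "times_differentiable_on k (\<lambda>x. inverse (f x)) S"
  using assms(2)
proof (induction k)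
  case 0
  then show ?case using assms(3) by (simp add: continuous_on_inverse)
next
  case (Suc k)
  let ?D = "\<lambda>x v. - (inverse (f x) * frechet_derivative f (at x) v * inverse (f x))"
  have hd: "((\<lambda>x. inverse (f x)) has_derivative ?D x) (at x)"
    if "x \<in> S" for x
    using Suc.prems that assms(3) by (auto intro!: Deriv.has_derivative_inverse has_frechet_derivative)
  have i: "times_differentiable_on k (\<lambda>x. inverse (f x)) S"
    using Suc times_differentiable_on_SucD by auto
  have td: "times_differentiable_on k
      (\<lambda>x. - (inverse (f x) * frechet_derivative f (at x) v * inverse (f x))) S" for v
    using Suc.prems i
    by (intro times_differentiable_on_bounded_linear[OF assms(1) bounded_linear_minus[OF bounded_linear_ident]]
        times_differentiable_on_bilinear[OF assms(1) bounded_bilinear_mult]) auto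
  show ?case
    by (rule times_differentiable_on_SucI[OF assms(1), where D = ?D]) (erule hd, rule td)
qed

section \<open>Closure properties of infinitely differentiable maps\<close>

lemma smooth_map_on_cong:
  "open S \<Longrightarrow> (\<And>x. x \<in> S \<Longrightarrow> f x = g x) \<Longrightarrow> smooth_map_on f S \<Longrightarrow> smooth_map_on g S"
  unfolding smooth_map_on_def using times_differentiable_on_cong by metis

lemma smooth_map_on_const: "smooth_map_on (\<lambda>x. c) S"
  by (simp add: smooth_map_on_def times_differentiable_on_const)

lemma smooth_map_on_bounded_linear:
  "open S \<Longrightarrow> bounded_linear L \<Longrightarrow> smooth_map_on f S \<Longrightarrow> smooth_map_on (\<lambda>x. L (f x)) S"
  unfolding smooth_map_on_def using times_differentiable_on_bounded_linear by metis

lemma smooth_map_on_add: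
  "open S \<Longrightarrow> smooth_map_on f S \<Longrightarrow> smooth_map_on g S \<Longrightarrow> smooth_map_on (\<lambda>x. f x + g x) S"
  unfolding smooth_map_on_def using times_differentiable_on_add by metis

lemma smooth_map_on_bilinear:
  "open S \<Longrightarrow> bounded_bilinear B \<Longrightarrow> smooth_map_on f S \<Longrightarrow> smooth_map_on g S \<Longrightarrow>
     smooth_map_on (\<lambda>x. B (f x) (g x)) S"
  unfolding smooth_map_on_def using times_differentiable_on_bilinear by metis

lemmas smooth_map_on_mult = smooth_map_on_bilinear[OF _ bounded_bilinear_mult]

lemma smooth_map_on_diff:
  assumes "open S" "smooth_map_on f S" "smooth_map_on g S"
  shows "smooth_map_on (\<lambda>x. f x - g x) S"
  using smooth_map_on_add[OF assms(1,2) smooth_map_on_bounded_linear[OF assms(1)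
        bounded_linear_minus[OF bounded_linear_ident] assms(3)]] by simp

lemma smooth_map_on_exp:
  fixes f :: "'a::real_normed_vector \<Rightarrow> real"
  shows "open S \<Longrightarrow> smooth_map_on f S \<Longrightarrow> smooth_map_on (\<lambda>x. exp (f x)) S"
  unfolding smooth_map_on_def using times_differentiable_on_exp by metis

lemma smooth_map_on_inverse:
  fixes f :: "'a::real_normed_vector \<Rightarrow> real"
  shows "open S \<Longrightarrow> smooth_map_on f S \<Longrightarrow> (\<And>x. x \<in> S \<Longrightarrow> f x \<noteq> 0) \<Longrightarrow>
    smooth_map_on (\<lambda>x. inverse (f x)) S"
  unfolding smooth_map_on_def using times_differentiable_on_inverse by metis

lemma smooth_map_on_sum:
  "open S \<Longrightarrow> (\<And>i. i \<in> I \<Longrightarrow> smooth_map_on (f i) S) \<Longrightarrow> smooth_map_on (\<lambda>x. \<Sum>i\<in>I. f i x) S"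
  by (induction I rule: infinite_finite_induct)
    (auto intro: smooth_map_on_const smooth_map_on_add)

lemma smooth_map_on_prod:
  fixes f :: "'i \<Rightarrow> 'a::real_normed_vector \<Rightarrow> real"
  shows "open S \<Longrightarrow> (\<And>i. i \<in> I \<Longrightarrow> smooth_map_on (f i) S) \<Longrightarrow> smooth_map_on (\<lambda>x. \<Prod>i\<in>I. f i x) S"
  by (induction I rule: infinite_finite_induct)
    (auto intro: smooth_map_on_const smooth_map_on_mult)

lemma smooth_map_on_differentiable:
  "smooth_map_on f S \<Longrightarrow> x \<in> S \<Longrightarrow> f differentiable (at x)"
  unfolding smooth_map_on_def by (metis times_differentiable_on.simps(2))

lemma smooth_map_on_frechet_derivative:
  "smooth_map_on f S \<Longrightarrow> smooth_map_on (\<lambda>x. frechet_derivative f (at x) v) S"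
  unfolding smooth_map_on_def by (metis times_differentiable_on.simps(2))

lemma smooth_map_on_continuous: "smooth_map_on f S \<Longrightarrow> continuous_on S f"
  unfolding smooth_map_on_def by (metis times_differentiable_on.simps(1))

lemma smooth_map_on_partial_deriv:
  "smooth_map_on f S \<Longrightarrow> smooth_map_on (partial_deriv i f) S"
  using smooth_map_on_frechet_derivative[of f S "axis i 1"] by (simp add: partial_deriv_def[abs_def])

lemma smooth_map_on_subset: "smooth_map_on f S \<Longrightarrow> T \<subseteq> S \<Longrightarrow> smooth_map_on f T"
proof -
  have "times_differentiable_on k f S \<Longrightarrow> T \<subseteq> S \<Longrightarrow> times_differentiable_on k f T" for k
    by (induction k arbitrary: f) (auto intro: continuous_on_subset)
  then show "smooth_map_on f S \<Longrightarrow> T \<subseteq> S \<Longrightarrow> smooth_map_on f T"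
    by (auto simp: smooth_map_on_def)
qed

lemma smooth_map_on_vec_nth:
  "open S \<Longrightarrow> smooth_map_on f S \<Longrightarrow> smooth_map_on (\<lambda>x. f x $ i) S"
  for f :: "'a::real_normed_vector \<Rightarrow> 'b::real_normed_vector^'n"
  by (rule smooth_map_on_bounded_linear[OF _ bounded_linear_vec_nth])

text \<open>A vector is the sum of its coordinates placed on the axes, and the inclusion of an axis
  is bounded linear.\<close>

lemma smooth_map_on_vecI:
  fixes f :: "'a::real_normed_vector \<Rightarrow> 'b::real_normed_vector^'n"
  assumes "open S" "\<And>i. smooth_map_on (\<lambda>x. f x $ i) S"
  shows "smooth_map_on f S"
proof -
  have lin: "bounded_linear (axis i :: 'b \<Rightarrow> 'b^'n)" for i
  proof (rule bounded_linear_intro[of _ 1])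
    show "norm (axis i x :: 'b^'n) \<le> norm x * 1" for x
      by (simp add: norm_vec_def L2_set_def axis_def if_distrib[of norm] if_distrib[of "\<lambda>t. t\<^sup>2"] cong: if_cong)
  qed (auto simp: vec_eq_iff axis_def)
  have "smooth_map_on (\<lambda>x. \<Sum>i\<in>UNIV. axis i (f x $ i)) S"
    using assms by (intro smooth_map_on_sum smooth_map_on_bounded_linear[OF _ lin]) auto
  moreover have "(\<Sum>i\<in>UNIV. axis i (f x $ i)) = f x" for x
    by (simp add: vec_eq_iff axis_def sum.If_cases if_distrib cong: if_cong)
  ultimately show ?thesis by simp
qed

lemma smooth_map_on_ident:
  "smooth_map_on (\<lambda>x. x) (S :: 'a::real_normed_vector set)"
proof -
  have "times_differentiable_on k (\<lambda>x. x) (S :: 'a set)" for k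
    by (cases k) (auto intro: times_differentiable_on_const)
  then show ?thesis by (simp add: smooth_map_on_def)
qed

section \<open>Derivatives along segments and the symmetry of second derivatives\<close>

lemma has_derivative_along_line:
  assumes "f differentiable (at (a + s *\<^sub>R v))"
  shows "((\<lambda>t. f (a + t *\<^sub>R v)) has_derivative (\<lambda>t. t *\<^sub>R frechet_derivative f (at (a + s *\<^sub>R v)) v)) (at s)"
proof -
  have "((\<lambda>t. a + t *\<^sub>R v) has_derivative (\<lambda>t. t *\<^sub>R v)) (at s)"
    by (auto intro!: derivative_eq_intros)
  from diff_chain_at[OF this has_frechet_derivative[OF assms]]
  show ?thesis
    using linear_cmul[OF linear_frechet_derivative[OF assms]] by (simp add: o_def)
qed

lemma has_vector_derivative_along_line:
  assumes "f differentiable (at (a + s *\<^sub>R v))"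
  shows "((\<lambda>t. f (a + t *\<^sub>R v)) has_vector_derivative frechet_derivative f (at (a + s *\<^sub>R v)) v) (at s)"
  using has_derivative_along_line[OF assms] by (simp add: has_vector_derivative_def)

text \<open>Two applications of the mean value theorem, one for each side of the parallelogram, give
  an exact expression; the intermediate point lies in the parallelogram, hence close to
  \<open>y\<close>.\<close>

lemma second_difference:
  fixes f :: "'a::real_normed_vector \<Rightarrow> real"
  assumes "smooth_map_on f (ball y r)" "h > 0" "h * (norm v + norm w) < r"
  shows "\<exists>z. norm (z - y) \<le> h * (norm v + norm w) \<and>
    f (y + h *\<^sub>R v + h *\<^sub>R w) - f (y + h *\<^sub>R v) - f (y + h *\<^sub>R w) + f y =
    h * h * frechet_derivative (\<lambda>x. frechet_derivative f (at x) v) (at z) w"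
proof -
  let ?Dv = "\<lambda>x. frechet_derivative f (at x) v"
  have nrm: "norm (s *\<^sub>R v + t *\<^sub>R w) \<le> h * (norm v + norm w)" if "0 \<le> s" "s \<le> h" "0 \<le> t" "t \<le> h" for s t
  proof -
    have "norm (s *\<^sub>R v + t *\<^sub>R w) \<le> s * norm v + t * norm w"
      using that norm_triangle_ineq[of "s *\<^sub>R v" "t *\<^sub>R w"] by simp
    also have "\<dots> \<le> h * norm v + h * norm w"
      using that by (intro add_mono mult_right_mono) auto
    finally show ?thesis by (simp add: algebra_simps)
  qed
  have inb: "y + s *\<^sub>R v + t *\<^sub>R w \<in> ball y r" if "0 \<le> s" "s \<le> h" "0 \<le> t" "t \<le> h" for s t
    using nrm[OF that] assms(3) by (simp add: dist_norm norm_minus_commute algebra_simps)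
  \<comment> \<open>The second difference is the increment, over the side in direction
    \<open>v\<close>, of the first difference in direction \<open>w\<close>.\<close>
  define g where "g s = f (y + h *\<^sub>R w + s *\<^sub>R v) - f (y + s *\<^sub>R v)" for s
  let ?g' = "\<lambda>s t. t *\<^sub>R ?Dv (y + h *\<^sub>R w + s *\<^sub>R v) - t *\<^sub>R ?Dv (y + s *\<^sub>R v)"
  have g': "(g has_derivative ?g' s) (at s within {0..h})" if "0 \<le> s" "s \<le> h" for s
    unfolding g_def using inb[of s h] inb[of s 0] that assms(2)
    by (intro has_derivative_at_withinI[OF has_derivative_diff] has_derivative_along_line
        smooth_map_on_differentiable[OF assms(1)]) (auto simp: algebra_simps)
  have "\<exists>\<xi>\<in>{0<..<h}. g h - g 0 = ?g' \<xi> (h - 0)"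
    by (rule mvt_simple[OF assms(2), where f' = ?g']) (rule g')
  then obtain \<xi> where xi: "0 < \<xi>" "\<xi> < h"
    and g: "g h - g 0 = h * (?Dv (y + h *\<^sub>R w + \<xi> *\<^sub>R v) - ?Dv (y + \<xi> *\<^sub>R v))"
    by (auto simp: algebra_simps)
  \<comment> \<open>At the point found on the first side, the mean value theorem is applied once
    more, now to the derivative along \<open>v\<close> and in direction \<open>w\<close>.\<close>
  define k where "k t = ?Dv ((y + \<xi> *\<^sub>R v) + t *\<^sub>R w)" for t
  let ?k' = "\<lambda>t u. u *\<^sub>R frechet_derivative ?Dv (at ((y + \<xi> *\<^sub>R v) + t *\<^sub>R w)) w"
  have k': "(k has_derivative ?k' t) (at t within {0..h})" if "0 \<le> t" "t \<le> h" for t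
    unfolding k_def using inb[of \<xi> t] that xi
    by (intro has_derivative_at_withinI[OF has_derivative_along_line]
        smooth_map_on_differentiable[OF smooth_map_on_frechet_derivative[OF assms(1)]]) auto
  have "\<exists>\<eta>\<in>{0<..<h}. k h - k 0 = ?k' \<eta> (h - 0)"
    by (rule mvt_simple[OF assms(2), where f' = ?k']) (rule k')
  then obtain \<eta> where eta: "0 < \<eta>" "\<eta> < h"
    and k: "k h - k 0 = h * frechet_derivative ?Dv (at ((y + \<xi> *\<^sub>R v) + \<eta> *\<^sub>R w)) w"
    by auto
  have "g h - g 0 = h * (k h - k 0)"
    by (simp add: g k_def algebra_simps)
  moreover have "f (y + h *\<^sub>R v + h *\<^sub>R w) - f (y + h *\<^sub>R v) - f (y + h *\<^sub>R w) + f y = g h - g 0"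
    by (simp add: g_def algebra_simps)
  ultimately show ?thesis
    using nrm[of \<xi> \<eta>] xi eta k by (intro exI[of _ "y + \<xi> *\<^sub>R v + \<eta> *\<^sub>R w"]) (simp add: algebra_simps)
qed

text \<open>Schwarz's theorem. The second difference is symmetric in \<open>v\<close> and
  \<open>w\<close>, so \<open>second_difference\<close> gives equal mixed derivatives at two nearby
  points, and continuity moves both points to \<open>y\<close>.\<close>

lemma smooth_map_on_derivative_symmetric:
  fixes f :: "'a::real_normed_vector \<Rightarrow> real"
  assumes "open S" "smooth_map_on f S" "y \<in> S"
  shows "frechet_derivative (\<lambda>x. frechet_derivative f (at x) v) (at y) w =
         frechet_derivative (\<lambda>x. frechet_derivative f (at x) w) (at y) v" (is "?A y = ?B y")
proof (rule ccontr)
  assume neq: "?A y \<noteq> ?B y"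
  \<comment> \<open>Half of the gap: a number cannot be within \<open>e\<close> of both
    \<open>?A y\<close> and \<open>?B y\<close>.\<close>
  define e where "e = \<bar>?A y - ?B y\<bar> / 2"
  have e: "e > 0" using neq by (simp add: e_def)
  have cont: "continuous_on S ?A" "continuous_on S ?B"
    by (intro smooth_map_on_continuous smooth_map_on_frechet_derivative assms)+
  then have "isCont ?A y" "isCont ?B y"
    using assms by (auto simp: continuous_on_eq_continuous_at)
  then obtain d1 d2 where d: "d1 > 0" "d2 > 0"
    "\<And>z. norm (z - y) < d1 \<Longrightarrow> \<bar>?A z - ?A y\<bar> < e" "\<And>z. norm (z - y) < d2 \<Longrightarrow> \<bar>?B z - ?B y\<bar> < e"
    using e unfolding continuous_at_eps_delta dist_norm real_norm_def by metis
  obtain r where r: "r > 0" "ball y r \<subseteq> S"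
    using assms openE by blast
  define m where "m = min r (min d1 d2)"
  \<comment> \<open>The parallelogram has to fit into the balls of radii \<open>r\<close>,
    \<open>d1\<close> and \<open>d2\<close>; the summand 1 keeps the denominator positive when both
    vectors vanish.\<close>
  define h where "h = m / (2 * (norm v + norm w + 1))"
  have N: "norm v + norm w + 1 > 0" by (smt (verit) norm_ge_zero)
  have "m > 0" using r d by (simp add: m_def)
  then have h: "h > 0" using N by (simp add: h_def)
  have "h * (norm v + norm w) < m"
  proof -
    have "h * (norm v + norm w) \<le> h * (norm v + norm w + 1)" using h by simp
    also have "\<dots> = m / 2" using N by (simp add: h_def field_simps)
    also have "\<dots> < m" using \<open>m > 0\<close> by simp
    finally show ?thesis .
  qed
  then have hm: "h * (norm v + norm w) < r" "h * (norm v + norm w) < d1" "h * (norm w + norm v) < d2"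
    "h * (norm w + norm v) < r" by (auto simp: m_def add.commute)
  have sm: "smooth_map_on f (ball y r)" by (rule smooth_map_on_subset[OF assms(2) r(2)])
  obtain z1 where z1: "norm (z1 - y) \<le> h * (norm v + norm w)"
    "f (y + h *\<^sub>R v + h *\<^sub>R w) - f (y + h *\<^sub>R v) - f (y + h *\<^sub>R w) + f y = h * h * ?A z1"
    using second_difference[OF sm h hm(1)] by blast
  obtain z2 where z2: "norm (z2 - y) \<le> h * (norm w + norm v)"
    "f (y + h *\<^sub>R w + h *\<^sub>R v) - f (y + h *\<^sub>R w) - f (y + h *\<^sub>R v) + f y = h * h * ?B z2"
    using second_difference[OF sm h hm(4)] by blast
  have "h * h * ?A z1 = h * h * ?B z2"
    using z1(2) z2(2) by (simp add: algebra_simps)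
  then have "?A z1 = ?B z2" using h by simp
  moreover have "\<bar>?A z1 - ?A y\<bar> < e" "\<bar>?B z2 - ?B y\<bar> < e"
    using d z1(1) z2(1) hm by auto
  ultimately show False unfolding e_def by (smt (verit) field_sum_of_halves)
qed

section \<open>Bilinear algebra in the plane\<close>

text \<open>The pointwise condition in \<open>riemannian_metric\<close>, isolated so that it can
  also be required in charts outside the atlas.\<close>

definition positive_form :: "real^2^2 \<Rightarrow> bool" where
  "positive_form H \<longleftrightarrow> transpose H = H \<and> (\<forall>v. v \<noteq> 0 \<longrightarrow> v \<bullet> (H *v v) > 0)"

lemma quadratic_form_2:
  fixes H :: "real^2^2"
  shows "v \<bullet> (H *v v) = H$1$1 * (v$1)\<^sup>2 + (H$1$2 + H$2$1) * (v$1 * v$2) + H$2$2 * (v$2)\<^sup>2"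
  unfolding inner_vec_def matrix_vector_mult_def sum_2 power2_eq_square inner_real_def vec_lambda_beta
  by algebra

lemma positive_form_sym: "positive_form H \<Longrightarrow> H$2$1 = H$1$2"
  unfolding positive_form_def
  by (drule conjunct1, drule arg_cong[where f = "\<lambda>M. M$1$2"]) (simp add: transpose_def)

lemma positive_form_11:
  assumes "positive_form H" shows "H$1$1 > 0"
proof -
  have "axis 1 1 \<bullet> (H *v axis 1 1) > 0"
    using assms by (auto simp: positive_form_def)
  then show ?thesis by (simp add: quadratic_form_2 axis_def)
qed

lemma positive_form_det:
  assumes "positive_form H" shows "det H > 0"
proof -
  \<comment> \<open>Orthogonal to the first row of \<open>H\<close>, so that the quadratic form
    collapses to \<open>H$1$1 * det H\<close>.\<close>
  let ?v = "vector [- H$1$2, H$1$1] :: real^2"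
  have "?v \<noteq> 0"
    using positive_form_11[OF assms] by (metis vector_2(2) zero_index less_irrefl)
  then have "?v \<bullet> (H *v ?v) > 0"
    using assms by (auto simp: positive_form_def)
  then have "H$1$1 * det H > 0"
    using positive_form_sym[OF assms]
    by (simp add: quadratic_form_2 det_2 power2_eq_square algebra_simps)
  then show ?thesis
    using positive_form_11[OF assms] by (simp add: zero_less_mult_iff)
qed

lemma matrix_inv_2:
  fixes H :: "real^2^2"
  assumes "det H \<noteq> 0"
  shows "matrix_inv H = vector [vector [H$2$2 / det H, - H$1$2 / det H],
                                vector [- H$2$1 / det H, H$1$1 / det H]]" (is "_ = ?B")
proof -
  have D: "H$1$1 * H$2$2 = det H + H$1$2 * H$2$1" by (simp add: det_2)
  have *: "?B ** H = mat 1"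
    using assms D
    by (simp add: vec_eq_iff forall_2 matrix_matrix_mult_def sum_2 mat_def divide_simps mult.commute)
  have "invertible H" using assms by (simp add: invertible_det_nz)
  then have "H ** matrix_inv H = mat 1 \<and> matrix_inv H ** H = mat 1"
    unfolding invertible_def matrix_inv_def by (rule someI_ex)
  then have "H ** matrix_inv H = mat 1" by simp
  then have "?B = ?B ** (H ** matrix_inv H)" by simp
  also have "\<dots> = matrix_inv H"
    unfolding matrix_mul_assoc * by simp
  finally show ?thesis ..
qed

lemma covector_norm_sq_eq:
  assumes "det H \<noteq> 0"
  shows "covector_norm_sq H \<omega> =
    (H$2$2 * (cmod (\<omega>$1))\<^sup>2 - (H$1$2 + H$2$1) * Re (\<omega>$1 * cnj (\<omega>$2)) + H$1$1 * (cmod (\<omega>$2))\<^sup>2) / det H"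
proof -
  have *: "(\<Sum>j\<in>UNIV. \<Sum>k\<in>UNIV. matrix_inv H $ j $ k * Re (\<omega> $ j * cnj (\<omega> $ k))) =
    H$2$2 / det H * (cmod (\<omega>$1))\<^sup>2 - H$1$2 / det H * Re (\<omega>$1 * cnj (\<omega>$2))
    - H$2$1 / det H * Re (\<omega>$1 * cnj (\<omega>$2)) + H$1$1 / det H * (cmod (\<omega>$2))\<^sup>2"
    unfolding matrix_inv_2[OF assms] sum_2 cmod_power2 by (simp add: power2_eq_square mult.commute)
  show ?thesis
    unfolding covector_norm_sq_def * by (simp add: diff_divide_distrib add_divide_distrib ring_distribs)
qed

lemma det_congruence:
  fixes J H :: "real^2^2"
  shows "det (transpose J ** H ** J) = (det J)\<^sup>2 * det H"
  by (simp add: det_mul det_transpose power2_eq_square)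

lemma congruence_entries:
  fixes J H :: "real^2^2"
  shows "(transpose J ** H ** J)$1$1 = J$1$1*J$1$1*H$1$1 + J$1$1*J$2$1*(H$1$2+H$2$1) + J$2$1*J$2$1*H$2$2" (is ?A)
    "(transpose J ** H ** J)$2$2 = J$1$2*J$1$2*H$1$1 + J$1$2*J$2$2*(H$1$2+H$2$1) + J$2$2*J$2$2*H$2$2" (is ?B)
    "(transpose J ** H ** J)$1$2 + (transpose J ** H ** J)$2$1 =
     2*J$1$1*J$1$2*H$1$1 + (J$1$1*J$2$2+J$1$2*J$2$1)*(H$1$2+H$2$1) + 2*J$2$1*J$2$2*H$2$2" (is ?C)
proof -
  show ?A ?B
    unfolding matrix_matrix_mult_def transpose_def sum_2 vec_lambda_beta by algebra+
  show ?C
    unfolding matrix_matrix_mult_def transpose_def sum_2 vec_lambda_beta by (simp only: algebra_simps)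
qed

text \<open>Naturality of the norm as an identity of polynomials: \<open>a, b, c, d\<close> stand
  for the entries of the Jacobian, and \<open>p, q, r, s\<close> for the real and imaginary parts of
  the covector.\<close>

lemma covector_norm_sq_polynomial: fixes a :: real
 shows "(b*b*h11 + b*d*(h12+h21) + d*d*h22) * ((a*p+c*r)\<^sup>2 + (a*q+c * s)\<^sup>2)
        - (2*a*b*h11 + (a*d+b*c)*(h12+h21) + 2*c*d*h22) * ((a*p+c*r)*(b*p+d*r) + (a*q+c * s)*(b*q+d * s))
        + (a*a*h11 + a*c*(h12+h21) + c*c*h22) * ((b*p+d*r)\<^sup>2 + (b*q+d * s)\<^sup>2)
      = (a*d-b*c)\<^sup>2 * (h22 * (p\<^sup>2 + q\<^sup>2) - (h12+h21) * (p*r+q * s) + h11 * (r\<^sup>2 + s\<^sup>2))"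
proof -
 show ?thesis by algebra
qed

text \<open>Pulling back both the metric and the covector multiplies numerator and denominator of
  the cofactor formula by the same factor, the square of \<open>det J\<close>.\<close>

lemma covector_norm_sq_congruence:
  fixes J H :: "real^2^2" and \<omega> :: "complex^2"
  assumes "det (transpose J ** H ** J) \<noteq> 0"
  shows "covector_norm_sq (transpose J ** H ** J) (\<chi> i. \<Sum>k\<in>UNIV. of_real (J$k$i) * \<omega>$k) =
    covector_norm_sq H \<omega>"
proof -
  have nz: "det J \<noteq> 0" "det H \<noteq> 0" using assms by (auto simp: det_congruence)
  let ?a = "J$1$1" let ?b = "J$1$2" let ?c = "J$2$1" let ?d = "J$2$2"
  let ?H = "transpose J ** H ** J"
  define p q r s where "p = Re (\<omega>$1)" and "q = Im (\<omega>$1)" and "r = Re (\<omega>$2)" and "s = Im (\<omega>$2)"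
  have "covector_norm_sq ?H (\<chi> i. \<Sum>k\<in>UNIV. of_real (J$k$i) * \<omega>$k) =
     (det J)\<^sup>2 * (H$2$2 * (p\<^sup>2 + q\<^sup>2) - (H$1$2+H$2$1) * (p*r+q * s) + H$1$1 * (r\<^sup>2 + s\<^sup>2)) / ((det J)\<^sup>2 * det H)"
  proof -
    let ?w = "(\<chi> i. \<Sum>k\<in>UNIV. of_real (J$k$i) * \<omega>$k) :: complex^2"
    have w: "(cmod (?w$1))\<^sup>2 = (?a*p+?c*r)\<^sup>2 + (?a*q+?c * s)\<^sup>2"
      "(cmod (?w$2))\<^sup>2 = (?b*p+?d*r)\<^sup>2 + (?b*q+?d * s)\<^sup>2"
      "Re (?w$1 * cnj (?w$2)) = (?a*p+?c*r)*(?b*p+?d*r) + (?a*q+?c * s)*(?b*q+?d * s)"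
      by (simp_all add: sum_2 cmod_power2 p_def q_def r_def s_def algebra_simps)
    show ?thesis
      unfolding covector_norm_sq_eq[OF assms] w congruence_entries covector_norm_sq_polynomial
      unfolding det_congruence det_2[of J] ..
  qed
  also have "\<dots> = covector_norm_sq H \<omega>"
    using nz by (simp add: covector_norm_sq_eq cmod_power2 p_def q_def r_def s_def)
  finally show ?thesis .
qed

text \<open>Cauchy-Schwarz between a covector and a vector. Through it the energy controls the
  covariant derivative along any vector of bounded length.\<close>

lemma covector_norm_sq_ge:
  assumes "positive_form H"
  shows "(cmod (\<Sum>i\<in>UNIV. of_real (v$i) * \<omega>$i))\<^sup>2 \<le> covector_norm_sq H \<omega> * (v \<bullet> (H *v v))"
proof -
  note D = positive_form_det[OF assms]
  define p q r s where "p = Re (\<omega>$1)" and "q = Im (\<omega>$1)" and "r = Re (\<omega>$2)" and "s = Im (\<omega>$2)"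
  let ?a = "H$1$1" let ?b = "H$1$2" let ?c = "H$2$2" let ?x = "v$1" let ?y = "v$2"
  have sym: "H$2$1 = ?b" by (rule positive_form_sym[OF assms])
  have D2: "det H = ?a * ?c - ?b * ?b" using sym by (simp add: det_2)
  let ?N = "?c * (p\<^sup>2 + q\<^sup>2) - (?b+?b) * (p*r+q * s) + ?a * (r\<^sup>2 + s\<^sup>2)"
  let ?Q = "?a * ?x\<^sup>2 + (?b+?b) * (?x*?y) + ?c * ?y\<^sup>2"
  \<comment> \<open>Lagrange's identity: the last two squares come from the wedge product of
    \<omega> with the covector \<open>H *v v\<close>, and vanish when the two are
    proportional.\<close>
  have id: "?N * ?Q = det H * ((?x*p+?y*r)\<^sup>2 + (?x*q+?y * s)\<^sup>2) +
     ((p*(?b*?x+?c*?y) - r*(?a*?x+?b*?y))\<^sup>2 + (q*(?b*?x+?c*?y) - s * (?a*?x+?b*?y))\<^sup>2)"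
    unfolding D2 by algebra
  have "det H * ((?x*p+?y*r)\<^sup>2 + (?x*q+?y * s)\<^sup>2) \<le> ?N * ?Q"
    unfolding id by simp
  then have "(?x*p+?y*r)\<^sup>2 + (?x*q+?y * s)\<^sup>2 \<le> ?N / det H * ?Q"
    using D by (simp add: field_simps)
  then show ?thesis
    using D unfolding quadratic_form_2 sym sum_2
    by (simp add: covector_norm_sq_eq cmod_power2 sym p_def q_def r_def s_def)
qed

lemma covector_norm_sq_nonneg:
  assumes "positive_form H" shows "covector_norm_sq H \<omega> \<ge> 0"
proof -
  have p: "axis 1 1 \<bullet> (H *v axis 1 1) > 0"
    using assms by (auto simp: positive_form_def)
  have "0 \<le> covector_norm_sq H \<omega> * (axis 1 1 \<bullet> (H *v axis 1 1))"
    using covector_norm_sq_ge[OF assms, of "axis 1 1" \<omega>] zero_le_power2 order_trans by blast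
  then show ?thesis using p by (simp add: zero_le_mult_iff)
qed

section \<open>Change of variables for nonnegative integrals\<close>

lemma nn_integral_lborel_absolutely_integrable:
  fixes f :: "real^2 \<Rightarrow> real"
  assumes "f \<in> borel_measurable borel" "\<And>x. f x \<ge> 0"
  shows "f absolutely_integrable_on UNIV \<longleftrightarrow> (\<integral>\<^sup>+x. ennreal (f x) \<partial>lborel) < \<infinity>"
    and "f absolutely_integrable_on UNIV \<Longrightarrow> (\<integral>\<^sup>+x. ennreal (f x) \<partial>lborel) = ennreal (integral UNIV f)"
proof -
  have m: "f \<in> borel_measurable lborel" using assms by simp
  have "f absolutely_integrable_on UNIV \<longleftrightarrow> integrable lborel f"
    using m by (simp add: set_integrable_def integrable_completion)
  also have i: "\<dots> \<longleftrightarrow> (\<integral>\<^sup>+x. ennreal (f x) \<partial>lborel) < \<infinity>"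
    using m assms(2) by (simp add: integrable_iff_bounded)
  finally show "f absolutely_integrable_on UNIV \<longleftrightarrow> (\<integral>\<^sup>+x. ennreal (f x) \<partial>lborel) < \<infinity>" .
  show "(\<integral>\<^sup>+x. ennreal (f x) \<partial>lborel) = ennreal (integral UNIV f)" if "f absolutely_integrable_on UNIV"
  proof -
    have int: "integrable lborel f"
      using that m by (simp add: set_integrable_def integrable_completion)
    then have "integral UNIV f = lebesgue_integral lborel f"
      using has_integral_integral_lborel[of f] by (simp add: integral_unique)
    then show ?thesis
      using int assms(2) by (simp add: nn_integral_eq_integral)
  qed
qed

text \<open>For nonnegative integrands the two sides are absolutely integrable together, and
  otherwise both integrals are infinite; so no integrability has to be assumed.\<close>

lemma nn_integral_change_of_variables:
  fixes f :: "real^2 \<Rightarrow> real" and g :: "real^2 \<Rightarrow> real^2"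
  assumes S: "S \<in> sets borel"
    and der: "\<And>x. x \<in> S \<Longrightarrow> (g has_derivative g' x) (at x)"
    and inj: "inj_on g S"
    and f: "\<And>x. f x \<ge> 0"
    and m1: "(\<lambda>x. f x * indicator (g ` S) x) \<in> borel_measurable borel"
    and m2: "(\<lambda>x. \<bar>det (matrix (g' x))\<bar> * f (g x) * indicator S x) \<in> borel_measurable borel"
  shows "(\<integral>\<^sup>+x. ennreal (f x * indicator (g ` S) x) \<partial>lborel) =
    (\<integral>\<^sup>+x. ennreal (\<bar>det (matrix (g' x))\<bar> * f (g x) * indicator S x) \<partial>lborel)" (is "?L = ?R")
proof -
  let ?l = "\<lambda>x. f x * indicator (g ` S) x"
  let ?r = "\<lambda>x. \<bar>det (matrix (g' x))\<bar> * f (g x) * indicator S x"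
  let ?v = "\<lambda>x. vec (f x) :: real^1"
  \<comment> \<open>The theorem on absolute integrals concerns vector values, so the integrand is
    regarded as a map into \<open>real^1\<close>.\<close>
  have eq: "(\<lambda>x. \<bar>det (matrix (g' x))\<bar> *\<^sub>R ?v (g x)) absolutely_integrable_on S \<and>
           integral S (\<lambda>x. \<bar>det (matrix (g' x))\<bar> *\<^sub>R ?v (g x)) = b
     \<longleftrightarrow> ?v absolutely_integrable_on (g ` S) \<and> integral (g ` S) ?v = b" for b
    by (rule has_absolute_integral_change_of_variables)
      (use S der inj in \<open>auto intro: has_derivative_at_withinI\<close>)
  have vec1: "(\<lambda>x. vec (h x) :: real^1) absolutely_integrable_on T \<longleftrightarrow> h absolutely_integrable_on T"
    "integral T (\<lambda>x. vec (h x) :: real^1) = vec (integral T h)" for h T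
    by (auto simp: absolutely_integrable_on_1_iff integral_on_1_eq)
  have UN1: "h absolutely_integrable_on T \<longleftrightarrow> (\<lambda>x. h x * indicator T x) absolutely_integrable_on UNIV"
    for h :: "real^2 \<Rightarrow> real" and T
    by (auto simp: set_integrable_def mult.commute)
  have UN2: "integral T h = integral UNIV (\<lambda>x. h x * indicator T x)"
    for h :: "real^2 \<Rightarrow> real" and T
    by (auto simp: Henstock_Kurzweil_Integration.integral_restrict_UNIV[symmetric, of T] indicator_def
        intro!: integral_cong)
  have "(?r absolutely_integrable_on UNIV \<and> integral UNIV ?r = b) \<longleftrightarrow>
     (?l absolutely_integrable_on UNIV \<and> integral UNIV ?l = b)" for b
    using eq[of "vec b"] UN1[of S "\<lambda>x. \<bar>det (matrix (g' x))\<bar> * f (g x)"]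
      UN2[of S "\<lambda>x. \<bar>det (matrix (g' x))\<bar> * f (g x)"] UN1[of "g ` S" f] UN2[of "g ` S" f]
    by (simp add: vec1 vec_scaleR[symmetric] del: vec_scaleR)
  then have iff: "?r absolutely_integrable_on UNIV \<longleftrightarrow> ?l absolutely_integrable_on UNIV"
    "?l absolutely_integrable_on UNIV \<Longrightarrow> integral UNIV ?r = integral UNIV ?l" by blast+
  note L = nn_integral_lborel_absolutely_integrable[OF m1]
  note R = nn_integral_lborel_absolutely_integrable[OF m2]
  show ?thesis
  proof (cases "?l absolutely_integrable_on UNIV")
    case True
    then show ?thesis using L(2) R(2) iff f by (simp add: mult_nonneg_nonneg)
  next
    case False
    then have "?L = \<infinity>" "?R = \<infinity>" using L(1) R(1) iff f
      by (auto simp: top.not_eq_extremum[symmetric])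
    then show ?thesis by simp
  qed
qed

section \<open>Charts\<close>

text \<open>What \<open>smooth_atlas\<close> demands of a single chart, without membership in an
  atlas; the annular charts will satisfy it too.\<close>

definition surface_chart :: "'a topology \<Rightarrow> 'a chart \<Rightarrow> bool" where
  "surface_chart X c \<longleftrightarrow> openin X (chart_dom c) \<and> open (chart_range c) \<and>
     homeomorphic_map (subtopology X (chart_dom c)) (top_of_set (chart_range c)) (chart_map c)"

lemma chart_map_in_range: "p \<in> chart_dom c \<Longrightarrow> chart_map c p \<in> chart_range c"
  by (simp add: chart_range_def)

lemma chart_inv_in_dom: "y \<in> chart_range c \<Longrightarrow> chart_inv c y \<in> chart_dom c"
  by (simp add: chart_range_def chart_inv_def inv_into_into)

lemma chart_map_inv: "y \<in> chart_range c \<Longrightarrow> chart_map c (chart_inv c y) = y"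
  by (simp add: chart_range_def chart_inv_def f_inv_into_f)

context
  fixes X :: "'a topology" and c :: "'a chart"
  assumes c: "surface_chart X c"
begin

lemma chart_dom_subset: "chart_dom c \<subseteq> topspace X"
  using c openin_subset by (auto simp: surface_chart_def)

lemma topspace_chart_dom: "topspace (subtopology X (chart_dom c)) = chart_dom c"
  using chart_dom_subset by (auto simp: topspace_subtopology)

lemma inj_on_chart: "inj_on (chart_map c) (chart_dom c)"
  using c topspace_chart_dom by (metis surface_chart_def homeomorphic_imp_injective_map)

lemma chart_inv_map: "p \<in> chart_dom c \<Longrightarrow> chart_inv c (chart_map c p) = p"
  by (simp add: chart_inv_def inj_on_chart)

text \<open>\<open>chart_inv\<close> is built from \<open>inv_into\<close>; on the range it agrees
  with the continuous inverse that the homeomorphism provides.\<close>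

lemma continuous_chart_inv: "continuous_map (top_of_set (chart_range c)) X (chart_inv c)"
proof -
  obtain g where g: "homeomorphic_maps (subtopology X (chart_dom c)) (top_of_set (chart_range c)) (chart_map c) g"
    using c by (auto simp: surface_chart_def homeomorphic_map_maps)
  have "continuous_map (top_of_set (chart_range c)) (subtopology X (chart_dom c)) (chart_inv c)"
  proof (rule continuous_map_eq)
    show "continuous_map (top_of_set (chart_range c)) (subtopology X (chart_dom c)) g"
      using g by (simp add: homeomorphic_maps_def)
    show "g y = chart_inv c y" if "y \<in> topspace (top_of_set (chart_range c))" for y
    proof -
      have y: "y \<in> chart_range c" using that by simp
      have "g (chart_map c (chart_inv c y)) = chart_inv c y"
        using g chart_inv_in_dom[OF y] unfolding homeomorphic_maps_def topspace_chart_dom by blast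
      then show ?thesis using chart_map_inv[OF y] by simp
    qed
  qed
  then show ?thesis by (rule continuous_map_into_fulltopology)
qed

lemma continuous_chart_map: "continuous_map (subtopology X (chart_dom c)) euclidean (chart_map c)"
proof -
  have "continuous_map (subtopology X (chart_dom c)) (top_of_set (chart_range c)) (chart_map c)"
    using c by (simp add: surface_chart_def homeomorphic_imp_continuous_map)
  then show ?thesis by (rule continuous_map_into_fulltopology)
qed

lemma open_chart_preimage:
  assumes "openin X U" shows "open (chart_range c \<inter> chart_inv c -` U)"
proof -
  have "openin (top_of_set (chart_range c)) {y \<in> chart_range c. chart_inv c y \<in> U}"
    using openin_continuous_map_preimage[OF continuous_chart_inv assms] by simp
  moreover have "{y \<in> chart_range c. chart_inv c y \<in> U} = chart_range c \<inter> chart_inv c -` U" by auto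
  moreover have "open (chart_range c)" using c by (simp add: surface_chart_def)
  ultimately show ?thesis by (simp add: openin_open_eq)
qed

lemma chart_image_eq: "U \<subseteq> chart_dom c \<Longrightarrow> chart_map c ` U = chart_range c \<inter> chart_inv c -` U"
proof (intro equalityI subsetI)
  fix y assume U: "U \<subseteq> chart_dom c" and "y \<in> chart_map c ` U"
  then obtain p where p: "p \<in> U" "y = chart_map c p" by blast
  then have "p \<in> chart_dom c" using U by blast
  then show "y \<in> chart_range c \<inter> chart_inv c -` U"
    using p by (simp add: chart_inv_map chart_map_in_range)
next
  fix y assume "y \<in> chart_range c \<inter> chart_inv c -` U"
  then have "y \<in> chart_range c" "chart_inv c y \<in> U" by auto
  then show "y \<in> chart_map c ` U"
    using chart_map_inv[of y c] by (metis imageI)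
qed

lemma open_chart_image:
  assumes "openin X U" shows "open (chart_map c ` (chart_dom c \<inter> U))"
proof -
  have "openin X (chart_dom c \<inter> U)" using c assms by (auto simp: surface_chart_def)
  then show ?thesis using open_chart_preimage[of "chart_dom c \<inter> U"] chart_image_eq[of "chart_dom c \<inter> U"]
    by (simp del: vimage_Int)
qed

lemma openin_chart_preimage:
  assumes "open V" shows "openin X (chart_dom c \<inter> chart_map c -` V)"
proof -
  have "openin (subtopology X (chart_dom c)) {p \<in> chart_dom c. chart_map c p \<in> V}"
    using openin_continuous_map_preimage[OF continuous_chart_map, of V] assms
    unfolding topspace_chart_dom by simp
  moreover have "{p \<in> chart_dom c. chart_map c p \<in> V} = chart_dom c \<inter> chart_map c -` V" by auto
  moreover have "openin X (chart_dom c)" using c by (simp add: surface_chart_def)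
  ultimately show ?thesis by (metis openin_open_subtopology)
qed

end

section \<open>Change of coordinates for derivatives and covectors\<close>

lemma transition_map:
  "surface_chart X c \<Longrightarrow> p \<in> chart_dom c \<Longrightarrow> transition c d (chart_map c p) = chart_map d p"
  by (simp add: transition_def chart_inv_map)

lemma has_derivative_jacobian:
  "f differentiable (at y) \<Longrightarrow> (f has_derivative (*v) (jacobian f (at y))) (at y)"
  for f :: "real^'n \<Rightarrow> real^'m"
  using jacobian_works by metis

text \<open>On the open image of the overlap, \<open>q\<close> read in \<open>c\<close> is
  \<open>q\<close> read in \<open>d\<close> after the transition, so this is the chain rule.\<close>

lemma change_of_chart_has_derivative:
  assumes c: "surface_chart X c" and d: "surface_chart X d" and p: "p \<in> chart_dom c \<inter> chart_dom d"
    and t: "transition c d differentiable (at (chart_map c p))"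
    and q: "(q \<circ> chart_inv d) differentiable (at (chart_map d p))"
  shows "(q \<circ> chart_inv c has_derivative
    (\<lambda>v. frechet_derivative (q \<circ> chart_inv d) (at (chart_map d p)) (transition_jacobian c d p *v v)))
    (at (chart_map c p))"
proof (rule has_derivative_transform_within_open)
  have t': "(transition c d has_derivative (*v) (transition_jacobian c d p)) (at (chart_map c p))"
    using has_derivative_jacobian[OF t] by (simp add: transition_jacobian_def)
  have q': "(q \<circ> chart_inv d has_derivative frechet_derivative (q \<circ> chart_inv d) (at (chart_map d p)))
     (at (transition c d (chart_map c p)))"
    using has_frechet_derivative[OF q] p transition_map[OF c] by simp
  show "((q \<circ> chart_inv d) \<circ> transition c d has_derivative
    (\<lambda>v. frechet_derivative (q \<circ> chart_inv d) (at (chart_map d p)) (transition_jacobian c d p *v v)))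
    (at (chart_map c p))"
    using diff_chain_at[OF t' q'] by (simp add: o_def)
  show "open (chart_map c ` (chart_dom c \<inter> chart_dom d))"
    using open_chart_image[OF c] d by (auto simp: surface_chart_def)
  show "chart_map c p \<in> chart_map c ` (chart_dom c \<inter> chart_dom d)"
    using p by blast
  show "(q \<circ> chart_inv d \<circ> transition c d) y = (q \<circ> chart_inv c) y"
    if "y \<in> chart_map c ` (chart_dom c \<inter> chart_dom d)" for y
    using that chart_inv_map[OF c] chart_inv_map[OF d] by (auto simp: transition_def)
qed

lemma vec_axis_expansion_2: "v = (\<Sum>k\<in>UNIV. v$k *\<^sub>R axis k (1::real))" for v :: "real^2"
  by (simp add: vec_eq_iff forall_2 sum_2 axis_def)

lemma frechet_derivative_partial:
  assumes "f differentiable (at y)"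
  shows "frechet_derivative f (at y) v = (\<Sum>k\<in>UNIV. v$k *\<^sub>R partial_deriv k f y)"
proof -
  have l: "linear (frechet_derivative f (at y))" by (rule linear_frechet_derivative[OF assms])
  show ?thesis
    by (subst vec_axis_expansion_2[of v])
      (simp add: linear_sum[OF l] linear_cmul[OF l] partial_deriv_def)
qed

lemma change_of_chart_partial_deriv:
  assumes "surface_chart X c" "surface_chart X d" "p \<in> chart_dom c \<inter> chart_dom d"
    and "transition c d differentiable (at (chart_map c p))"
    and "(q \<circ> chart_inv d) differentiable (at (chart_map d p))"
  shows "partial_deriv i (q \<circ> chart_inv c) (chart_map c p) =
    (\<Sum>k\<in>UNIV. transition_jacobian c d p $ k $ i *\<^sub>R partial_deriv k (q \<circ> chart_inv d) (chart_map d p))"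
proof -
  have "(transition_jacobian c d p *v axis i 1) $ k = transition_jacobian c d p $ k $ i" for k
    by (simp add: matrix_vector_mult_basis column_def)
  then show ?thesis
    using frechet_derivative_eq[OF change_of_chart_has_derivative[OF assms]]
      frechet_derivative_partial[OF assms(5), of "transition_jacobian c d p *v axis i 1"]
    unfolding partial_deriv_def by simp
qed

text \<open>Both \<open>du\<close> and \<open>A\<close> are covectors and \<open>u p\<close> is a
  scalar, so the combination transforms like a covector.\<close>

lemma magnetic_differential_change_of_chart:
  assumes "surface_chart X c" "surface_chart X d" "p \<in> chart_dom c \<inter> chart_dom d"
    and "transition c d differentiable (at (chart_map c p))"
    and "(u \<circ> chart_inv d) differentiable (at (chart_map d p))"
    and A: "A c p = transpose (transition_jacobian c d p) *v A d p"
  shows "magnetic_differential A u c p =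
    (\<chi> i. \<Sum>k\<in>UNIV. of_real (transition_jacobian c d p $ k $ i) * magnetic_differential A u d p $ k)"
  unfolding magnetic_differential_def change_of_chart_partial_deriv[OF assms(1-5)]
  by (simp add: vec_eq_iff A matrix_vector_mult_def transpose_def sum_2 scaleR_conv_of_real algebra_simps)

lemma smooth_atlas_chart: "smooth_atlas X \<A> \<Longrightarrow> c \<in> \<A> \<Longrightarrow> surface_chart X c"
  by (auto simp: smooth_atlas_def surface_chart_def)

lemma smooth_atlas_transition:
  "smooth_atlas X \<A> \<Longrightarrow> c \<in> \<A> \<Longrightarrow> d \<in> \<A> \<Longrightarrow> p \<in> chart_dom c \<inter> chart_dom d \<Longrightarrow>
    transition c d differentiable (at (chart_map c p))"
  unfolding smooth_atlas_def by (blast intro: smooth_map_on_differentiable)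

text \<open>A chart outside of the atlas with differentiable coordinate changes; tensors have components
  in such charts, too, and the charts of the atlas are a special case.\<close>

definition compatible_chart :: "'a topology \<Rightarrow> 'a chart set \<Rightarrow> 'a chart \<Rightarrow> bool" where
  "compatible_chart X \<A> d \<longleftrightarrow> surface_chart X d \<and>
     (\<forall>c\<in>\<A>. \<forall>p\<in>chart_dom c \<inter> chart_dom d.
        transition c d differentiable (at (chart_map c p)) \<and>
        transition d c differentiable (at (chart_map d p)))"

definition metric_components :: "'a chart set \<Rightarrow> 'a metric_tensor \<Rightarrow> 'a chart \<Rightarrow> bool" where
  "metric_components \<A> h d \<longleftrightarrow>
     continuous_on (chart_range d) (h d \<circ> chart_inv d) \<and>
     (\<forall>p\<in>chart_dom d. positive_form (h d p)) \<and>
     (\<forall>c\<in>\<A>. \<forall>p\<in>chart_dom c \<inter> chart_dom d.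
        h c p = transpose (transition_jacobian c d p) ** h d p ** transition_jacobian c d p)"

lemma atlas_compatible:
  assumes "smooth_atlas X \<A>" "d \<in> \<A>"
  shows "compatible_chart X \<A> d"
  unfolding compatible_chart_def
proof (intro conjI ballI)
  show "surface_chart X d" by (rule smooth_atlas_chart[OF assms])
  fix c p assume cp: "c \<in> \<A>" "p \<in> chart_dom c \<inter> chart_dom d"
  show "transition c d differentiable (at (chart_map c p))"
    by (rule smooth_atlas_transition[OF assms(1) cp(1) assms(2) cp(2)])
  show "transition d c differentiable (at (chart_map d p))"
    by (rule smooth_atlas_transition[OF assms cp(1)]) (use cp in blast)
qed

lemma riemannian_metric_components:
  assumes h: "riemannian_metric \<A> h" and d: "d \<in> \<A>"
  shows "metric_components \<A> h d"
  unfolding metric_components_def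
proof (intro conjI ballI)
  note h = h[unfolded riemannian_metric_def]
  show "continuous_on (chart_range d) (h d \<circ> chart_inv d)"
    by (rule smooth_map_on_continuous[OF bspec[OF conjunct1[OF h] d]])
  show "positive_form (h d p)" if "p \<in> chart_dom d" for p
    unfolding positive_form_def by (rule bspec[OF bspec[OF conjunct1[OF conjunct2[OF h]] d] that])
  show "h c p = transpose (transition_jacobian c d p) ** h d p ** transition_jacobian c d p"
    if "c \<in> \<A>" "p \<in> chart_dom c \<inter> chart_dom d" for c p
    by (rule bspec[OF bspec[OF bspec[OF conjunct2[OF conjunct2[OF h]] that(1)] d] that(2)])
qed

lemma metric_components_change:
  assumes "metric_components \<A> h d" "c \<in> \<A>" "p \<in> chart_dom c \<inter> chart_dom d"
  shows "h c p = transpose (transition_jacobian c d p) ** h d p ** transition_jacobian c d p"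
  using bspec[OF bspec[OF conjunct2[OF conjunct2[OF assms(1)[unfolded metric_components_def]]] assms(2)] assms(3)] .

lemma metric_components_det:
  assumes "metric_components \<A> h d" "c \<in> \<A>" "p \<in> chart_dom c \<inter> chart_dom d"
  shows "det (h c p) = (det (transition_jacobian c d p))\<^sup>2 * det (h d p)"
  unfolding metric_components_change[OF assms] by (rule det_congruence)

section \<open>The Riemannian measure\<close>

lemma metric_components_positive:
  assumes "metric_components \<A> h d" "p \<in> chart_dom d"
  shows "positive_form (h d p)"
  using bspec[OF conjunct1[OF conjunct2[OF assms(1)[unfolded metric_components_def]]] assms(2)] .

lemma metric_components_continuous:
  "metric_components \<A> h d \<Longrightarrow> continuous_on (chart_range d) (\<lambda>y. h d (chart_inv d y))"
  unfolding metric_components_def o_def by (rule conjunct1)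

lemma compatible_surface_chart: "compatible_chart X \<A> d \<Longrightarrow> surface_chart X d"
  unfolding compatible_chart_def by (rule conjunct1)

lemma compatible_transition:
  assumes "compatible_chart X \<A> d" "c \<in> \<A>" "p \<in> chart_dom c" "p \<in> chart_dom d"
  shows "transition c d differentiable (at (chart_map c p))"
    and "transition d c differentiable (at (chart_map d p))"
  using bspec[OF bspec[OF conjunct2[OF assms(1)[unfolded compatible_chart_def]] assms(2)], of p] assms(3,4)
  by simp_all

definition borel_of_surface :: "'a topology \<Rightarrow> 'a measure" where
  "borel_of_surface X = sigma (topspace X) {U. openin X U}"

lemma space_borel_of_surface [simp]: "space (borel_of_surface X) = topspace X"
  unfolding borel_of_surface_def by (rule space_measure_of) (auto dest: openin_subset)

lemma sets_borel_of_surface: "sets (borel_of_surface X) = sigma_sets (topspace X) {U. openin X U}"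
  unfolding borel_of_surface_def by (rule sets_measure_of) (auto dest: openin_subset)

lemma openin_borel_of_surface: "openin X U \<Longrightarrow> U \<in> sets (borel_of_surface X)"
  unfolding sets_borel_of_surface by (rule sigma_sets.Basic) simp

lemma continuous_map_borel_of_surface:
  fixes f :: "'a \<Rightarrow> 'b::topological_space"
  assumes "continuous_map X euclidean f"
  shows "f \<in> borel_measurable (borel_of_surface X)"
proof (rule borel_measurableI)
  fix S :: "'b set" assume "open S"
  then have "openin X {x \<in> topspace X. f x \<in> S}"
    using openin_continuous_map_preimage[OF assms, of S] by simp
  moreover have "{x \<in> topspace X. f x \<in> S} = f -` S \<inter> space (borel_of_surface X)" by auto
  ultimately show "f -` S \<inter> space (borel_of_surface X) \<in> sets (borel_of_surface X)"
    using openin_borel_of_surface by metis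
qed

text \<open>The inverse chart made total, as a measurable map on the whole plane. Off the range its
  value is an arbitrary point of the surface; \<open>chart_density\<close> vanishes there.\<close>

definition chart_extension :: "'a topology \<Rightarrow> 'a chart \<Rightarrow> real^2 \<Rightarrow> 'a" where
  "chart_extension X c y = (if y \<in> chart_range c then chart_inv c y else (SOME p. p \<in> topspace X))"

lemma chart_extension_measurable:
  assumes c: "surface_chart X c" and ne: "topspace X \<noteq> {}"
  shows "chart_extension X c \<in> borel \<rightarrow>\<^sub>M borel_of_surface X"
  unfolding borel_of_surface_def
proof (rule measurable_measure_of)
  have some: "(SOME p. p \<in> topspace X) \<in> topspace X" using ne by (simp add: some_in_eq)
  show "{U. openin X U} \<subseteq> Pow (topspace X)" by (auto dest: openin_subset)
  show "chart_extension X c \<in> space borel \<rightarrow> topspace X"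
    using some subsetD[OF chart_dom_subset[OF c] chart_inv_in_dom] by (auto simp: chart_extension_def)
  fix U assume "U \<in> {U. openin X U}"
  then have "open (chart_range c \<inter> chart_inv c -` U)" "open (chart_range c)"
    using open_chart_preimage[OF c, of U] c by (simp_all add: surface_chart_def)
  then have "(chart_range c \<inter> chart_inv c -` U) \<union> (if (SOME p. p \<in> topspace X) \<in> U then - chart_range c else {}) \<in> sets borel"
    by auto
  moreover have "chart_extension X c -` U \<inter> space borel =
     (chart_range c \<inter> chart_inv c -` U) \<union> (if (SOME p. p \<in> topspace X) \<in> U then - chart_range c else {})"
    by (auto simp: chart_extension_def split: if_splits)
  ultimately show "chart_extension X c -` U \<inter> space borel \<in> sets borel" by simp
qed

text \<open>An image under the chart is the part in the range of a preimage under the extended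
  inverse chart, which is measurable.\<close>

lemma chart_image_measurable:
  assumes c: "surface_chart X c" and E: "E \<in> sets (borel_of_surface X)" "E \<subseteq> chart_dom c"
  shows "chart_map c ` E \<in> sets borel"
proof (cases "topspace X = {}")
  case True
  then show ?thesis using E sets.sets_into_space[OF E(1)] by auto
next
  case False
  have "chart_extension X c -` E \<inter> space borel \<in> sets borel"
    by (rule measurable_sets[OF chart_extension_measurable[OF c False] E(1)])
  moreover have "chart_range c \<in> sets borel" using c by (auto simp: surface_chart_def)
  ultimately have "chart_range c \<inter> (chart_extension X c -` E \<inter> space borel) \<in> sets borel" by blast
  moreover have "chart_range c \<inter> (chart_extension X c -` E \<inter> space borel) = chart_map c ` E"
    unfolding chart_image_eq[OF c E(2)] by (auto simp: chart_extension_def)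
  ultimately show ?thesis by simp
qed

definition chart_density :: "'a metric_tensor \<Rightarrow> 'a chart \<Rightarrow> real^2 \<Rightarrow> real" where
  "chart_density h c y = sqrt (det (h c (chart_inv c y))) * indicator (chart_range c) y"

definition chart_volume :: "'a metric_tensor \<Rightarrow> 'a chart \<Rightarrow> 'a set \<Rightarrow> ennreal" where
  "chart_volume h c E = (\<integral>\<^sup>+ y. ennreal (chart_density h c y) * indicator (chart_map c ` E) y \<partial>lborel)"

lemma continuous_on_det_2: "continuous_on S f \<Longrightarrow> continuous_on S (\<lambda>x. det (f x :: real^2^2))"
  unfolding det_2 by (intro continuous_intros)

lemma chart_density_continuous:
  assumes "metric_components \<A> h d"
  shows "continuous_on (chart_range d) (\<lambda>y. sqrt (det (h d (chart_inv d y))))"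
  by (intro continuous_on_real_sqrt continuous_on_det_2 metric_components_continuous[OF assms])

lemma chart_density_measurable [measurable]:
  assumes "surface_chart X d" "metric_components \<A> h d"
  shows "chart_density h d \<in> borel_measurable borel"
proof -
  have "chart_range d \<in> sets borel" using assms(1) by (auto simp: surface_chart_def)
  from borel_measurable_continuous_on_indicator[OF this chart_density_continuous[OF assms(2)]]
  show ?thesis by (simp add: chart_density_def[abs_def] mult.commute)
qed

lemma chart_density_nonneg:
  assumes "metric_components \<A> h d"
  shows "chart_density h d y \<ge> 0"
proof (cases "y \<in> chart_range d")
  case True
  then have "positive_form (h d (chart_inv d y))"
    using metric_components_positive[OF assms] chart_inv_in_dom by blast
  then show ?thesis using positive_form_det by (auto simp: chart_density_def less_imp_le)
qed (simp add: chart_density_def)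

lemma chart_volume_alt:
  "E \<subseteq> chart_dom c \<Longrightarrow> chart_volume h c E =
    (\<integral>\<^sup>+ y. ennreal (sqrt (det (h c (chart_inv c y)))) * indicator (chart_map c ` E) y \<partial>lborel)"
  unfolding chart_volume_def chart_density_def
  by (rule nn_integral_cong) (auto simp: indicator_def chart_range_def)

text \<open>The root of the Gram determinant is multiplied by the absolute value of the Jacobian
  determinant, exactly as Lebesgue measure requires. The chart \<open>d\<close> may lie outside the
  atlas.\<close>

lemma chart_volume_change:
  assumes atlas: "smooth_atlas X \<A>" and c: "c \<in> \<A>" and hc: "metric_components \<A> h c"
    and d: "compatible_chart X \<A> d" and hd: "metric_components \<A> h d"
    and E: "E \<in> sets (borel_of_surface X)" "E \<subseteq> chart_dom c \<inter> chart_dom d"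
  shows "chart_volume h c E = chart_volume h d E"
proof -
  have cc: "surface_chart X c" and cd: "surface_chart X d"
    using smooth_atlas_chart[OF atlas c] compatible_surface_chart[OF d] .
  let ?S = "chart_map c ` E"
  let ?t = "transition c d"
  let ?J = "\<lambda>y. jacobian ?t (at y)"
  have S: "?S \<in> sets borel" and S': "chart_map d ` E \<in> sets borel"
    using E by (auto intro!: chart_image_measurable[OF cc] chart_image_measurable[OF cd])
  have tS: "?t ` ?S = chart_map d ` E"
    unfolding image_image using E by (intro image_cong refl transition_map[OF cc]) auto
  have der: "(?t has_derivative (*v) (?J y)) (at y)" if "y \<in> ?S" for y
  proof -
    obtain p where "p \<in> E" "y = chart_map c p" using \<open>y \<in> ?S\<close> by blast
    then show ?thesis
      using has_derivative_jacobian[OF compatible_transition(1)[OF d c, of p]] E by blast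
  qed
  have inj: "inj_on ?t ?S"
  proof (rule inj_onI)
    fix y z assume "y \<in> ?S" "z \<in> ?S" and eq: "?t y = ?t z"
    then obtain p q where pq: "p \<in> E" "y = chart_map c p" "q \<in> E" "z = chart_map c q" by blast
    then have "chart_map d p = chart_map d q"
      using eq subsetD[OF E(2)] transition_map[OF cc, of p d] transition_map[OF cc, of q d] by simp
    then show "y = z"
      using inj_onD[OF inj_on_chart[OF cd]] pq E by blast
  qed
  have eq: "\<bar>det (?J y)\<bar> * chart_density h d (?t y) * indicator ?S y = chart_density h c y * indicator ?S y" for y
  proof (cases "y \<in> ?S")
    case True
    then obtain p where p: "p \<in> E" "y = chart_map c p" by blast
    have pc: "p \<in> chart_dom c" "p \<in> chart_dom d" using p E by auto
    have "det (h c p) = (det (?J y))\<^sup>2 * det (h d p)"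
      using metric_components_det[OF hd c, of p] pc p by (simp add: transition_jacobian_def)
    then have "sqrt (det (h c p)) = \<bar>det (?J y)\<bar> * sqrt (det (h d p))"
      by (simp add: real_sqrt_mult)
    then show ?thesis
      using pc p by (simp add: chart_density_def transition_map[OF cc] chart_inv_map[OF cc]
          chart_inv_map[OF cd] chart_map_in_range)
  qed simp
  have "chart_volume h d E = (\<integral>\<^sup>+ y. ennreal (chart_density h d y * indicator (?t ` ?S) y) \<partial>lborel)"
    unfolding chart_volume_def tS by (intro nn_integral_cong) (auto simp: indicator_def)
  also have "\<dots> = (\<integral>\<^sup>+ y. ennreal (\<bar>det (matrix ((*v) (?J y)))\<bar> * chart_density h d (?t y) * indicator ?S y) \<partial>lborel)"
  proof (rule nn_integral_change_of_variables[OF S der inj])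
    show "0 \<le> chart_density h d x" for x by (rule chart_density_nonneg[OF hd])
    note [measurable] = S S' chart_density_measurable[OF cd hd] chart_density_measurable[OF cc hc]
    show "(\<lambda>x. chart_density h d x * indicator (?t ` ?S) x) \<in> borel_measurable borel"
      unfolding tS by measurable
    show "(\<lambda>x. \<bar>det (matrix ((*v) (?J x)))\<bar> * chart_density h d (?t x) * indicator ?S x) \<in> borel_measurable borel"
      unfolding matrix_of_matrix_vector_mul eq by measurable
  qed
  also have "\<dots> = chart_volume h c E"
    unfolding matrix_of_matrix_vector_mul eq chart_volume_def
    by (intro nn_integral_cong) (auto simp: indicator_def)
  finally show ?thesis ..
qed

lemma chart_volume_countably_additive:
  assumes d: "surface_chart X d" and hd: "metric_components \<A> h d"
    and E: "\<And>i::nat. E i \<in> sets (borel_of_surface X)" "\<And>i. E i \<subseteq> chart_dom d" "disjoint_family E"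
  shows "(\<lambda>i. chart_volume h d (E i)) sums chart_volume h d (\<Union>i. E i)"
proof -
  let ?m = "density lborel (\<lambda>y. ennreal (chart_density h d y))"
  note [measurable] = chart_density_measurable[OF d hd]
  have em: "chart_volume h d F = emeasure ?m (chart_map d ` F)"
    if "F \<in> sets (borel_of_surface X)" "F \<subseteq> chart_dom d" for F
    unfolding chart_volume_def using chart_image_measurable[OF d that]
    by (subst emeasure_density) auto
  have "(\<lambda>i. emeasure ?m (chart_map d ` E i)) sums emeasure ?m (\<Union>i. chart_map d ` E i)"
  proof -
    have "disjoint_family (\<lambda>i. chart_map d ` E i)"
      using E(2,3) inj_on_chart[OF d] unfolding disjoint_family_on_def
      by (metis image_empty inj_on_image_Int)
    then have "(\<Sum>i. emeasure ?m (chart_map d ` E i)) = emeasure ?m (\<Union>i. chart_map d ` E i)"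
      using chart_image_measurable[OF d] E by (intro suminf_emeasure) auto
    then show ?thesis by (metis summableI summable_sums)
  qed
  moreover have "(\<Union>i. E i) \<in> sets (borel_of_surface X)" "(\<Union>i. E i) \<subseteq> chart_dom d"
    using E by auto
  ultimately show ?thesis using em E by (simp add: image_UN)
qed

lemma is_riemannian_measureD:
  assumes m: "is_riemannian_measure X \<A> h m"
  shows "space m = topspace X" and "sets m = sets (borel_of_surface X)"
    and "c \<in> \<A> \<Longrightarrow> E \<in> sets m \<Longrightarrow> E \<subseteq> chart_dom c \<Longrightarrow> emeasure m E = chart_volume h c E"
proof -
  note m = m[unfolded is_riemannian_measure_def]
  show "space m = topspace X" by (rule conjunct1[OF m])
  show "sets m = sets (borel_of_surface X)"
    unfolding sets_borel_of_surface by (rule conjunct1[OF conjunct2[OF m]])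
  show "emeasure m E = chart_volume h c E" if "c \<in> \<A>" "E \<in> sets m" "E \<subseteq> chart_dom c"
    unfolding chart_volume_alt[OF that(3)]
    by (rule bspec[OF bspec[OF conjunct2[OF conjunct2[OF m]] that(1)] that(2), rule_format, OF that(3)])
qed

section \<open>Construction of the Riemannian measure on a compact surface\<close>

locale compact_riemannian_surface =
  fixes X :: "'a topology" and \<A> :: "'a chart set" and h :: "'a metric_tensor"
  assumes surface: "smooth_surface X \<A>" and compact: "compact_space X"
    and metric: "riemannian_metric \<A> h"
begin

lemma atlas: "smooth_atlas X \<A>"
  using surface by (simp add: smooth_surface_def)

lemma finite_chart_cover:
  obtains cs where "set cs \<subseteq> \<A>" "(\<Union>c\<in>set cs. chart_dom c) = topspace X"
proof -
  have "\<forall>U\<in>chart_dom ` \<A>. openin X U" "\<Union>(chart_dom ` \<A>) = topspace X"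
    using atlas by (auto simp: smooth_atlas_def)
  then obtain F where "finite F" "F \<subseteq> chart_dom ` \<A>" "topspace X \<subseteq> \<Union>F"
    using compact unfolding compact_space_alt by (metis order_refl)
  then obtain C where C: "finite C" "C \<subseteq> \<A>" "F = chart_dom ` C"
    by (metis finite_subset_image)
  obtain cs where "set cs = C" using finite_list[OF C(1)] by auto
  moreover have "(\<Union>c\<in>C. chart_dom c) = topspace X"
  proof
    show "(\<Union>c\<in>C. chart_dom c) \<subseteq> topspace X"
      using C(2) chart_dom_subset[OF smooth_atlas_chart[OF atlas]] by (intro UN_least) blast
    show "topspace X \<subseteq> (\<Union>c\<in>C. chart_dom c)" using \<open>topspace X \<subseteq> \<Union>F\<close> C(3) by simp
  qed
  ultimately show ?thesis using that C(2) by metis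
qed

definition cover :: "'a chart list" where
  "cover = (SOME cs. set cs \<subseteq> \<A> \<and> (\<Union>c\<in>set cs. chart_dom c) = topspace X)"

lemma cover: "set cover \<subseteq> \<A>" "(\<Union>c\<in>set cover. chart_dom c) = topspace X"
proof -
  have "\<exists>cs. set cs \<subseteq> \<A> \<and> (\<Union>c\<in>set cs. chart_dom c) = topspace X"
    by (rule finite_chart_cover) blast
  from someI_ex[OF this, folded cover_def]
  show "set cover \<subseteq> \<A>" "(\<Union>c\<in>set cover. chart_dom c) = topspace X" by auto
qed

text \<open>Subtracting the earlier charts makes the finite cover disjoint, so that local volumes
  can be added without overcounting.\<close>

definition piece :: "nat \<Rightarrow> 'a set" where
  "piece i = chart_dom (cover ! i) - (\<Union>j<i. chart_dom (cover ! j))"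

lemma cover_nth: "i < length cover \<Longrightarrow> cover ! i \<in> \<A>"
  using cover(1) nth_mem by blast

lemma piece_measurable:
  assumes "i < length cover" shows "piece i \<in> sets (borel_of_surface X)"
proof -
  have "chart_dom (cover ! j) \<in> sets (borel_of_surface X)" if "j \<le> i" for j
  proof -
    have "j < length cover" using that assms by simp
    then have "surface_chart X (cover ! j)" by (intro smooth_atlas_chart[OF atlas cover_nth])
    then show ?thesis by (intro openin_borel_of_surface) (simp add: surface_chart_def)
  qed
  then show ?thesis
    unfolding piece_def by (intro sets.Diff sets.finite_UN) auto
qed

lemma piece_subset: "piece i \<subseteq> chart_dom (cover ! i)"
  by (auto simp: piece_def)

lemma piece_disjoint: "disjoint_family piece"
  unfolding disjoint_family_on_def piece_def
  by (auto, metis linorder_neqE_nat lessThan_iff)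

lemma piece_cover: "(\<Union>i<length cover. piece i) = topspace X"
proof
  show "(\<Union>i<length cover. piece i) \<subseteq> topspace X"
    using piece_subset cover(2) nth_mem by fastforce
  show "topspace X \<subseteq> (\<Union>i<length cover. piece i)"
  proof
    fix p assume "p \<in> topspace X"
    then have ex: "\<exists>i. i < length cover \<and> p \<in> chart_dom (cover ! i)"
    proof -
      obtain c where "c \<in> set cover" "p \<in> chart_dom c"
        using \<open>p \<in> topspace X\<close> cover(2) by blast
      then show ?thesis by (metis in_set_conv_nth)
    qed
    let ?i = "LEAST i. i < length cover \<and> p \<in> chart_dom (cover ! i)"
    have i: "?i < length cover" "p \<in> chart_dom (cover ! ?i)" using LeastI_ex[OF ex] by auto
    have "p \<notin> chart_dom (cover ! j)" if "j < ?i" for j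
      using not_less_Least[OF that] that i by auto
    then have "p \<in> piece ?i" using i(2) unfolding piece_def by blast
    then show "p \<in> (\<Union>i<length cover. piece i)" using i(1) by blast
  qed
qed

text \<open>The candidate measure, glued from local formulas; that any other chart gives the same
  values is the content of \<open>volume_chart\<close>.\<close>

definition volume :: "'a set \<Rightarrow> ennreal" where
  "volume E = (\<Sum>i<length cover. chart_volume h (cover ! i) (E \<inter> piece i))"

lemma atlas_components: "c \<in> \<A> \<Longrightarrow> metric_components \<A> h c"
  using riemannian_metric_components[OF metric] .

lemma volume_countably_additive:
  "countably_additive (sets (borel_of_surface X)) volume"
proof (rule countably_additiveI)
  fix E :: "nat \<Rightarrow> 'a set"
  assume E: "range E \<subseteq> sets (borel_of_surface X)" "disjoint_family E"
  have "(\<lambda>n. volume (E n)) sums volume (\<Union>n. E n)"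
    unfolding volume_def
  proof (rule sums_sum)
    fix i assume "i \<in> {..<length cover}"
    then have i: "i < length cover" by simp
    have "(\<lambda>n. chart_volume h (cover ! i) (E n \<inter> piece i)) sums
        chart_volume h (cover ! i) (\<Union>n. E n \<inter> piece i)"
      using E piece_measurable[OF i] piece_subset[of i]
      by (intro chart_volume_countably_additive[OF smooth_atlas_chart[OF atlas cover_nth[OF i]]
            atlas_components[OF cover_nth[OF i]]]) (auto simp: disjoint_family_on_def)
    then show "(\<lambda>n. chart_volume h (cover ! i) (E n \<inter> piece i)) sums
        chart_volume h (cover ! i) ((\<Union>n. E n) \<inter> piece i)"
      by (simp add: Int_UN_distrib2)
  qed
  then show "(\<Sum>n. volume (E n)) = volume (\<Union>n. E n)" by (simp add: sums_iff)
qed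

lemma chart_volume_sum_pieces:
  assumes d: "compatible_chart X \<A> d" and hd: "metric_components \<A> h d"
    and E: "E \<in> sets (borel_of_surface X)" "E \<subseteq> chart_dom d"
  shows "chart_volume h d E = (\<Sum>i<length cover. chart_volume h d (E \<inter> piece i))"
proof -
  have sd: "surface_chart X d" by (rule compatible_surface_chart[OF d])
  \<comment> \<open>The finite partition, continued by empty sets so that countable additivity
    applies.\<close>
  let ?F = "\<lambda>i. if i < length cover then E \<inter> piece i else {}"
  have s1: "(\<lambda>i. chart_volume h d (?F i)) sums chart_volume h d (\<Union>i. ?F i)"
    using piece_disjoint E piece_measurable
    by (intro chart_volume_countably_additive[OF sd hd]) (auto simp: disjoint_family_on_def)
  have "(\<Union>i. ?F i) = E \<inter> (\<Union>i<length cover. piece i)" by (auto split: if_splits)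
  then have F: "(\<Union>i. ?F i) = E"
    using piece_cover E(2) chart_dom_subset[OF sd] by auto
  have s2: "(\<lambda>i. chart_volume h d (?F i)) sums (\<Sum>i<length cover. chart_volume h d (?F i))"
    by (rule sums_finite) (auto simp: chart_volume_def)
  have "chart_volume h d E = (\<Sum>i<length cover. chart_volume h d (?F i))"
    using sums_unique2[OF s1 s2] by (simp only: F)
  then show ?thesis by simp
qed

text \<open>On each piece the formula of the covering chart may be replaced by that of
  \<open>d\<close>, since this part of \<open>E\<close> lies in both domains.\<close>

lemma volume_chart:
  assumes d: "compatible_chart X \<A> d" and hd: "metric_components \<A> h d"
    and E: "E \<in> sets (borel_of_surface X)" "E \<subseteq> chart_dom d"
  shows "volume E = chart_volume h d E"
  unfolding volume_def chart_volume_sum_pieces[OF assms]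
proof (rule sum.cong)
  fix i assume "i \<in> {..<length cover}"
  then have i: "i < length cover" by simp
  show "chart_volume h (cover ! i) (E \<inter> piece i) = chart_volume h d (E \<inter> piece i)"
  proof (rule chart_volume_change[OF atlas cover_nth[OF i] atlas_components[OF cover_nth[OF i]] d hd])
    show "E \<inter> piece i \<in> sets (borel_of_surface X)" using E(1) piece_measurable[OF i] by blast
    show "E \<inter> piece i \<subseteq> chart_dom (cover ! i) \<inter> chart_dom d" using E(2) piece_subset[of i] by blast
  qed
qed simp

lemma is_riemannian_measure_volume:
  "is_riemannian_measure X \<A> h (measure_of (topspace X) {U. openin X U} volume)" (is "is_riemannian_measure _ _ _ ?m")
proof -
  have sp: "{U. openin X U} \<subseteq> Pow (topspace X)" by (auto dest: openin_subset)
  have s: "space ?m = topspace X" "sets ?m = sigma_sets (topspace X) {U. openin X U}"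
    using sp by (auto simp: space_measure_of sets_measure_of)
  have sigma: "sigma_algebra (topspace X) (sets (borel_of_surface X))"
    using sets.sigma_algebra_axioms[of "borel_of_surface X"] by simp
  have "emeasure ?m E = volume E" if "E \<in> sets ?m" for E
  proof (rule emeasure_measure_of[OF refl sp _ _ that])
    show "positive (sets ?m) volume"
      by (auto simp: positive_def volume_def chart_volume_def)
    show "countably_additive (sets ?m) volume"
      using volume_countably_additive s by (simp add: sets_borel_of_surface)
  qed
  note em = this
  show ?thesis
    unfolding is_riemannian_measure_def
  proof (intro conjI ballI impI s)
    fix c E assume c: "c \<in> \<A>" and E: "E \<in> sets ?m" "E \<subseteq> chart_dom c"
    have "emeasure ?m E = chart_volume h c E"
      unfolding em[OF E(1)]
      using volume_chart[OF atlas_compatible[OF atlas c] atlas_components[OF c] _ E(2)] E(1)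
      unfolding s(2) sets_borel_of_surface by simp
    then show "emeasure ?m E = (\<integral>\<^sup>+ y. ennreal (sqrt (det (h c (chart_inv c y)))) *
        indicator (chart_map c ` E) y \<partial>lborel)"
      unfolding chart_volume_alt[OF E(2)] .
  qed
qed

text \<open>Uniqueness: the prescribed values in charts determine a measure on each piece, hence on
  every Borel set by additivity.\<close>

lemma is_riemannian_measure_eq_volume:
  assumes m: "is_riemannian_measure X \<A> h m" and E: "E \<in> sets m"
  shows "emeasure m E = volume E"
proof -
  have s: "sets m = sets (borel_of_surface X)"
    by (rule is_riemannian_measureD(2)[OF m])
  have "E = (\<Union>i<length cover. E \<inter> piece i)"
    using piece_cover sets.sets_into_space[OF E[unfolded s]] by auto
  moreover have "emeasure m (\<Union>i<length cover. E \<inter> piece i) = (\<Sum>i<length cover. emeasure m (E \<inter> piece i))"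
    using E piece_measurable piece_disjoint s
    by (intro sum_emeasure[symmetric]) (auto simp: disjoint_family_on_def)
  moreover have "emeasure m (E \<inter> piece i) = chart_volume h (cover ! i) (E \<inter> piece i)" if i: "i < length cover" for i
  proof -
    have "E \<inter> piece i \<in> sets m" "E \<inter> piece i \<subseteq> chart_dom (cover ! i)"
      using E piece_measurable[OF i] piece_subset s by auto
    then show ?thesis
      by (rule is_riemannian_measureD(3)[OF m cover_nth[OF i]])
  qed
  ultimately show ?thesis by (simp add: volume_def)
qed

text \<open>Existence and uniqueness together justify the definite description behind
  \<open>riemannian_measure\<close>.\<close>

lemma is_riemannian_measure_riemannian_measure:
  "is_riemannian_measure X \<A> h (riemannian_measure X \<A> h)"
  unfolding riemannian_measure_def
proof (rule theI)
  show "is_riemannian_measure X \<A> h (measure_of (topspace X) {U. openin X U} volume)"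
    by (rule is_riemannian_measure_volume)
  fix m assume m: "is_riemannian_measure X \<A> h m"
  show "m = measure_of (topspace X) {U. openin X U} volume"
  proof (rule measure_eqI)
    note D = is_riemannian_measureD(2)[OF m] is_riemannian_measureD(2)[OF is_riemannian_measure_volume]
    show "sets m = sets (measure_of (topspace X) {U. openin X U} volume)"
      by (simp only: D)
    show "emeasure m E = emeasure (measure_of (topspace X) {U. openin X U} volume) E" if "E \<in> sets m" for E
      using is_riemannian_measure_eq_volume[OF m that]
        is_riemannian_measure_eq_volume[OF is_riemannian_measure_volume, of E] that
      by (simp only: D)
  qed
qed

abbreviation \<mu> :: "'a measure" where "\<mu> \<equiv> riemannian_measure X \<A> h"

lemma space_measure: "space \<mu> = topspace X"
  and sets_measure: "sets \<mu> = sets (borel_of_surface X)"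
  by (rule is_riemannian_measureD[OF is_riemannian_measure_riemannian_measure])+

lemma emeasure_chart:
  assumes "compatible_chart X \<A> d" "metric_components \<A> h d" "E \<in> sets \<mu>" "E \<subseteq> chart_dom d"
  shows "emeasure \<mu> E = chart_volume h d E"
  unfolding is_riemannian_measure_eq_volume[OF is_riemannian_measure_riemannian_measure assms(3)]
  using assms(3) by (intro volume_chart assms) (simp add: sets_measure)

text \<open>Restricted to the domain of \<open>d\<close>, the Riemannian measure is the image of
  weighted Lebesgue measure under the extended inverse chart, and integrals are computed as for an
  image measure.\<close>

lemma nn_integral_chart:
  assumes d: "compatible_chart X \<A> d" and hd: "metric_components \<A> h d"
    and f: "f \<in> borel_measurable \<mu>"
  shows "(\<integral>\<^sup>+ p. f p * indicator (chart_dom d) p \<partial>\<mu>) =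
    (\<integral>\<^sup>+ y. f (chart_inv d y) * ennreal (sqrt (det (h d (chart_inv d y)))) * indicator (chart_range d) y \<partial>lborel)"
proof (cases "topspace X = {}")
  case True
  have "chart_dom d = {}" using True chart_dom_subset[OF compatible_surface_chart[OF d]] by simp
  then show ?thesis by (simp add: chart_range_def)
next
  case False
  have sd: "surface_chart X d" by (rule compatible_surface_chart[OF d])
  note [measurable] = chart_density_measurable[OF sd hd]
  let ?m = "density lborel (\<lambda>y. ennreal (chart_density h d y))"
  have dom: "chart_dom d \<in> sets \<mu>"
    using sd unfolding sets_measure by (intro openin_borel_of_surface) (simp add: surface_chart_def)
  have ext: "chart_extension X d \<in> ?m \<rightarrow>\<^sub>M \<mu>"
    using chart_extension_measurable[OF sd False] measurable_cong_sets[OF _ sets_measure] by auto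
  \<comment> \<open>The weight is zero off the range of \<open>d\<close>, so the arbitrary default
    value of the extension carries no mass.\<close>
  have eq: "density \<mu> (indicator (chart_dom d)) = distr ?m \<mu> (chart_extension X d)"
  proof (rule measure_eqI)
    fix E assume "E \<in> sets (density \<mu> (indicator (chart_dom d)))"
    then have E: "E \<in> sets \<mu>" by simp
    have "emeasure (density \<mu> (indicator (chart_dom d))) E = emeasure \<mu> (chart_dom d \<inter> E)"
    proof -
      have "emeasure (density \<mu> (indicator (chart_dom d))) E = (\<integral>\<^sup>+ p. indicator (chart_dom d) p * indicator E p \<partial>\<mu>)"
        using E dom by (intro emeasure_density) auto
      also have "\<dots> = (\<integral>\<^sup>+ p. indicator (chart_dom d \<inter> E) p \<partial>\<mu>)"
        by (intro nn_integral_cong) (auto simp: indicator_def)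
      finally show ?thesis using E dom by simp
    qed
    also have "\<dots> = chart_volume h d (chart_dom d \<inter> E)"
      using E dom by (intro emeasure_chart[OF d hd]) auto
    also have "\<dots> = (\<integral>\<^sup>+ y. ennreal (chart_density h d y) * indicator (chart_extension X d -` E) y \<partial>lborel)"
      unfolding chart_volume_def chart_image_eq[OF sd Int_lower1]
      by (intro nn_integral_cong) (auto simp: indicator_def chart_density_def chart_extension_def chart_inv_in_dom)
    also have "\<dots> = emeasure ?m (chart_extension X d -` E \<inter> space ?m)"
      using measurable_sets[OF ext E] by (subst emeasure_density) auto
    also have "\<dots> = emeasure (distr ?m \<mu> (chart_extension X d)) E"
      using ext E by (simp add: emeasure_distr)
    finally show "emeasure (density \<mu> (indicator (chart_dom d))) E = emeasure (distr ?m \<mu> (chart_extension X d)) E" .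
  qed simp
  have "(\<integral>\<^sup>+ p. f p * indicator (chart_dom d) p \<partial>\<mu>) = (\<integral>\<^sup>+ p. f p \<partial>density \<mu> (indicator (chart_dom d)))"
    using f dom by (simp add: nn_integral_density mult.commute)
  also have "\<dots> = (\<integral>\<^sup>+ y. f (chart_extension X d y) \<partial>?m)"
    unfolding eq using ext f by (simp add: nn_integral_distr)
  also have "\<dots> = (\<integral>\<^sup>+ y. ennreal (chart_density h d y) * f (chart_extension X d y) \<partial>lborel)"
    using measurable_compose[OF ext f] by (intro nn_integral_density) auto
  also have "\<dots> = (\<integral>\<^sup>+ y. f (chart_inv d y) * ennreal (sqrt (det (h d (chart_inv d y)))) * indicator (chart_range d) y \<partial>lborel)"
    by (intro nn_integral_cong) (auto simp: indicator_def chart_density_def chart_extension_def mult.commute)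
  finally show ?thesis .
qed

end

section \<open>The magnetic energy\<close>

definition one_form_components :: "'a chart set \<Rightarrow> 'a one_form \<Rightarrow> 'a chart \<Rightarrow> bool" where
  "one_form_components \<A> A d \<longleftrightarrow>
     (\<forall>c\<in>\<A>. \<forall>p\<in>chart_dom c \<inter> chart_dom d.
        A c p = transpose (transition_jacobian c d p) *v A d p)"

lemma one_form_components_change:
  assumes "one_form_components \<A> A d" "c \<in> \<A>" "p \<in> chart_dom c" "p \<in> chart_dom d"
  shows "A c p = transpose (transition_jacobian c d p) *v A d p"
  using bspec[OF bspec[OF assms(1)[unfolded one_form_components_def] assms(2)], of p] assms(3,4) by blast

lemma smooth_one_form_components:
  assumes "smooth_one_form \<A> A" "d \<in> \<A>" shows "one_form_components \<A> A d"
  unfolding one_form_components_def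
proof (intro ballI)
  fix c p assume "c \<in> \<A>" "p \<in> chart_dom c \<inter> chart_dom d"
  then show "A c p = transpose (transition_jacobian c d p) *v A d p"
    by (intro bspec[OF bspec[OF bspec[OF conjunct2[OF assms(1)[unfolded smooth_one_form_def]]]]] assms(2))
qed

lemma continuous_map_via_charts:
  fixes f :: "'a \<Rightarrow> 'b::topological_space"
  assumes atlas: "smooth_atlas X \<A>"
    and f: "\<And>c. c \<in> \<A> \<Longrightarrow> continuous_on (chart_range c) (f \<circ> chart_inv c)"
  shows "continuous_map X euclidean f"
  unfolding continuous_map_def
proof (intro conjI allI impI)
  show "f \<in> topspace X \<rightarrow> topspace euclidean" by simp
  fix V :: "'b set" assume V: "openin euclidean V"
  show "openin X {x \<in> topspace X. f x \<in> V}"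
  proof (subst openin_subopen, intro ballI)
    fix p assume p: "p \<in> {x \<in> topspace X. f x \<in> V}"
    then have "p \<in> (\<Union>c\<in>\<A>. chart_dom c)" using atlas by (simp add: smooth_atlas_def)
    then obtain c where c: "c \<in> \<A>" "p \<in> chart_dom c" by blast
    have sc: "surface_chart X c" by (rule smooth_atlas_chart[OF atlas c(1)])
    have "open (chart_range c)" using sc by (simp add: surface_chart_def)
    then have "\<forall>B. open B \<longrightarrow> open ((f \<circ> chart_inv c) -` B \<inter> chart_range c)"
      using f[OF c(1)] by (simp only: continuous_on_open_vimage)
    then have o: "open ((f \<circ> chart_inv c) -` V \<inter> chart_range c)"
      using V by (simp only: open_openin)
    have "chart_dom c \<inter> chart_map c -` ((f \<circ> chart_inv c) -` V \<inter> chart_range c) \<subseteq> {x \<in> topspace X. f x \<in> V}"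
      using chart_inv_map[OF sc] chart_dom_subset[OF sc] by auto
    moreover have "p \<in> chart_dom c \<inter> chart_map c -` ((f \<circ> chart_inv c) -` V \<inter> chart_range c)"
      using c(2) p chart_map_in_range[OF c(2)] by (simp add: chart_inv_map[OF sc])
    ultimately show "\<exists>T. openin X T \<and> p \<in> T \<and> T \<subseteq> {x \<in> topspace X. f x \<in> V}"
      using openin_chart_preimage[OF sc o] by blast
  qed
qed

lemma smooth_function_continuous_map:
  assumes "smooth_atlas X \<A>" "smooth_function \<A> u"
  shows "continuous_map X euclidean u"
  using assms(2) by (intro continuous_map_via_charts[OF assms(1)] smooth_map_on_continuous)
    (simp add: smooth_function_def)

text \<open>Smoothness is tested in the atlas only; a compatible chart is reached by the chain rule
  through an atlas chart around \<open>p\<close>.\<close>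

lemma smooth_function_differentiable:
  assumes atlas: "smooth_atlas X \<A>" and u: "smooth_function \<A> u"
    and d: "compatible_chart X \<A> d" and p: "p \<in> chart_dom d"
  shows "(u \<circ> chart_inv d) differentiable (at (chart_map d p))"
proof -
  have sd: "surface_chart X d" by (rule compatible_surface_chart[OF d])
  have "p \<in> topspace X" using chart_dom_subset[OF sd] p by blast
  then have "p \<in> (\<Union>c\<in>\<A>. chart_dom c)" using atlas by (simp add: smooth_atlas_def)
  then obtain c where c: "c \<in> \<A>" "p \<in> chart_dom c" by blast
  have sc: "surface_chart X c" by (rule smooth_atlas_chart[OF atlas c(1)])
  have "(u \<circ> chart_inv c) differentiable (at (chart_map c p))"
    using u c chart_map_in_range[OF c(2)] by (intro smooth_map_on_differentiable) (auto simp: smooth_function_def)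
  then show ?thesis
    using change_of_chart_has_derivative[OF sd sc _ compatible_transition(2)[OF d c p], of u] p c(2)
    by (auto intro: differentiableI)
qed

lemma covector_norm_sq_continuous:
  fixes H :: "'b::topological_space \<Rightarrow> real^2^2"
  assumes "continuous_on S H" "continuous_on S \<omega>" "\<And>y. y \<in> S \<Longrightarrow> det (H y) \<noteq> 0"
  shows "continuous_on S (\<lambda>y. covector_norm_sq (H y) (\<omega> y))"
proof -
  have "continuous_on S (\<lambda>y. (H y$2$2 * (cmod (\<omega> y$1))\<^sup>2 - (H y$1$2 + H y$2$1) * Re (\<omega> y$1 * cnj (\<omega> y$2))
      + H y$1$1 * (cmod (\<omega> y$2))\<^sup>2) / det (H y))"
    using assms by (intro continuous_intros continuous_on_det_2) auto
  then show ?thesis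
    by (rule continuous_on_cong[THEN iffD1, rotated 2]) (auto simp: covector_norm_sq_eq assms(3))
qed

lemma continuous_on_vecI:
  fixes f :: "'b::topological_space \<Rightarrow> 'c::topological_space^'n"
  shows "(\<And>i. continuous_on S (\<lambda>y. f y $ i)) \<Longrightarrow> continuous_on S f"
  using continuous_on_vec_lambda[of S "\<lambda>i y. f y $ i"] by simp

section \<open>Integrals of continuous functions on the surface\<close>

context compact_riemannian_surface
begin

lemma openin_sets: "openin X U \<Longrightarrow> U \<in> sets \<mu>"
  unfolding sets_measure by (rule openin_borel_of_surface)

lemma continuous_measurable:
  fixes f :: "'a \<Rightarrow> 'b::topological_space"
  shows "continuous_map X euclidean f \<Longrightarrow> f \<in> borel_measurable \<mu>"
  using continuous_map_borel_of_surface measurable_cong_sets[OF sets_measure refl] by blast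

lemma chart_at:
  assumes "p \<in> topspace X"
  obtains c where "c \<in> \<A>" "p \<in> chart_dom c" "surface_chart X c"
proof -
  have "p \<in> (\<Union>c\<in>\<A>. chart_dom c)" using atlas assms by (simp add: smooth_atlas_def)
  then obtain c where "c \<in> \<A>" "p \<in> chart_dom c" by blast
  then show ?thesis using that smooth_atlas_chart[OF atlas] by blast
qed

text \<open>Turns a local property into a finite cover; used for the finiteness of the measure and
  for the uniform mass bound.\<close>

lemma compact_cover:
  assumes "\<And>p. p \<in> topspace X \<Longrightarrow> \<exists>U. openin X U \<and> p \<in> U \<and> P U"
  shows "\<exists>F. finite F \<and> (\<forall>U\<in>F. openin X U \<and> P U) \<and> \<Union>F = topspace X"
proof -
  let ?G = "{U. openin X U \<and> P U}"
  have "\<forall>U\<in>?G. openin X U" "topspace X \<subseteq> \<Union>?G" using assms by blast+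
  then obtain F where "finite F" "F \<subseteq> ?G" "topspace X \<subseteq> \<Union>F"
    using compact[unfolded compact_space_alt, rule_format, of ?G] by blast
  then have G: "\<forall>U\<in>F. openin X U \<and> P U" by blast
  then have "\<Union>F \<subseteq> topspace X" using openin_subset[of X] by (intro Union_least) blast
  then have "\<Union>F = topspace X" using \<open>topspace X \<subseteq> \<Union>F\<close> by (rule equalityI)
  then show ?thesis using \<open>finite F\<close> G by (intro exI[of _ F] conjI)
qed

lemma emeasure_chart_ball:
  assumes c: "c \<in> \<A>" and K: "cball y r \<subseteq> chart_range c"
  shows "emeasure \<mu> (chart_dom c \<inter> chart_map c -` ball y r) < \<infinity>"
proof -
  let ?U = "chart_dom c \<inter> chart_map c -` ball y r"
  have sc: "surface_chart X c" by (rule smooth_atlas_chart[OF atlas c])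
  have "compact ((\<lambda>y. sqrt (det (h c (chart_inv c y)))) ` cball y r)"
    by (intro compact_continuous_image continuous_on_subset[OF chart_density_continuous[OF atlas_components[OF c]] K]) simp
  then have "bounded ((\<lambda>y. sqrt (det (h c (chart_inv c y)))) ` cball y r)"
    by (rule compact_imp_bounded)
  then obtain B where "\<forall>x\<in>cball y r. \<bar>sqrt (det (h c (chart_inv c x)))\<bar> \<le> B"
    by (auto simp: bounded_iff)
  then have B: "sqrt (det (h c (chart_inv c x))) \<le> B" if "x \<in> cball y r" for x
    using that by fastforce
  have "chart_map c ` ?U \<subseteq> ball y r" by auto
  then have le: "ennreal (chart_density h c x) * indicator (chart_map c ` ?U) x \<le> ennreal B * indicator (ball y r) x" for x
    using B[of x] by (auto simp: indicator_def chart_density_def intro!: ennreal_leI)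
  have "emeasure \<mu> ?U = chart_volume h c ?U"
    by (intro emeasure_chart atlas_compatible[OF atlas c] atlas_components[OF c] openin_sets
        openin_chart_preimage[OF sc]) auto
  also have "\<dots> \<le> (\<integral>\<^sup>+ x. ennreal B * indicator (ball y r) x \<partial>lborel)"
    unfolding chart_volume_def by (intro nn_integral_mono le)
  also have "\<dots> = ennreal B * emeasure lborel (ball y r)"
    by (simp add: nn_integral_cmult_indicator)
  also have "\<dots> < \<infinity>"
    using emeasure_bounded_finite[OF bounded_ball, of y r] by (simp add: ennreal_mult_less_top)
  finally show ?thesis .
qed

lemma small_chart_ball:
  assumes "c \<in> \<A>" "p \<in> chart_dom c"
  obtains r where "r > 0" "cball (chart_map c p) r \<subseteq> chart_range c"
proof -
  have "open (chart_range c)" using smooth_atlas_chart[OF atlas assms(1)] by (simp add: surface_chart_def)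
  then show ?thesis
    using open_contains_cball chart_map_in_range[OF assms(2)] that by blast
qed

lemma finite_measure_surface: "finite_measure \<mu>"
proof
  have "\<exists>U. openin X U \<and> p \<in> U \<and> emeasure \<mu> U < \<infinity>" if p: "p \<in> topspace X" for p
  proof -
    obtain c where c: "c \<in> \<A>" "p \<in> chart_dom c" "surface_chart X c" by (rule chart_at[OF p])
    obtain r where r: "r > 0" "cball (chart_map c p) r \<subseteq> chart_range c"
      by (rule small_chart_ball[OF c(1,2)])
    show ?thesis
      using openin_chart_preimage[OF c(3) open_ball] emeasure_chart_ball[OF c(1) r(2)] c(2) r(1)
      by (intro exI[of _ "chart_dom c \<inter> chart_map c -` ball (chart_map c p) r"]) simp
  qed
  then have "\<exists>F. finite F \<and> (\<forall>U\<in>F. openin X U \<and> emeasure \<mu> U < \<infinity>) \<and> \<Union>F = topspace X"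
    by (rule compact_cover)
  then obtain F where F: "finite F" "\<forall>U\<in>F. openin X U \<and> emeasure \<mu> U < \<infinity>" "\<Union>F = topspace X"
    by (elim exE conjE) (rule that)
  have "emeasure \<mu> (\<Union>F) \<le> (\<Sum>U\<in>F. emeasure \<mu> U)"
    using emeasure_subadditive_finite[of F "\<lambda>U. U" \<mu>] F openin_sets by auto
  also have "\<dots> < \<infinity>" using F by (auto simp: less_top[symmetric])
  finally show "emeasure \<mu> (space \<mu>) \<noteq> \<infinity>" using F(3) by (simp add: space_measure)
qed

lemma integrable_continuous:
  fixes f :: "'a \<Rightarrow> real"
  assumes "continuous_map X euclidean f"
  shows "integrable \<mu> f"
proof -
  interpret finite_measure \<mu> by (rule finite_measure_surface)
  have "compactin euclidean (f ` topspace X)"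
    using image_compactin[OF _ assms] compact by (simp add: compact_space_def)
  then have "bounded (f ` topspace X)" by (simp add: compact_imp_bounded)
  then obtain B where "\<And>p. p \<in> topspace X \<Longrightarrow> norm (f p) \<le> B" by (auto simp: bounded_iff)
  then show ?thesis
    using continuous_measurable[OF assms] by (intro integrable_const_bound[of _ B] AE_I2) (auto simp: space_measure)
qed

text \<open>In a chart the density is positive, and a nonempty open set of the plane is not
  negligible.\<close>

lemma emeasure_open_positive:
  assumes "openin X U" "p \<in> U"
  shows "emeasure \<mu> U > 0"
proof (rule ccontr)
  assume "\<not> emeasure \<mu> U > 0"
  then have z: "emeasure \<mu> U = 0" by simp
  have "p \<in> topspace X" using assms openin_subset by blast
  then obtain c where c: "c \<in> \<A>" "p \<in> chart_dom c" "surface_chart X c" by (rule chart_at)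
  let ?U = "chart_dom c \<inter> U" let ?V = "chart_map c ` ?U"
  have oU: "openin X ?U" using c(3) assms(1) by (auto simp: surface_chart_def)
  have oV: "open ?V" by (rule open_chart_image[OF c(3) assms(1)])
  have "emeasure \<mu> ?U = 0"
    using z emeasure_mono[of ?U U \<mu>] openin_sets[OF assms(1)] by simp
  then have "chart_volume h c ?U = 0"
    using emeasure_chart[OF atlas_compatible[OF atlas c(1)] atlas_components[OF c(1)] openin_sets[OF oU]] by simp
  then have "AE y in lborel. ennreal (chart_density h c y) * indicator ?V y = 0"
    unfolding chart_volume_def using oV chart_density_measurable[OF c(3) atlas_components[OF c(1)]]
    by (subst (asm) nn_integral_0_iff_AE) auto
  moreover have "ennreal (chart_density h c y) * indicator ?V y \<noteq> 0" if "y \<in> ?V" for y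
  proof -
    have y: "y \<in> chart_range c" using that by (auto simp: chart_range_def)
    have "positive_form (h c (chart_inv c y))"
      by (rule metric_components_positive[OF atlas_components[OF c(1)] chart_inv_in_dom[OF y]])
    then show ?thesis using that y positive_form_det[of "h c (chart_inv c y)"]
      by (simp add: chart_density_def)
  qed
  ultimately have "AE y in lborel. y \<notin> ?V" by (auto elim!: eventually_mono)
  then have "?V \<in> null_sets lborel" using oV by (subst AE_iff_null_sets) auto
  then have "negligible ?V" by (simp add: negligible_iff_null_sets null_sets_completionI)
  then show False using open_not_negligible[OF oV] c(2) assms(2) by blast
qed

text \<open>Keeps the denominator of the Rayleigh quotient away from zero: a continuous function
  that is nonzero somewhere is nonzero on an open set, which has positive measure.\<close>

lemma nn_integral_norm_positive:
  fixes u :: "'a \<Rightarrow> complex"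
  assumes u: "continuous_map X euclidean u" and p: "p \<in> topspace X" "u p \<noteq> 0"
  shows "(\<integral>\<^sup>+ p. ennreal ((cmod (u p))\<^sup>2) \<partial>\<mu>) > 0"
proof (rule ccontr)
  assume "\<not> (\<integral>\<^sup>+ p. ennreal ((cmod (u p))\<^sup>2) \<partial>\<mu>) > 0"
  then have z: "(\<integral>\<^sup>+ p. ennreal ((cmod (u p))\<^sup>2) \<partial>\<mu>) = 0" by simp
  let ?U = "{p \<in> topspace X. u p \<in> - {0}}"
  have "openin euclidean (- {0 :: complex})" by (simp add: open_Compl)
  from openin_continuous_map_preimage[OF u this] have oU: "openin X ?U" .
  have [measurable]: "u \<in> borel_measurable \<mu>" by (rule continuous_measurable[OF u])
  have "AE p in \<mu>. ennreal ((cmod (u p))\<^sup>2) = 0"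
    using z by (subst (asm) nn_integral_0_iff_AE) auto
  then have "AE p in \<mu>. p \<notin> ?U" by (auto elim!: eventually_mono)
  then have "?U \<in> null_sets \<mu>" using openin_sets[OF oU] by (subst AE_iff_null_sets) auto
  then show False using emeasure_open_positive[OF oU, of p] p by auto
qed

end

section \<open>Energy density and Rayleigh quotients\<close>

locale magnetic_surface = compact_riemannian_surface X \<A> h
  for X :: "'a topology" and \<A> h +
  fixes A :: "'a one_form"
  assumes one_form: "smooth_one_form \<A> A"
begin

text \<open>The density is defined through some chosen atlas chart; invariance of the covector norm
  allows its computation in any compatible chart, in particular in the annular ones.\<close>

lemma energy_density_chart:
  assumes u: "smooth_function \<A> u" and d: "compatible_chart X \<A> d" and hd: "metric_components \<A> h d"
    and Ad: "one_form_components \<A> A d" and p: "p \<in> chart_dom d"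
  shows "magnetic_energy_density \<A> h A u p = covector_norm_sq (h d p) (magnetic_differential A u d p)"
proof -
  have sd: "surface_chart X d" by (rule compatible_surface_chart[OF d])
  define c where "c = (SOME c. c \<in> \<A> \<and> p \<in> chart_dom c)"
  have "p \<in> topspace X" using chart_dom_subset[OF sd] p by blast
  then have "\<exists>c. c \<in> \<A> \<and> p \<in> chart_dom c" by (rule chart_at) blast
  then have c: "c \<in> \<A>" "p \<in> chart_dom c" unfolding c_def by (metis (mono_tags, lifting) someI_ex)+
  have sc: "surface_chart X c" by (rule smooth_atlas_chart[OF atlas c(1)])
  have pi: "p \<in> chart_dom c \<inter> chart_dom d" using p c(2) by blast
  let ?J = "transition_jacobian c d p"
  have m: "magnetic_differential A u c p = (\<chi> i. \<Sum>k\<in>UNIV. of_real (?J $ k $ i) * magnetic_differential A u d p $ k)"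
    by (rule magnetic_differential_change_of_chart[where A = A and u = u and c = c and d = d and p = p, OF sc sd pi compatible_transition(1)[OF d c p]
          smooth_function_differentiable[OF atlas u d p] one_form_components_change[OF Ad c p]])
  have hc: "h c p = transpose ?J ** h d p ** ?J" by (rule metric_components_change[OF hd c(1) pi])
  have "det (h c p) \<noteq> 0"
    using positive_form_det[OF metric_components_positive[OF atlas_components[OF c(1)] c(2)]] by simp
  then have "covector_norm_sq (h c p) (magnetic_differential A u c p) = covector_norm_sq (h d p) (magnetic_differential A u d p)"
    unfolding m hc by (rule covector_norm_sq_congruence)
  then show ?thesis by (simp add: magnetic_energy_density_def c_def Let_def)
qed

lemma energy_density_atlas:
  assumes "smooth_function \<A> u" "c \<in> \<A>" "p \<in> chart_dom c"
  shows "magnetic_energy_density \<A> h A u p = covector_norm_sq (h c p) (magnetic_differential A u c p)"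
  by (rule energy_density_chart[OF assms(1) atlas_compatible[OF atlas assms(2)] atlas_components[OF assms(2)]
        smooth_one_form_components[OF one_form assms(2)] assms(3)])

lemma magnetic_differential_continuous:
  assumes u: "smooth_function \<A> u" and c: "c \<in> \<A>"
  shows "continuous_on (chart_range c) (\<lambda>y. magnetic_differential A u c (chart_inv c y))"
proof (rule continuous_on_vecI)
  fix i
  have su: "smooth_map_on (u \<circ> chart_inv c) (chart_range c)" using u c by (simp add: smooth_function_def)
  have sA: "smooth_map_on (A c \<circ> chart_inv c) (chart_range c)" using one_form c by (simp add: smooth_one_form_def)
  have "continuous_on (chart_range c) (\<lambda>y. partial_deriv i (u \<circ> chart_inv c) y -
            \<i> * (u \<circ> chart_inv c) y * complex_of_real ((A c \<circ> chart_inv c) y $ i))"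
    by (intro continuous_intros smooth_map_on_continuous smooth_map_on_partial_deriv su sA)
  then show "continuous_on (chart_range c) (\<lambda>y. magnetic_differential A u c (chart_inv c y) $ i)"
    by (rule continuous_on_cong[THEN iffD1, rotated 2]) (auto simp: magnetic_differential_def chart_map_inv)
qed

text \<open>Continuity gives measurability and, by compactness, integrability; hence the Lebesgue
  integral in the Rayleigh quotient may be traded for a nonnegative integral.\<close>

lemma energy_density_continuous:
  assumes u: "smooth_function \<A> u"
  shows "continuous_map X euclidean (magnetic_energy_density \<A> h A u)"
proof (rule continuous_map_via_charts[OF atlas])
  fix c assume c: "c \<in> \<A>"
  have "det (h c (chart_inv c y)) \<noteq> 0" if "y \<in> chart_range c" for y
    using positive_form_det[OF metric_components_positive[OF atlas_components[OF c] chart_inv_in_dom[OF that]]] by simp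
  then have "continuous_on (chart_range c) (\<lambda>y. covector_norm_sq (h c (chart_inv c y)) (magnetic_differential A u c (chart_inv c y)))"
    by (intro covector_norm_sq_continuous metric_components_continuous[OF atlas_components[OF c]]
        magnetic_differential_continuous[OF u c])
  then show "continuous_on (chart_range c) (magnetic_energy_density \<A> h A u \<circ> chart_inv c)"
    by (rule continuous_on_cong[THEN iffD1, rotated 2])
      (auto simp: energy_density_atlas[OF u c chart_inv_in_dom])
qed

lemma energy_density_nonneg:
  assumes u: "smooth_function \<A> u" and p: "p \<in> topspace X"
  shows "magnetic_energy_density \<A> h A u p \<ge> 0"
proof -
  obtain c where c: "c \<in> \<A>" "p \<in> chart_dom c" "surface_chart X c" by (rule chart_at[OF p])
  show ?thesis
    unfolding energy_density_atlas[OF u c(1,2)]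
    by (rule covector_norm_sq_nonneg[OF metric_components_positive[OF atlas_components[OF c(1)] c(2)]])
qed

abbreviation energy :: "('a \<Rightarrow> complex) \<Rightarrow> ennreal" where
  "energy u \<equiv> \<integral>\<^sup>+ p. ennreal (magnetic_energy_density \<A> h A u p) \<partial>\<mu>"

lemma rayleigh_quotient_ge:
  assumes u: "smooth_function \<A> u" and p: "p \<in> topspace X" "u p \<noteq> 0" and K: "K > 0"
    and le: "(\<integral>\<^sup>+ p. ennreal ((cmod (u p))\<^sup>2) \<partial>\<mu>) \<le> ennreal K * energy u"
  shows "magnetic_rayleigh_quotient X \<A> h A u \<ge> 1 / K"
proof -
  have cu: "continuous_map X euclidean u" by (rule smooth_function_continuous_map[OF atlas u])
  have "continuous_map X euclidean (\<lambda>p. (cmod (u p))\<^sup>2)"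
    by (rule continuous_map_compose[OF cu, of euclidean "\<lambda>z. (cmod z)\<^sup>2", unfolded o_def])
      (simp add: continuous_intros)
  then have iu: "integrable \<mu> (\<lambda>p. (cmod (u p))\<^sup>2)" by (rule integrable_continuous)
  have ie: "integrable \<mu> (magnetic_energy_density \<A> h A u)"
    by (rule integrable_continuous[OF energy_density_continuous[OF u]])
  let ?N = "LINT p|\<mu>. (cmod (u p))\<^sup>2" and ?E = "LINT p|\<mu>. magnetic_energy_density \<A> h A u p"
  have N: "(\<integral>\<^sup>+ p. ennreal ((cmod (u p))\<^sup>2) \<partial>\<mu>) = ennreal ?N"
    by (rule nn_integral_eq_integral[OF iu]) simp
  have E: "energy u = ennreal ?E"
    using energy_density_nonneg[OF u]
    by (intro nn_integral_eq_integral[OF ie] AE_I2) (simp add: space_measure)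
  have E0: "?E \<ge> 0" using energy_density_nonneg[OF u]
    by (intro integral_nonneg_AE AE_I2) (simp add: space_measure)
  have "?N > 0" using nn_integral_norm_positive[OF cu p] unfolding N by simp
  moreover have "?N \<le> K * ?E"
    using le K E0 unfolding N E by (simp add: ennreal_mult[symmetric])
  ultimately show ?thesis
    using K unfolding magnetic_rayleigh_quotient_def by (simp add: field_simps)
qed

lemma smooth_function_const: "smooth_function \<A> (\<lambda>p. c)"
  by (simp add: smooth_function_def o_def smooth_map_on_const)

text \<open>Reduces a lower bound for the eigenvalue to one inequality between mass and
  energy.\<close>

lemma magnetic_lambda1_ge:
  assumes K: "K > 0" and ne: "topspace X \<noteq> {}"
    and le: "\<And>u. smooth_function \<A> u \<Longrightarrow>
      (\<integral>\<^sup>+ p. ennreal ((cmod (u p))\<^sup>2) \<partial>\<mu>) \<le> ennreal K * energy u"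
  shows "magnetic_lambda1 X \<A> h A \<ge> 1 / K"
  unfolding magnetic_lambda1_def
proof (rule cINF_greatest)
  obtain p where "p \<in> topspace X" using ne by blast
  \<comment> \<open>An infimum of reals is informative only over a nonempty set; the constant 1 is
    admissible because the surface has a point.\<close>
  then have "(\<lambda>p. 1) \<in> {u :: 'a \<Rightarrow> complex. smooth_function \<A> u \<and> (\<exists>p\<in>topspace X. u p \<noteq> 0)}"
    using smooth_function_const[of 1] by auto
  then show "{u :: 'a \<Rightarrow> complex. smooth_function \<A> u \<and> (\<exists>p\<in>topspace X. u p \<noteq> 0)} \<noteq> {}" by blast
  show "1 / K \<le> magnetic_rayleigh_quotient X \<A> h A u"
    if "u \<in> {u. smooth_function \<A> u \<and> (\<exists>p\<in>topspace X. u p \<noteq> 0)}" for u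
    using that rayleigh_quotient_ge[OF _ _ _ K le] by blast
qed

end

section \<open>Transport along segments and circles\<close>

lemma nn_integral_continuous_interval:
  fixes q :: "real \<Rightarrow> real"
  assumes "continuous_on {a..b} q" "\<And>t. t \<in> {a..b} \<Longrightarrow> q t \<ge> 0"
  shows "(\<integral>\<^sup>+ t. ennreal (q t) * indicator {a..b} t \<partial>lborel) = ennreal (integral {a..b} q)"
proof -
  have "(q has_integral integral {a..b} q) {a..b}"
    using assms(1) integrable_continuous_interval by (simp add: has_integral_integral)
  from nn_integral_has_integral_lebesgue[OF assms(2) this]
  show ?thesis
    by (subst nn_integral_cong[of _ _ "\<lambda>t. ennreal (indicator {a..b} t * q t)"])
      (auto simp: indicator_def)
qed

text \<open>Gronwall's argument. A real potential \<open>b\<close> only rotates the phase, so the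
  growth of the squared modulus is governed by the covariant derivative, with a constant that does
  not see \<open>b\<close>.\<close>

lemma segment_transport_bound:
  fixes w :: "real \<Rightarrow> complex" and b :: "real \<Rightarrow> real"
  assumes w: "\<And>t. t \<in> {0..1} \<Longrightarrow> (w has_vector_derivative w' t) (at t)"
    and w': "continuous_on {0..1} w'" and b: "continuous_on {0..1} b"
  shows "ennreal ((cmod (w 1))\<^sup>2) \<le> ennreal (exp 1) * (ennreal ((cmod (w 0))\<^sup>2) +
    (\<integral>\<^sup>+ t. ennreal ((cmod (w' t - \<i> * w t * b t))\<^sup>2) * indicator {0..1} t \<partial>lborel))"
proof -
  let ?q = "\<lambda>t. (cmod (w' t - \<i> * w t * b t))\<^sup>2"
  \<comment> \<open>The weight absorbs the square of \<open>w\<close> that appears when twice an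
    inner product is estimated by a sum of two squares.\<close>
  let ?g = "\<lambda>t. exp (- t) * (cmod (w t))\<^sup>2"
  let ?g' = "\<lambda>t. exp (- t) * (2 * (w t \<bullet> w' t)) - exp (- t) * (cmod (w t))\<^sup>2"
  have cw: "continuous_on {0..1} w"
    by (intro continuous_at_imp_continuous_on ballI) (meson w has_vector_derivative_continuous)
  have cq: "continuous_on {0..1} ?q" by (intro continuous_intros cw w' b)
  have dg: "(?g has_vector_derivative ?g' t) (at t within {0..1})" if "t \<in> {0..1}" for t
  proof -
    have wd: "(w has_derivative (\<lambda>s. s *\<^sub>R w' t)) (at t)"
      using w[OF that] by (simp add: has_vector_derivative_def)
    have eq: "(\<lambda>s. w t \<bullet> s *\<^sub>R w' t + s *\<^sub>R w' t \<bullet> w t) = (*) (2 * (w t \<bullet> w' t))"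
      by (simp add: fun_eq_iff inner_commute algebra_simps)
    have d1: "((\<lambda>t. w t \<bullet> w t) has_real_derivative 2 * (w t \<bullet> w' t)) (at t)"
      using has_derivative_inner[OF wd wd] unfolding has_field_derivative_def eq .
    have d0: "((\<lambda>t. exp (- t)) has_real_derivative - exp (- t)) (at t)"
      by (auto intro!: derivative_eq_intros)
    have "((\<lambda>t. exp (- t) * (w t \<bullet> w t)) has_real_derivative ?g' t) (at t)"
      using DERIV_mult[OF d0 d1] by (simp add: power2_norm_eq_inner algebra_simps)
    then have "(?g has_vector_derivative ?g' t) (at t)"
      unfolding has_real_derivative_iff_has_vector_derivative power2_norm_eq_inner .
    then show ?thesis by (rule has_vector_derivative_at_within)
  qed
  have "(?g' has_integral ?g 1 - ?g 0) {0..1}"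
    by (rule fundamental_theorem_of_calculus[OF _ dg]) auto
  moreover have "(?q has_integral integral {0..1} ?q) {0..1}"
    using cq integrable_continuous_interval by (simp add: has_integral_integral)
  moreover have "?g' t \<le> ?q t" if "t \<in> {0..1}" for t
  proof -
    define z where "z = w' t - \<i> * w t * b t"
    \<comment> \<open>The term \<open>\<i> * w t * b t\<close> is orthogonal to \<open>w t\<close>,
      so the derivative may be replaced by the covariant one.\<close>
    have "w t \<bullet> w' t = w t \<bullet> z"
      by (simp add: z_def inner_complex_def algebra_simps)
    also have "2 * (w t \<bullet> z) \<le> (cmod (w t))\<^sup>2 + (cmod z)\<^sup>2"
      using zero_le_power2[of "norm (w t - z)"]
      by (simp add: power2_norm_eq_inner inner_diff inner_commute algebra_simps)
    ultimately have "?g' t \<le> exp (- t) * (cmod z)\<^sup>2"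
      using mult_left_mono[of "2 * (w t \<bullet> w' t)" "(cmod (w t))\<^sup>2 + (cmod z)\<^sup>2" "exp (- t)"]
      by (simp add: algebra_simps)
    also have "\<dots> \<le> 1 * (cmod z)\<^sup>2" using that by (intro mult_right_mono) auto
    finally show ?thesis by (simp add: z_def)
  qed
  ultimately have "?g 1 - ?g 0 \<le> integral {0..1} ?q"
    by (rule has_integral_le)
  then have "(cmod (w 1))\<^sup>2 \<le> exp 1 * ((cmod (w 0))\<^sup>2 + integral {0..1} ?q)"
    by (simp add: exp_minus field_simps)
  moreover have "integral {0..1} ?q \<ge> 0" by (intro integral_nonneg integrable_continuous_interval cq) simp
  ultimately show ?thesis
    unfolding nn_integral_continuous_interval[OF cq zero_le_power2]
    by (simp add: ennreal_mult[symmetric] ennreal_plus[symmetric] ennreal_leI del: ennreal_plus)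
qed

text \<open>The connection form has holonomy \<open>-1\<close> around the circle, so transporting \<open>w 0\<close>
  once around moves it by \<open>2 |w 0|\<close>.\<close>

lemma circle_transport_bound:
  fixes w :: "real \<Rightarrow> complex"
  assumes w: "\<And>t. t \<in> {0..2*pi} \<Longrightarrow> (w has_vector_derivative w' t) (at t)"
    and w': "continuous_on {0..2*pi} w'" and per: "w (2*pi) = w 0"
  shows "ennreal ((cmod (w 0))\<^sup>2) \<le> ennreal (pi/2) *
    (\<integral>\<^sup>+ t. ennreal ((cmod (w' t - \<i> * w t * of_real (1/2)))\<^sup>2) * indicator {0..2*pi} t \<partial>lborel)"
proof -
  let ?z = "\<lambda>t. w' t - \<i> * w t * of_real (1/2)"
  let ?q = "\<lambda>t. (cmod (?z t))\<^sup>2"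
  \<comment> \<open>Integrating factor: it turns the covariant derivative into an ordinary one and
    equals -1 after a full turn.\<close>
  let ?e = "\<lambda>t. exp (- \<i> * of_real t / 2)"
  have cw: "continuous_on {0..2*pi} w"
    by (intro continuous_at_imp_continuous_on ballI) (meson w has_vector_derivative_continuous)
  have cz: "continuous_on {0..2*pi} ?z" by (intro continuous_intros cw w')
  then have cq: "continuous_on {0..2*pi} ?q" by (intro continuous_on_power continuous_on_norm)
  have de: "(?e has_vector_derivative (- \<i> / 2) * ?e t) (at t within {0..2*pi})" for t
    by (rule has_vector_derivative_real_field[of "\<lambda>z. exp (- \<i> * z / 2)", unfolded o_def])
      (auto intro!: derivative_eq_intros)
  have dg: "((\<lambda>t. ?e t * w t) has_vector_derivative ?e t * ?z t) (at t within {0..2*pi})" if "t \<in> {0..2*pi}" for t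
    using has_vector_derivative_mult[OF de[of t] has_vector_derivative_at_within[OF w[OF that]]]
    by (simp add: algebra_simps)
  have "((\<lambda>t. ?e t * ?z t) has_integral ?e (2*pi) * w (2*pi) - ?e 0 * w 0) {0..2*pi}"
    by (rule fundamental_theorem_of_calculus[OF _ dg]) auto
  moreover have "?e (2*pi) = - 1"
    by (simp add: exp_minus exp_pi_i')
  ultimately have I: "((\<lambda>t. ?e t * ?z t) has_integral (- 2 * w 0)) {0..2*pi}"
    using per by simp
  have "norm (integral {0..2*pi} (\<lambda>t. ?e t * ?z t)) \<le> integral {0..2*pi} (\<lambda>t. cmod (?z t))"
    by (rule integral_norm_bound_integral)
      (auto intro!: integrable_continuous_interval continuous_intros cw w' simp: norm_mult)
  then have 1: "2 * cmod (w 0) \<le> integral {0..2*pi} (\<lambda>t. cmod (?z t))"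
    using integral_unique[OF I] by (simp add: norm_mult)
  let ?a = "cmod (w 0)"
  \<comment> \<open>Multiplying by \<open>?a\<close> under the integral replaces Cauchy-Schwarz for
    integrals by a pointwise inequality.\<close>
  have "2 * ?a * ?a \<le> integral {0..2*pi} (\<lambda>t. cmod (?z t)) * ?a"
    using 1 by (intro mult_right_mono) auto
  also have "\<dots> = integral {0..2*pi} (\<lambda>t. cmod (?z t) * ?a)" by simp
  also have "\<dots> \<le> integral {0..2*pi} (\<lambda>t. ?a\<^sup>2 / (2*pi) + (pi/2) * ?q t)"
  proof (rule integral_le)
    \<comment> \<open>Weighted so that the first summand integrates to \<open>?a\<^sup>2\<close>
      over the circle, which is half of the left-hand side; the other half survives.\<close>
    show "cmod (?z t) * ?a \<le> ?a\<^sup>2 / (2*pi) + (pi/2) * ?q t" for t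
    proof -
      have "0 \<le> (?a - pi * cmod (?z t))\<^sup>2 / (2*pi)" by simp
      also have "\<dots> = ?a\<^sup>2 / (2*pi) + (pi/2) * ?q t - cmod (?z t) * ?a"
        by (simp add: power2_eq_square field_simps)
      finally show ?thesis by simp
    qed
  qed (auto intro!: integrable_continuous_interval continuous_intros cw w')
  also have "\<dots> = ?a\<^sup>2 + (pi/2) * integral {0..2*pi} ?q"
  proof -
    have "integral {0..2*pi} (\<lambda>t. ?a\<^sup>2 / (2*pi) + (pi/2) * ?q t) =
        integral {0..2*pi} (\<lambda>t. ?a\<^sup>2 / (2*pi)) + integral {0..2*pi} (\<lambda>t. (pi/2) * ?q t)"
      by (rule Henstock_Kurzweil_Integration.integral_add)
        (auto intro!: integrable_continuous_interval continuous_intros cw w')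
    then show ?thesis by simp
  qed
  finally have "?a\<^sup>2 \<le> (pi/2) * integral {0..2*pi} ?q" by (simp add: power2_eq_square)
  moreover have "integral {0..2*pi} ?q \<ge> 0" by (intro integral_nonneg integrable_continuous_interval cq) simp
  ultimately show ?thesis
    unfolding nn_integral_continuous_interval[OF cq zero_le_power2]
    by (simp add: ennreal_mult[symmetric] ennreal_leI)
qed

section \<open>Area-preserving flows and rotations\<close>

lemma nn_integral_measure_preserving:
  fixes f :: "real^2 \<Rightarrow> ennreal"
  assumes "distr lborel borel \<phi> = lborel" "\<phi> \<in> borel_measurable borel" "f \<in> borel_measurable borel"
  shows "(\<integral>\<^sup>+ y. f (\<phi> y) \<partial>lborel) = (\<integral>\<^sup>+ y. f y \<partial>lborel)"
proof -
  have "(\<integral>\<^sup>+ y. f y \<partial>distr lborel borel \<phi>) = (\<integral>\<^sup>+ y. f (\<phi> y) \<partial>lborel)"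
    using assms by (intro nn_integral_distr) auto
  then show ?thesis using assms(1) by simp
qed

text \<open>Tonelli: integrating a transport bound over all starting points costs only the time
  \<open>L\<close>, because every \<open>\<phi> t\<close> preserves area.\<close>

lemma nn_integral_flow_average:
  fixes f :: "real^2 \<Rightarrow> ennreal" and \<phi> :: "real \<Rightarrow> real^2 \<Rightarrow> real^2"
  assumes \<phi>: "\<And>t. distr lborel borel (\<phi> t) = lborel"
    and m: "(\<lambda>(y, t). \<phi> t y) \<in> borel_measurable (borel \<Otimes>\<^sub>M borel)"
    and f [measurable]: "f \<in> borel_measurable borel" and L: "L \<ge> 0"
  shows "(\<integral>\<^sup>+ y. (\<integral>\<^sup>+ t. f (\<phi> t y) * indicator {0..L} t \<partial>lborel) \<partial>lborel) =
     ennreal L * (\<integral>\<^sup>+ y. f y \<partial>lborel)"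
proof -
  have [measurable]: "(\<lambda>p. \<phi> (fst p) (snd p)) \<in> borel_measurable (borel \<Otimes>\<^sub>M borel)"
    using measurable_compose[OF measurable_pair_swap' m] by (simp add: case_prod_beta')
  have mt: "\<phi> t \<in> borel_measurable borel" for t
    using measurable_compose[OF measurable_Pair2'[of t borel borel] m] by simp
  have "(\<integral>\<^sup>+ y. (\<integral>\<^sup>+ t. f (\<phi> t y) * indicator {0..L} t \<partial>lborel) \<partial>lborel) =
    (\<integral>\<^sup>+ t. (\<integral>\<^sup>+ y. f (\<phi> t y) * indicator {0..L} t \<partial>lborel) \<partial>lborel)"
  proof (rule lborel_pair.Fubini')
    show "case_prod (\<lambda>t y. f (\<phi> t y) * indicator {0..L} t) \<in> borel_measurable (lborel \<Otimes>\<^sub>M lborel)"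
      unfolding measurable_cong_sets[OF sets_pair_measure_cong[OF sets_lborel sets_lborel] refl] case_prod_beta'
      by measurable
  qed
  also have "\<dots> = (\<integral>\<^sup>+ t. (\<integral>\<^sup>+ y. f y \<partial>lborel) * indicator {0..L} t \<partial>lborel)"
  proof (rule nn_integral_cong)
    fix t
    have "(\<integral>\<^sup>+ y. f (\<phi> t y) * indicator {0..L} t \<partial>lborel) = (\<integral>\<^sup>+ y. f (\<phi> t y) \<partial>lborel) * indicator {0..L} t"
      using mt by (intro nn_integral_multc) (auto intro: measurable_compose[OF _ f])
    then show "(\<integral>\<^sup>+ y. f (\<phi> t y) * indicator {0..L} t \<partial>lborel) = (\<integral>\<^sup>+ y. f y \<partial>lborel) * indicator {0..L} t"
      by (simp add: nn_integral_measure_preserving[OF \<phi> mt f])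
  qed
  also have "\<dots> = ennreal L * (\<integral>\<^sup>+ y. f y \<partial>lborel)"
    using L by (simp add: nn_integral_cmult_indicator mult.commute)
  finally show ?thesis .
qed

definition rotation :: "real \<Rightarrow> real^2 \<Rightarrow> real^2" where
  "rotation t x = vector [cos t * x$1 - sin t * x$2, sin t * x$1 + cos t * x$2]"

text \<open>The velocity field of \<open>rotation\<close>, that is, the coordinate field of the
  polar angle.\<close>

definition angular_field :: "real^2 \<Rightarrow> real^2" where
  "angular_field x = vector [- x$2, x$1]"

lemma rotation_nth [simp]:
  "rotation t x $ 1 = cos t * x$1 - sin t * x$2" "rotation t x $ 2 = sin t * x$1 + cos t * x$2"
  by (simp_all add: rotation_def)

lemma angular_field_nth [simp]: "angular_field x $ 1 = - x$2" "angular_field x $ 2 = x$1"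
  by (simp_all add: angular_field_def)

lemma rotation_radius: "(rotation t x $ 1)\<^sup>2 + (rotation t x $ 2)\<^sup>2 = (x$1)\<^sup>2 + (x$2)\<^sup>2"
proof -
  have "(cos t * x$1 - sin t * x$2)\<^sup>2 + (sin t * x$1 + cos t * x$2)\<^sup>2 =
     ((cos t)\<^sup>2 + (sin t)\<^sup>2) * ((x$1)\<^sup>2 + (x$2)\<^sup>2)"
    by algebra
  then show ?thesis by simp
qed

lemma rotation_continuous: "continuous_on UNIV (\<lambda>(x, t). rotation t x)"
proof (rule continuous_on_vecI)
  have "continuous_on UNIV (\<lambda>p :: (real^2) \<times> real. cos (snd p) * fst p $ 1 - sin (snd p) * fst p $ 2)"
    "continuous_on UNIV (\<lambda>p :: (real^2) \<times> real. sin (snd p) * fst p $ 1 + cos (snd p) * fst p $ 2)"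
    by (intro continuous_intros)+
  then show "continuous_on UNIV (\<lambda>y. (case y of (x, t) \<Rightarrow> rotation t x) $ i)" for i
    using exhaust_2[of i] by (auto simp: case_prod_beta')
qed

lemma rotation_linear: "linear (rotation t)"
  by (rule linearI) (simp_all add: vec_eq_iff forall_2 algebra_simps)

lemma rotation_inverse: "rotation (- t) (rotation t x) = x"
proof -
  have "cos t * cos t + sin t * sin t = 1" by (simp flip: power2_eq_square)
  then have "cos t * (cos t * a - sin t * b) + sin t * (sin t * a + cos t * b) = a"
    "- sin t * (cos t * a - sin t * b) + cos t * (sin t * a + cos t * b) = b" for a b
    by algebra+
  then show ?thesis by (simp add: vec_eq_iff forall_2)
qed

lemma rotation_measure_preserving: "distr lborel borel (rotation t) = lborel"
proof (rule measure_eqI)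
  have c: "continuous_on UNIV (rotation t)"
    using linear_continuous_on[of "rotation t"] rotation_linear linear_linear by blast
  then have m [measurable]: "rotation t \<in> borel_measurable borel" by (rule borel_measurable_continuous_onI)
  have d: "det (matrix (rotation t)) = 1"
    by (simp add: det_2 matrix_def axis_def)
  have inj: "inj (rotation t)"
    by (rule inj_on_inverseI[of _ "rotation (- t)"]) (rule rotation_inverse)
  have surj: "range (rotation t) = UNIV"
    by (rule surjI[of _ "rotation (- t)"]) (use rotation_inverse[of "- t"] in simp)
  fix E assume "E \<in> sets (distr lborel borel (rotation t))"
  then have E [measurable]: "E \<in> sets borel" by simp
  have "emeasure lborel E = (\<integral>\<^sup>+x. ennreal (indicator E x * indicator (range (rotation t)) x) \<partial>lborel)"
    using E surj by (simp add: nn_integral_indicator[symmetric] ennreal_indicator del: nn_integral_indicator)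
  also have "\<dots> = (\<integral>\<^sup>+x. ennreal (\<bar>det (matrix (rotation t))\<bar> * indicator E (rotation t x) * indicator UNIV x) \<partial>lborel)"
  proof (rule nn_integral_change_of_variables)
    show "(rotation t has_derivative rotation t) (at x)" for x
      by (rule linear_imp_has_derivative[OF rotation_linear])
    show "(\<lambda>x. indicator E x * indicator (range (rotation t)) x :: real) \<in> borel_measurable borel"
      unfolding surj by measurable
    show "(\<lambda>x. \<bar>det (matrix (rotation t))\<bar> * indicator E (rotation t x) * indicator UNIV x :: real) \<in> borel_measurable borel"
      by measurable
  qed (use inj in auto)
  also have "\<dots> = (\<integral>\<^sup>+x. indicator (rotation t -` E) x \<partial>lborel)"
    unfolding d by (intro nn_integral_cong) (auto simp: indicator_def)
  also have "\<dots> = emeasure (distr lborel borel (rotation t)) E"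
    using measurable_sets[OF m E] by (simp add: emeasure_distr)
  finally show "emeasure (distr lborel borel (rotation t)) E = emeasure lborel E" ..
qed simp

lemma rotation_has_vector_derivative:
  "((\<lambda>t. rotation t x) has_vector_derivative angular_field (rotation t x)) (at t)"
proof -
  have "((\<lambda>t. rotation t x $ i) has_vector_derivative angular_field (rotation t x) $ i) (at t)" for i
  proof (cases "i = 1")
    case True
    then show ?thesis
      by (auto intro!: derivative_eq_intros simp: has_real_derivative_iff_has_vector_derivative[symmetric] algebra_simps)
  next
    case False
    then have "i = 2" using exhaust_2[of i] by auto
    then show ?thesis
      by (auto intro!: derivative_eq_intros simp: has_real_derivative_iff_has_vector_derivative[symmetric] algebra_simps)
  qed
  then show ?thesis
    unfolding has_vector_derivative_def by (subst has_derivative_componentwise_within)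
      (auto simp: Basis_vec_def inner_axis)
qed

lemma rotation_0 [simp]: "rotation 0 x = x" "rotation (2*pi) x = x"
  by (simp_all add: vec_eq_iff forall_2)

section \<open>The magnetic field and the metrics\<close>

text \<open>The shift by 3 puts the centre of the first hole at the origin.\<close>

lemma smooth_map_on_standard_polynomial:
  "smooth_map_on (\<lambda>v::real^2. standard_polynomial g (v$1 + 3) (v$2)) UNIV"
  unfolding standard_polynomial_def power2_eq_square
  by (intro smooth_map_on_mult smooth_map_on_prod smooth_map_on_diff smooth_map_on_add
      smooth_map_on_vec_nth smooth_map_on_const smooth_map_on_ident open_UNIV)

lemma standard_polynomial_split:
  assumes "g \<ge> 1"
  shows "standard_polynomial g (a + 3) b = ((3 * real g + 2)\<^sup>2 - (a + 3)\<^sup>2 - b\<^sup>2) *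
    ((a\<^sup>2 + b\<^sup>2 - 1) * (\<Prod>k=2..g. (a + 3 - 3 * real k)\<^sup>2 + b\<^sup>2 - 1))"
proof -
  have "{1..g} = insert 1 {2..g}" using assms by auto
  then show ?thesis by (simp add: standard_polynomial_def)
qed

text \<open>Seen from the first hole, the other centres have abscissa at least 3, so a point with
  abscissa below 2 is outside of their closed unit discs.\<close>

lemma standard_polynomial_far_holes:
  assumes "\<bar>a\<bar> < 2"
  shows "(\<Prod>k=2..g. (a + 3 - 3 * real k)\<^sup>2 + b\<^sup>2 - 1) > 0"
proof (rule prod_pos)
  fix k assume "k \<in> {2..g}"
  then have "real k \<ge> 2" by simp
  then have "1 < 3 * real k - 3 - a" using assms by linarith
  then have "1 < (3 * real k - 3 - a)\<^sup>2" by (simp add: one_less_power)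
  also have "\<dots> = (a + 3 - 3 * real k)\<^sup>2" by (simp add: power2_eq_square algebra_simps)
  finally have "1 < (a + 3 - 3 * real k)\<^sup>2" .
  then show "0 < (a + 3 - 3 * real k)\<^sup>2 + b\<^sup>2 - 1" by (smt (verit) zero_le_power2)
qed

lemma abs_less_2:
  assumes "a\<^sup>2 + b\<^sup>2 < 4" shows "\<bar>a\<bar> < (2::real)"
proof -
  have "a\<^sup>2 < 4" using zero_le_power2[of b] assms by linarith
  then show ?thesis using power2_less_imp_less[of "\<bar>a\<bar>" 2] by simp
qed

text \<open>The outer circle has radius \<open>3 * g + 2\<close>, hence at least 5, while a point
  within distance 2 of the centre \<open>(3, 0)\<close> has norm below 5.\<close>

lemma standard_polynomial_outer:
  assumes "g \<ge> 1" "a\<^sup>2 + b\<^sup>2 < 4"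
  shows "(3 * real g + 2)\<^sup>2 - (a + 3)\<^sup>2 - b\<^sup>2 > 0"
proof -
  have "(a + 3)\<^sup>2 + b\<^sup>2 = a\<^sup>2 + b\<^sup>2 + 6 * a + 9" by (simp add: power2_eq_square algebra_simps)
  also have "\<dots> < 25" using assms(2) abs_less_2[OF assms(2)] by linarith
  also have "25 \<le> (3 * real g + 2)\<^sup>2"
    using power_mono[of 5 "3 * real g + 2" 2] assms(1) by simp
  finally show ?thesis by simp
qed

lemma standard_polynomial_pos:
  assumes "g \<ge> 1" "1 < a\<^sup>2 + b\<^sup>2" "a\<^sup>2 + b\<^sup>2 < 4"
  shows "standard_polynomial g (a + 3) b > 0"
  unfolding standard_polynomial_split[OF assms(1)]
  using standard_polynomial_outer[OF assms(1,3)] standard_polynomial_far_holes[OF abs_less_2[OF assms(3)], where g = g and b = b] assms(2)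
  by (intro mult_pos_pos) auto

text \<open>At the centre of the first hole exactly one factor is negative. So the surface misses
  the vertical line on which the angular form is singular.\<close>

lemma standard_polynomial_center:
  assumes "g \<ge> 1" shows "standard_polynomial g (0 + 3) 0 < 0"
proof -
  have 1: "(3 * real g + 2)\<^sup>2 - (0 + 3)\<^sup>2 - 0\<^sup>2 > 0"
    using standard_polynomial_outer[OF assms, of 0 0] by simp
  have 2: "(\<Prod>k=2..g. (0 + 3 - 3 * real k)\<^sup>2 + 0\<^sup>2 - 1) > 0"
    by (rule standard_polynomial_far_holes) simp
  show ?thesis
    unfolding standard_polynomial_split[OF assms]
    by (intro mult_pos_neg[OF 1] mult_neg_pos[OF _ 2]) simp
qed

definition planar_part :: "real^3 \<Rightarrow> real^2" where
  "planar_part v = vector [v$1 - 3, v$2]"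

definition radius_sq :: "real^2 \<Rightarrow> real" where
  "radius_sq x = (x$1)\<^sup>2 + (x$2)\<^sup>2"

lemma planar_part_nth [simp]: "planar_part v $ 1 = v$1 - 3" "planar_part v $ 2 = v$2"
  by (simp_all add: planar_part_def)

lemma standard_surface_radius_pos:
  assumes "g \<ge> 1" "v \<in> standard_surface g"
  shows "radius_sq (planar_part v) > 0"
proof (rule ccontr)
  assume "\<not> ?thesis"
  then have "(v$1 - 3)\<^sup>2 + (v$2)\<^sup>2 = 0"
    unfolding radius_sq_def by (smt (verit) planar_part_nth zero_le_power2)
  then have "v$1 = 0 + 3" "v$2 = 0" by (auto simp: sum_power2_eq_zero_iff)
  then have "(v$3)\<^sup>2 < 0"
    using assms(2) standard_polynomial_center[OF assms(1)] by (simp add: standard_surface_def)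
  then show False by (simp add: not_less[symmetric])
qed

text \<open>The form is \<open>k\<close> times the differential of the polar angle of
  \<open>(a, b)\<close>. Mixed second derivatives cancel by symmetry, and what remains vanishes
  identically. Arbitrary functions \<open>a\<close> and \<open>b\<close> cover all charts at
  once.\<close>

lemma angular_form_closed:
  fixes a b :: "real^2 \<Rightarrow> real" and k :: real
  assumes S: "open S" "y \<in> S" and a: "smooth_map_on a S" and b: "smooth_map_on b S"
    and nz: "(a y)\<^sup>2 + (b y)\<^sup>2 \<noteq> 0"
  shows "partial_deriv 1 (\<lambda>x. k * inverse ((a x)\<^sup>2 + (b x)\<^sup>2) * (a x * partial_deriv 2 b x - b x * partial_deriv 2 a x)) y =
         partial_deriv 2 (\<lambda>x. k * inverse ((a x)\<^sup>2 + (b x)\<^sup>2) * (a x * partial_deriv 1 b x - b x * partial_deriv 1 a x)) y"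
proof -
  let ?D = "\<lambda>f. frechet_derivative f (at y)"
  have d: "(a has_derivative ?D a) (at y)" "(b has_derivative ?D b) (at y)"
    "(partial_deriv i a has_derivative ?D (partial_deriv i a)) (at y)"
    "(partial_deriv i b has_derivative ?D (partial_deriv i b)) (at y)" for i
    by (intro has_frechet_derivative smooth_map_on_differentiable[OF _ S(2)] smooth_map_on_partial_deriv a b)+
  let ?f = "(a y)\<^sup>2 + (b y)\<^sup>2"
  have P: "partial_deriv j (\<lambda>x. k * inverse ((a x)\<^sup>2 + (b x)\<^sup>2) * (a x * partial_deriv i b x - b x * partial_deriv i a x)) y =
    k * (- (inverse ?f * (2 * a y * partial_deriv j a y + 2 * b y * partial_deriv j b y) * inverse ?f)
       * (a y * partial_deriv i b y - b y * partial_deriv i a y) +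
     inverse ?f * (partial_deriv j a y * partial_deriv i b y + a y * partial_deriv j (partial_deriv i b) y
       - partial_deriv j b y * partial_deriv i a y - b y * partial_deriv j (partial_deriv i a) y))" for i j
  proof -
    have "((\<lambda>x. k * inverse ((a x)\<^sup>2 + (b x)\<^sup>2) * (a x * partial_deriv i b x - b x * partial_deriv i a x))
      has_derivative (\<lambda>v. k * (- (inverse ?f * (2 * a y * ?D a v + 2 * b y * ?D b v) * inverse ?f)
       * (a y * partial_deriv i b y - b y * partial_deriv i a y) +
     inverse ?f * (?D a v * partial_deriv i b y + a y * ?D (partial_deriv i b) v
       - ?D b v * partial_deriv i a y - b y * ?D (partial_deriv i a) v)))) (at y)"
      by (rule derivative_eq_intros d refl nz | simp add: nz)+ (simp add: fun_eq_iff algebra_simps)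
    from frechet_derivative_eq[OF this] show ?thesis by (simp add: partial_deriv_def)
  qed
  have sym: "partial_deriv 1 (partial_deriv 2 f) y = partial_deriv 2 (partial_deriv 1 f) y"
    if "smooth_map_on f S" for f :: "real^2 \<Rightarrow> real"
    using smooth_map_on_derivative_symmetric[OF S(1) that S(2), of "axis 2 1" "axis 1 1"]
    by (simp add: partial_deriv_def[abs_def])
  \<comment> \<open>With the reciprocal as a variable subject to one polynomial relation, the claim
    becomes a question of ideal membership.\<close>
  define I where "I = inverse ?f"
  have I: "I * ?f = 1" using nz by (simp add: I_def)
  show ?thesis
    unfolding P sym[OF a] sym[OF b] I_def[symmetric] using I by algebra
qed

lemma partial_deriv_cong:
  assumes "open S" "y \<in> S" "\<And>x. x \<in> S \<Longrightarrow> f x = k x"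
  shows "partial_deriv i f y = partial_deriv i k y"
proof -
  have "(f has_derivative f') (at y) \<longleftrightarrow> (k has_derivative f') (at y)" for f'
    using has_derivative_transform_within_open[OF _ assms(1,2), of f f' UNIV k]
      has_derivative_transform_within_open[OF _ assms(1,2), of k f' UNIV f] assms(3) by auto
  then show ?thesis unfolding partial_deriv_def frechet_derivative_def by simp
qed

definition surface_differential :: "('a \<Rightarrow> real) \<Rightarrow> 'a chart \<Rightarrow> 'a \<Rightarrow> real^2" where
  "surface_differential q c p = (\<chi> i. partial_deriv i (q \<circ> chart_inv c) (chart_map c p))"

lemma surface_differential_change:
  assumes "surface_chart X c" "surface_chart X d" "p \<in> chart_dom c \<inter> chart_dom d"
    and "transition c d differentiable (at (chart_map c p))"
    and "(q \<circ> chart_inv d) differentiable (at (chart_map d p))"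
  shows "surface_differential q c p = transpose (transition_jacobian c d p) *v surface_differential q d p"
  unfolding surface_differential_def change_of_chart_partial_deriv[OF assms]
  by (simp add: vec_eq_iff matrix_vector_mult_def transpose_def)

lemma smooth_function_compose_linear:
  assumes "smooth_atlas X \<A>" "smooth_function \<A> f" "bounded_linear L"
  shows "smooth_function \<A> (\<lambda>p. L (f p))"
  unfolding smooth_function_def
proof
  fix c assume c: "c \<in> \<A>"
  have "open (chart_range c)" using smooth_atlas_chart[OF assms(1) c] by (simp add: surface_chart_def)
  from smooth_map_on_bounded_linear[OF this assms(3), of "f \<circ> chart_inv c"] assms(2) c
  show "smooth_map_on ((\<lambda>p. L (f p)) \<circ> chart_inv c) (chart_range c)"
    by (simp add: smooth_function_def o_def)
qed

definition bump :: "nat \<Rightarrow> real \<Rightarrow> real" where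
  "bump n r = exp (real n * ((r - 2) * (3 - r)))"

section \<open>The stretched metrics and the field on the surface\<close>

locale handle_surface =
  fixes X :: "'a topology" and \<A> :: "'a chart set" and g :: nat and F :: "'a \<Rightarrow> real^3"
  assumes g: "g \<ge> 1" and smooth: "smooth_surface X \<A>" and compact: "compact_space X"
    and F_homeo: "homeomorphic_map X (top_of_set (standard_surface g)) F"
    and F_smooth: "smooth_function \<A> F"
    and F_immersion: "\<And>c y. c \<in> \<A> \<Longrightarrow> y \<in> chart_range c \<Longrightarrow> inj (frechet_derivative (F \<circ> chart_inv c) (at y))"
begin

lemma atlas: "smooth_atlas X \<A>"
  using smooth by (simp add: smooth_surface_def)

lemma open_range: "c \<in> \<A> \<Longrightarrow> open (chart_range c)"
  using smooth_atlas_chart[OF atlas] by (simp add: surface_chart_def)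

definition radius :: "'a \<Rightarrow> real" where
  "radius p = radius_sq (planar_part (F p))"

lemma radius_alt: "radius p = (F p $ 1 - 3)\<^sup>2 + (F p $ 2)\<^sup>2"
  by (simp add: radius_def radius_sq_def)

lemma radius_pos: "p \<in> topspace X \<Longrightarrow> radius p > 0"
proof -
  assume "p \<in> topspace X"
  then have "F p \<in> standard_surface g"
    using homeomorphic_imp_surjective_map[OF F_homeo] by auto
  then show ?thesis using standard_surface_radius_pos[OF g] by (simp add: radius_def)
qed

lemma smooth_F_nth: "smooth_function \<A> (\<lambda>p. F p $ i)"
  by (rule smooth_function_compose_linear[OF atlas F_smooth bounded_linear_vec_nth])

lemma smooth_F_local: "c \<in> \<A> \<Longrightarrow> smooth_map_on (\<lambda>y. F (chart_inv c y) $ i) (chart_range c)"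
  using smooth_F_nth by (simp add: smooth_function_def o_def)

lemma smooth_radius_local: "c \<in> \<A> \<Longrightarrow> smooth_map_on (\<lambda>y. radius (chart_inv c y)) (chart_range c)"
  unfolding radius_alt power2_eq_square
  by (intro smooth_map_on_add smooth_map_on_mult smooth_map_on_diff smooth_map_on_const smooth_F_local open_range)

lemma smooth_radius: "smooth_function \<A> radius"
  using smooth_radius_local by (simp add: smooth_function_def o_def)

text \<open>The coefficient \<open>e\<close> is a number here, so that the metrics
  \<open>stretched n\<close> can be enclosed between \<open>gram 0\<close> and
  \<open>gram 1\<close>.\<close>

definition gram :: "real \<Rightarrow> 'a metric_tensor" where
  "gram e c p = (\<chi> i j.
     (\<Sum>m\<in>UNIV. surface_differential (\<lambda>p. F p $ m) c p $ i * surface_differential (\<lambda>p. F p $ m) c p $ j) +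
     e * (surface_differential radius c p $ i * surface_differential radius c p $ j))"

definition stretched :: "nat \<Rightarrow> 'a metric_tensor" where
  "stretched n c p = gram (bump n (radius p)) c p"

definition field :: "'a one_form" where
  "field c p = (\<chi> i. 1/2 * inverse (radius p) *
     ((F p $ 1 - 3) * surface_differential (\<lambda>p. F p $ 2) c p $ i -
      F p $ 2 * surface_differential (\<lambda>p. F p $ 1) c p $ i))"

lemma gram_form:
  "v \<bullet> (gram e c p *v w) = (\<Sum>m\<in>UNIV. (v \<bullet> surface_differential (\<lambda>p. F p $ m) c p) * (w \<bullet> surface_differential (\<lambda>p. F p $ m) c p)) +
     e * ((v \<bullet> surface_differential radius c p) * (w \<bullet> surface_differential radius c p))"
  by (simp add: gram_def inner_vec_def matrix_vector_mult_def sum_2 sum_3 algebra_simps)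

lemma gram_symmetric: "transpose (gram e c p) = gram e c p"
  by (simp add: gram_def transpose_def vec_eq_iff mult.commute)

lemma bump_pos: "bump n r > 0" by (simp add: bump_def)

text \<open>The stretching factor is a function on the surface, hence the same in both charts; all
  else is a sum of squares of differentials.\<close>

lemma stretched_change:
  assumes sc: "surface_chart X c" and sd: "surface_chart X d" and p: "p \<in> chart_dom c \<inter> chart_dom d"
    and t: "transition c d differentiable (at (chart_map c p))"
    and F: "(F \<circ> chart_inv d) differentiable (at (chart_map d p))"
    and r: "(radius \<circ> chart_inv d) differentiable (at (chart_map d p))"
  shows "stretched n c p = transpose (transition_jacobian c d p) ** stretched n d p ** transition_jacobian c d p"
proof -
  have "((\<lambda>p. F p $ m) \<circ> chart_inv d) differentiable (at (chart_map d p))" for m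
    using differentiableI[OF bounded_linear.has_derivative[OF bounded_linear_vec_nth has_frechet_derivative[OF F]]]
    by (simp add: o_def)
  then have 1: "surface_differential (\<lambda>p. F p $ m) c p = transpose (transition_jacobian c d p) *v surface_differential (\<lambda>p. F p $ m) d p" for m
    by (rule surface_differential_change[OF sc sd p t])
  note 2 = surface_differential_change[OF sc sd p t r]
  show ?thesis
    unfolding stretched_def gram_def 1 2
    by (simp add: vec_eq_iff matrix_matrix_mult_def matrix_vector_mult_def transpose_def sum_2 sum_3 algebra_simps)
qed

text \<open>The immersion makes the pulled-back Euclidean part positive definite, and the stretching
  adds a nonnegative square.\<close>

lemma gram_positive:
  assumes "inj (frechet_derivative (F \<circ> chart_inv c) (at (chart_map c p)))"
    and F: "(F \<circ> chart_inv c) differentiable (at (chart_map c p))" and e: "e \<ge> 0"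
  shows "positive_form (gram e c p)"
  unfolding positive_form_def
proof (intro conjI allI impI gram_symmetric)
  fix v :: "real^2" assume v: "v \<noteq> 0"
  let ?D = "frechet_derivative (F \<circ> chart_inv c) (at (chart_map c p))"
  have "?D v \<noteq> ?D 0" using assms(1) v by (auto dest: injD)
  then have "?D v \<noteq> 0" using linear_0[OF linear_frechet_derivative[OF F]] by simp
  then obtain m where m: "?D v $ m \<noteq> 0" by (auto simp: vec_eq_iff)
  have "v \<bullet> surface_differential (\<lambda>p. F p $ k) c p = ?D v $ k" for k
  proof -
    have d: "((\<lambda>p. F p $ k) \<circ> chart_inv c has_derivative (\<lambda>v. ?D v $ k)) (at (chart_map c p))"
      using bounded_linear.has_derivative[OF bounded_linear_vec_nth has_frechet_derivative[OF F]] by (simp add: o_def)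
    then have "?D v $ k = frechet_derivative ((\<lambda>p. F p $ k) \<circ> chart_inv c) (at (chart_map c p)) v"
      by (simp add: frechet_derivative_eq)
    also have "\<dots> = (\<Sum>i\<in>UNIV. v$i *\<^sub>R partial_deriv i ((\<lambda>p. F p $ k) \<circ> chart_inv c) (chart_map c p))"
      using d by (intro frechet_derivative_partial) (auto simp: differentiable_def)
    finally show ?thesis by (simp add: surface_differential_def inner_vec_def)
  qed
  then have "v \<bullet> (gram e c p *v v) \<ge> (\<Sum>k\<in>UNIV. (?D v $ k)\<^sup>2)"
    using e by (simp add: gram_form power2_eq_square)
  moreover have "(\<Sum>k\<in>UNIV. (?D v $ k)\<^sup>2) > 0"
    using m by (intro sum_pos2[of _ m]) auto
  ultimately show "v \<bullet> (gram e c p *v v) > 0" by linarith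
qed

lemma differential_local:
  "y \<in> chart_range c \<Longrightarrow> surface_differential q c (chart_inv c y) $ i = partial_deriv i (q \<circ> chart_inv c) y"
  by (simp add: surface_differential_def chart_map_inv)

lemma stretched_smooth:
  assumes c: "c \<in> \<A>"
  shows "smooth_map_on (stretched n c \<circ> chart_inv c) (chart_range c)"
proof (intro smooth_map_on_vecI open_range c)
  fix i j
  have "smooth_map_on (\<lambda>y. (\<Sum>m\<in>UNIV. partial_deriv i ((\<lambda>p. F p $ m) \<circ> chart_inv c) y * partial_deriv j ((\<lambda>p. F p $ m) \<circ> chart_inv c) y) +
     exp (real n * ((radius (chart_inv c y) - 2) * (3 - radius (chart_inv c y)))) *
      (partial_deriv i (radius \<circ> chart_inv c) y * partial_deriv j (radius \<circ> chart_inv c) y)) (chart_range c)"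
    using c smooth_F_nth smooth_radius
    by (intro smooth_map_on_add smooth_map_on_mult smooth_map_on_sum smooth_map_on_exp smooth_map_on_const
        smooth_map_on_diff smooth_radius_local smooth_map_on_partial_deriv open_range)
      (simp_all add: smooth_function_def)
  then show "smooth_map_on (\<lambda>y. (stretched n c \<circ> chart_inv c) y $ i $ j) (chart_range c)"
    by (rule smooth_map_on_cong[OF open_range[OF c], rotated])
      (simp add: stretched_def gram_def differential_local bump_def)
qed

lemma stretched_metric: "riemannian_metric \<A> (stretched n)"
  unfolding riemannian_metric_def
proof (intro conjI ballI)
  show "smooth_map_on (stretched n c \<circ> chart_inv c) (chart_range c)" if "c \<in> \<A>" for c
    by (rule stretched_smooth[OF that])
  have dF: "(F \<circ> chart_inv c) differentiable (at (chart_map c p))" "(radius \<circ> chart_inv c) differentiable (at (chart_map c p))"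
    if "c \<in> \<A>" "p \<in> chart_dom c" for c p
    by (intro smooth_function_differentiable[OF atlas _ atlas_compatible[OF atlas that(1)] that(2)] F_smooth smooth_radius)+
  have "positive_form (stretched n c p)" if "c \<in> \<A>" "p \<in> chart_dom c" for c p
    unfolding stretched_def
    by (rule gram_positive[OF F_immersion[OF that(1) chart_map_in_range[OF that(2)]] dF(1)[OF that] less_imp_le[OF bump_pos]])
  then show "transpose (stretched n c p) = stretched n c p" "\<forall>v. v \<noteq> 0 \<longrightarrow> v \<bullet> (stretched n c p *v v) > 0"
    if "c \<in> \<A>" "p \<in> chart_dom c" for c p
    using that gram_symmetric unfolding positive_form_def stretched_def by blast+
  fix c d p assume c: "c \<in> \<A>" and d: "d \<in> \<A>" and p: "p \<in> chart_dom c \<inter> chart_dom d"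
  then have pd: "p \<in> chart_dom d" by blast
  show "stretched n c p = transpose (transition_jacobian c d p) ** stretched n d p ** transition_jacobian c d p"
    by (rule stretched_change[OF smooth_atlas_chart[OF atlas c] smooth_atlas_chart[OF atlas d] p
          smooth_atlas_transition[OF atlas c d p] dF[OF d pd]])
qed

lemma field_change:
  assumes sc: "surface_chart X c" and sd: "surface_chart X d" and p: "p \<in> chart_dom c \<inter> chart_dom d"
    and t: "transition c d differentiable (at (chart_map c p))"
    and F: "(F \<circ> chart_inv d) differentiable (at (chart_map d p))"
  shows "field c p = transpose (transition_jacobian c d p) *v field d p"
proof -
  have "((\<lambda>p. F p $ m) \<circ> chart_inv d) differentiable (at (chart_map d p))" for m
    using differentiableI[OF bounded_linear.has_derivative[OF bounded_linear_vec_nth has_frechet_derivative[OF F]]]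
    by (simp add: o_def)
  then have 1: "surface_differential (\<lambda>p. F p $ m) c p = transpose (transition_jacobian c d p) *v surface_differential (\<lambda>p. F p $ m) d p" for m
    by (rule surface_differential_change[OF sc sd p t])
  show ?thesis
    unfolding field_def 1
    by (simp add: vec_eq_iff matrix_vector_mult_def transpose_def sum_2 algebra_simps)
qed

text \<open>Brings the field into the shape of \<open>angular_form_closed\<close>, with
  \<open>F $ 1 - 3\<close> as first function; the constant does not affect derivatives.\<close>

lemma field_local:
  assumes c: "c \<in> \<A>" and y: "y \<in> chart_range c"
  shows "field c (chart_inv c y) $ i =
    1/2 * inverse ((F (chart_inv c y) $ 1 - 3)\<^sup>2 + (F (chart_inv c y) $ 2)\<^sup>2) *
     ((F (chart_inv c y) $ 1 - 3) * partial_deriv i (\<lambda>y. F (chart_inv c y) $ 2) y -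
      F (chart_inv c y) $ 2 * partial_deriv i (\<lambda>y. F (chart_inv c y) $ 1 - 3) y)"
proof -
  have d: "(\<lambda>y. F (chart_inv c y) $ 1) differentiable (at y)"
    by (rule smooth_map_on_differentiable[OF smooth_F_local[OF c] y])
  have "partial_deriv i (\<lambda>y. F (chart_inv c y) $ 1 - 3) y = partial_deriv i (\<lambda>y. F (chart_inv c y) $ 1) y"
    using frechet_derivative_eq[OF has_derivative_diff[OF has_frechet_derivative[OF d] has_derivative_const[of 3]]]
    by (simp add: partial_deriv_def)
  then show ?thesis
    by (simp add: field_def differential_local[OF y] radius_alt o_def)
qed

lemma field_smooth_one_form: "smooth_one_form \<A> field"
  unfolding smooth_one_form_def
proof (intro conjI ballI)
  fix c assume c: "c \<in> \<A>"
  have nz: "(F (chart_inv c y) $ 1 - 3)\<^sup>2 + (F (chart_inv c y) $ 2)\<^sup>2 \<noteq> 0" if "y \<in> chart_range c" for y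
    using radius_pos[OF subsetD[OF chart_dom_subset[OF smooth_atlas_chart[OF atlas c]] chart_inv_in_dom[OF that]]]
    unfolding radius_alt by linarith
  have sq: "smooth_map_on (\<lambda>y. (F (chart_inv c y) $ 1 - 3)\<^sup>2 + (F (chart_inv c y) $ 2)\<^sup>2) (chart_range c)"
    using smooth_radius_local[OF c] by (simp add: radius_alt)
  show "smooth_map_on (field c \<circ> chart_inv c) (chart_range c)"
  proof (rule smooth_map_on_vecI[OF open_range[OF c]])
    fix i
    have "smooth_map_on (\<lambda>y. 1/2 * inverse ((F (chart_inv c y) $ 1 - 3)\<^sup>2 + (F (chart_inv c y) $ 2)\<^sup>2) *
     ((F (chart_inv c y) $ 1 - 3) * partial_deriv i (\<lambda>y. F (chart_inv c y) $ 2) y -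
      F (chart_inv c y) $ 2 * partial_deriv i (\<lambda>y. F (chart_inv c y) $ 1 - 3) y)) (chart_range c)"
      by (intro smooth_map_on_mult smooth_map_on_diff smooth_map_on_const smooth_map_on_inverse sq nz
          smooth_map_on_partial_deriv smooth_F_local[OF c] open_range[OF c])
    then show "smooth_map_on (\<lambda>y. (field c \<circ> chart_inv c) y $ i) (chart_range c)"
      by (rule smooth_map_on_cong[OF open_range[OF c], rotated]) (simp add: field_local[OF c])
  qed
next
  fix c d p assume c: "c \<in> \<A>" and d: "d \<in> \<A>" and p: "p \<in> chart_dom c \<inter> chart_dom d"
  then have pd: "p \<in> chart_dom d" by blast
  show "field c p = transpose (transition_jacobian c d p) *v field d p"
    by (rule field_change[OF smooth_atlas_chart[OF atlas c] smooth_atlas_chart[OF atlas d] p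
          smooth_atlas_transition[OF atlas c d p]
          smooth_function_differentiable[OF atlas F_smooth atlas_compatible[OF atlas d] pd]])
qed

lemma field_closed: "closed_one_form \<A> field"
  unfolding closed_one_form_def
proof (intro conjI ballI field_smooth_one_form)
  fix c y assume c: "c \<in> \<A>" and y: "y \<in> chart_range c"
  have nz: "(F (chart_inv c y) $ 1 - 3)\<^sup>2 + (F (chart_inv c y) $ 2)\<^sup>2 \<noteq> 0"
    using radius_pos[OF subsetD[OF chart_dom_subset[OF smooth_atlas_chart[OF atlas c]] chart_inv_in_dom[OF y]]]
    unfolding radius_alt by linarith
  have eq: "partial_deriv j (\<lambda>x. field c (chart_inv c x) $ i) y =
    partial_deriv j (\<lambda>x. 1/2 * inverse ((F (chart_inv c x) $ 1 - 3)\<^sup>2 + (F (chart_inv c x) $ 2)\<^sup>2) *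
     ((F (chart_inv c x) $ 1 - 3) * partial_deriv i (\<lambda>y. F (chart_inv c y) $ 2) x -
      F (chart_inv c x) $ 2 * partial_deriv i (\<lambda>y. F (chart_inv c y) $ 1 - 3) x)) y" for i j
    by (rule partial_deriv_cong[OF open_range[OF c] y]) (rule field_local[OF c])
  show "partial_deriv 1 (\<lambda>x. field c (chart_inv c x) $ 2) y = partial_deriv 2 (\<lambda>x. field c (chart_inv c x) $ 1) y"
    unfolding eq
    by (rule angular_form_closed[OF open_range[OF c] y
          smooth_map_on_diff[OF open_range[OF c] smooth_F_local[OF c] smooth_map_on_const] smooth_F_local[OF c] nz])
qed

end

section \<open>The annular charts\<close>

text \<open>Contains the stretched ring \<open>2 \<le> r \<le> 3\<close> in its interior, so the
  sheets reach into the unstretched part. Its closure stays inside \<open>1 < r < 4\<close>, where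
  the height is positive, so slopes are bounded.\<close>

definition annulus :: "(real^2) set" where
  "annulus = {x. 3/2 < radius_sq x \<and> radius_sq x < 7/2}"

definition height :: "nat \<Rightarrow> real^2 \<Rightarrow> real" where
  "height g x = standard_polynomial g (x$1 + 3) (x$2)"

text \<open>Parametrises the upper sheet for \<open>\<sigma> = 1\<close> and the lower one for
  \<open>\<sigma> = - 1\<close>.\<close>

definition lift :: "nat \<Rightarrow> real \<Rightarrow> real^2 \<Rightarrow> real^3" where
  "lift g \<sigma> x = vector [x$1 + 3, x$2, \<sigma> * sqrt (height g x)]"

lemma lift_nth [simp]: "lift g \<sigma> x $ 1 = x$1 + 3" "lift g \<sigma> x $ 2 = x$2"
  "lift g \<sigma> x $ 3 = \<sigma> * sqrt (height g x)"
  by (simp_all add: lift_def)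

lemma planar_part_lift [simp]: "planar_part (lift g \<sigma> x) = x"
  by (simp add: vec_eq_iff forall_2)

lemma continuous_on_radius_sq: "continuous_on S radius_sq"
  unfolding radius_sq_def[abs_def] by (intro continuous_intros)

lemma open_annulus: "open annulus"
  unfolding annulus_def
  by (intro open_Collect_conj open_Collect_less continuous_on_const continuous_on_radius_sq)

lemma compact_closed_annulus: "compact {x. a \<le> radius_sq x \<and> radius_sq x \<le> b}"
proof (rule compact_eq_bounded_closed[THEN iffD2], intro conjI)
  show "closed {x. a \<le> radius_sq x \<and> radius_sq x \<le> b}"
    by (intro closed_Collect_conj closed_Collect_le continuous_on_const continuous_on_radius_sq)
  have "norm x \<le> sqrt b" if "radius_sq x \<le> b" for x
    using that by (simp add: norm_vec_def L2_set_def sum_2 radius_sq_def)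
  then show "bounded {x. a \<le> radius_sq x \<and> radius_sq x \<le> b}"
    by (intro boundedI[of _ "sqrt b"]) auto
qed

lemma height_pos:
  assumes "g \<ge> 1" "1 < radius_sq x" "radius_sq x < 4" shows "height g x > 0"
  using standard_polynomial_pos[OF assms(1)] assms(2,3) by (simp add: height_def radius_sq_def)

lemma smooth_height: "smooth_map_on (height g) UNIV"
  unfolding height_def[abs_def] by (rule smooth_map_on_standard_polynomial)

text \<open>The gradient of the third coordinate of \<open>lift\<close>, by
  \<open>lift_third_has_derivative\<close>.\<close>

definition slope :: "nat \<Rightarrow> real \<Rightarrow> real^2 \<Rightarrow> real^2" where
  "slope g \<sigma> x = (\<chi> i. \<sigma> * (partial_deriv i (height g) x / (2 * sqrt (height g x))))"

lemma partial_derivI: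
  "(f has_derivative D) (at y) \<Longrightarrow> partial_deriv i f y = D (axis i 1)"
  by (simp add: partial_deriv_def frechet_derivative_eq)

lemma slope_continuous:
  assumes "\<And>x. x \<in> S \<Longrightarrow> height g x > 0"
  shows "continuous_on S (slope g \<sigma>)"
proof (rule continuous_on_vecI)
  fix i
  have "height g x \<noteq> 0" if "x \<in> S" for x using assms[OF that] by simp
  then have "continuous_on S (\<lambda>x. \<sigma> * (partial_deriv i (height g) x / (2 * sqrt (height g x))))"
    by (intro continuous_intros smooth_map_on_continuous smooth_map_on_subset[OF smooth_height]
        smooth_map_on_subset[OF smooth_map_on_partial_deriv[OF smooth_height]]) auto
  then show "continuous_on S (\<lambda>x. slope g \<sigma> x $ i)" by (simp add: slope_def)
qed

lemma lift_third_has_derivative: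
  assumes "height g x > 0"
  shows "((\<lambda>x. \<sigma> * sqrt (height g x)) has_derivative (\<lambda>v. v \<bullet> slope g \<sigma> x)) (at x)"
proof -
  have dh: "height g differentiable (at x)"
    using smooth_map_on_differentiable[OF smooth_height] by blast
  have "((\<lambda>x. \<sigma> * sqrt (height g x)) has_derivative
    (\<lambda>v. \<sigma> * (frechet_derivative (height g) (at x) v * (inverse (sqrt (height g x)) / 2)))) (at x)"
    by (intro has_derivative_mult_right has_derivative_real_sqrt assms has_frechet_derivative[OF dh])
  moreover have "\<sigma> * (frechet_derivative (height g) (at x) v * (inverse (sqrt (height g x)) / 2)) = v \<bullet> slope g \<sigma> x" for v
  proof -
    have e: "a / (2 * s) = a * (inverse s / 2)" for a s :: real
      by (simp add: inverse_eq_divide mult.commute)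
    show ?thesis
      unfolding frechet_derivative_partial[OF dh] slope_def inner_vec_def sum_2 e real_scaleR_def
        inner_real_def vec_lambda_beta by algebra
  qed
  ultimately show ?thesis by simp
qed

section \<open>The two sheets as graphs over the annulus\<close>

context handle_surface
begin

definition F_inv :: "real^3 \<Rightarrow> 'a" where
  "F_inv = (SOME G. homeomorphic_maps X (top_of_set (standard_surface g)) F G)"

lemma F_inv: "homeomorphic_maps X (top_of_set (standard_surface g)) F F_inv"
proof -
  have "\<exists>G. homeomorphic_maps X (top_of_set (standard_surface g)) F G"
    using F_homeo by (simp add: homeomorphic_map_maps)
  then show ?thesis unfolding F_inv_def by (rule someI_ex)
qed

lemma F_inv_F: "p \<in> topspace X \<Longrightarrow> F_inv (F p) = p"
  using F_inv by (simp add: homeomorphic_maps_def)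

lemma F_F_inv: "v \<in> standard_surface g \<Longrightarrow> F (F_inv v) = v"
  using F_inv by (simp add: homeomorphic_maps_def)

lemma F_inv_in: "v \<in> standard_surface g \<Longrightarrow> F_inv v \<in> topspace X"
  using F_inv unfolding homeomorphic_maps_def continuous_map_def by auto

lemma F_in: "p \<in> topspace X \<Longrightarrow> F p \<in> standard_surface g"
  using F_inv unfolding homeomorphic_maps_def continuous_map_def by auto

lemma continuous_F: "continuous_map X euclidean F"
  using F_inv unfolding homeomorphic_maps_def by (meson continuous_map_into_fulltopology)

definition sheet :: "real \<Rightarrow> 'a set" where
  "sheet \<sigma> = {p \<in> topspace X. \<sigma> * F p $ 3 > 0 \<and> planar_part (F p) \<in> annulus}"

definition annular_chart :: "real \<Rightarrow> 'a chart" where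
  "annular_chart \<sigma> = (sheet \<sigma>, \<lambda>p. planar_part (F p))"

lemma annular_chart_simps [simp]:
  "chart_dom (annular_chart \<sigma>) = sheet \<sigma>" "chart_map (annular_chart \<sigma>) p = planar_part (F p)"
  by (simp_all add: annular_chart_def)

lemma annulus_height_pos: "x \<in> annulus \<Longrightarrow> height g x > 0"
  using height_pos[OF g] by (simp add: annulus_def)

lemma F_height: "p \<in> topspace X \<Longrightarrow> (F p $ 3)\<^sup>2 = height g (planar_part (F p))"
  using F_in[of p] by (simp add: standard_surface_def height_def)

lemma lift_planar_part:
  assumes "p \<in> sheet \<sigma>" "\<sigma> = 1 \<or> \<sigma> = - 1"
  shows "lift g \<sigma> (planar_part (F p)) = F p"
proof -
  have p: "p \<in> topspace X" "\<sigma> * F p $ 3 > 0" using assms(1) by (auto simp: sheet_def)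
  have "sqrt (height g (planar_part (F p))) = \<bar>F p $ 3\<bar>"
    using F_height[OF p(1)] by (metis real_sqrt_abs)
  then have "\<sigma> * sqrt (height g (planar_part (F p))) = F p $ 3" using p(2) assms(2) by auto
  then show ?thesis by (simp add: vec_eq_iff forall_3)
qed

lemma lift_in_surface:
  assumes "x \<in> annulus" "\<sigma> = 1 \<or> \<sigma> = - 1"
  shows "lift g \<sigma> x \<in> standard_surface g"
  using annulus_height_pos[OF assms(1)] assms(2)
  by (auto simp: standard_surface_def power_mult_distrib height_def)

lemma F_inv_lift_in_sheet:
  assumes "x \<in> annulus" "\<sigma> = 1 \<or> \<sigma> = - 1"
  shows "F_inv (lift g \<sigma> x) \<in> sheet \<sigma>"
proof -
  have F: "F (F_inv (lift g \<sigma> x)) = lift g \<sigma> x" by (rule F_F_inv[OF lift_in_surface[OF assms]])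
  have "\<sigma> * F (F_inv (lift g \<sigma> x)) $ 3 = sqrt (height g x)" unfolding F using assms(2) by auto
  then have "\<sigma> * F (F_inv (lift g \<sigma> x)) $ 3 > 0" using annulus_height_pos[OF assms(1)] by simp
  then show ?thesis
    using F_inv_in[OF lift_in_surface[OF assms]] assms(1) unfolding sheet_def by (simp add: F)
qed

lemma annular_chart_range:
  assumes "\<sigma> = 1 \<or> \<sigma> = - 1" shows "chart_range (annular_chart \<sigma>) = annulus"
proof
  show "chart_range (annular_chart \<sigma>) \<subseteq> annulus"
    by (auto simp: chart_range_def sheet_def)
  show "annulus \<subseteq> chart_range (annular_chart \<sigma>)"
  proof
    fix x assume x: "x \<in> annulus"
    have "planar_part (F (F_inv (lift g \<sigma> x))) = x"
      by (simp add: F_F_inv[OF lift_in_surface[OF x assms]])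
    then show "x \<in> chart_range (annular_chart \<sigma>)"
      unfolding chart_range_def using F_inv_lift_in_sheet[OF x assms] by force
  qed
qed

lemma planar_part_continuous: "continuous_on S planar_part"
proof (rule continuous_on_vecI)
  have "continuous_on S (\<lambda>y :: real^3. y$1 - 3)" "continuous_on S (\<lambda>y :: real^3. y$2)"
    by (intro continuous_intros)+
  then show "continuous_on S (\<lambda>y. planar_part y $ i)" for i
    using exhaust_2[of i] by auto
qed

lemma lift_continuous: "continuous_on annulus (lift g \<sigma>)"
proof (rule continuous_on_vecI)
  have "continuous_on annulus (\<lambda>x :: real^2. x$1 + 3)" "continuous_on annulus (\<lambda>x :: real^2. x$2)"
    "continuous_on annulus (\<lambda>x. \<sigma> * sqrt (height g x))"
    by (intro continuous_intros smooth_map_on_continuous smooth_map_on_subset[OF smooth_height] subset_UNIV)+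
  then show "continuous_on annulus (\<lambda>y. lift g \<sigma> y $ i)" for i
    using exhaust_3[of i] by auto
qed

lemma surface_chart_annular:
  assumes \<sigma>: "\<sigma> = 1 \<or> \<sigma> = - 1" shows "surface_chart X (annular_chart \<sigma>)"
  unfolding surface_chart_def annular_chart_range[OF \<sigma>]
proof (intro conjI open_annulus)
  have "open {v. \<sigma> * v $ 3 > 0 \<and> planar_part v \<in> annulus}"
  proof -
    have "open {v :: real^3. \<sigma> * v $ 3 > 0}"
      by (intro open_Collect_less continuous_intros)
    moreover have "open (planar_part -` annulus)"
      using open_vimage[OF open_annulus planar_part_continuous] .
    moreover have "{v. \<sigma> * v $ 3 > 0 \<and> planar_part v \<in> annulus} = {v. \<sigma> * v $ 3 > 0} \<inter> planar_part -` annulus"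
      by auto
    ultimately show ?thesis by auto
  qed
  then have "openin X {p \<in> topspace X. F p \<in> {v. \<sigma> * v $ 3 > 0 \<and> planar_part v \<in> annulus}}"
    using openin_continuous_map_preimage[OF continuous_F, of "{v. \<sigma> * v $ 3 > 0 \<and> planar_part v \<in> annulus}"]
    by simp
  then show "openin X (chart_dom (annular_chart \<sigma>))" by (simp add: sheet_def)
  have sub: "topspace (subtopology X (sheet \<sigma>)) = sheet \<sigma>" by (auto simp: sheet_def)
  have "homeomorphic_maps (subtopology X (sheet \<sigma>)) (top_of_set annulus) (\<lambda>p. planar_part (F p)) (\<lambda>x. F_inv (lift g \<sigma> x))"
    unfolding homeomorphic_maps_def
  proof (intro conjI ballI)
    have "continuous_map X euclidean (\<lambda>p. planar_part (F p))"
      by (rule continuous_map_compose[OF continuous_F, of euclidean planar_part, unfolded o_def])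
        (simp add: planar_part_continuous)
    then show "continuous_map (subtopology X (sheet \<sigma>)) (top_of_set annulus) (\<lambda>p. planar_part (F p))"
      by (auto simp: continuous_map_in_subtopology continuous_map_from_subtopology sheet_def)
    have c1: "continuous_map (top_of_set annulus) (top_of_set (standard_surface g)) (lift g \<sigma>)"
      using lift_continuous lift_in_surface[OF _ \<sigma>] by (auto simp: continuous_map_in_subtopology)
    have c2: "continuous_map (top_of_set (standard_surface g)) X F_inv"
      using F_inv by (simp add: homeomorphic_maps_def)
    have "continuous_map (top_of_set annulus) X (\<lambda>x. F_inv (lift g \<sigma> x))"
      using continuous_map_compose[OF c1 c2] by (simp add: o_def)
    then show "continuous_map (top_of_set annulus) (subtopology X (sheet \<sigma>)) (\<lambda>x. F_inv (lift g \<sigma> x))"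
      using F_inv_lift_in_sheet[OF _ \<sigma>] by (auto simp: continuous_map_in_subtopology)
    show "F_inv (lift g \<sigma> (planar_part (F p))) = p" if "p \<in> topspace (subtopology X (sheet \<sigma>))" for p
      using that lift_planar_part[OF _ \<sigma>, of p] F_inv_F[of p] unfolding sub by (simp add: sheet_def)
    show "planar_part (F (F_inv (lift g \<sigma> x))) = x" if "x \<in> topspace (top_of_set annulus)" for x
      using that F_F_inv[OF lift_in_surface[OF _ \<sigma>]] by simp
  qed
  then have "homeomorphic_map (subtopology X (sheet \<sigma>)) (top_of_set annulus) (\<lambda>p. planar_part (F p))"
    unfolding homeomorphic_map_maps by blast
  then show "homeomorphic_map (subtopology X (chart_dom (annular_chart \<sigma>))) (top_of_set annulus) (chart_map (annular_chart \<sigma>))"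
    by (simp add: annular_chart_def)
qed

lemma annular_chart_inv:
  assumes "\<sigma> = 1 \<or> \<sigma> = - 1" "x \<in> annulus"
  shows "chart_inv (annular_chart \<sigma>) x = F_inv (lift g \<sigma> x)"
proof -
  have "chart_inv (annular_chart \<sigma>) (planar_part (F (F_inv (lift g \<sigma> x)))) = F_inv (lift g \<sigma> x)"
    using chart_inv_map[OF surface_chart_annular[OF assms(1)], of "F_inv (lift g \<sigma> x)"]
      F_inv_lift_in_sheet[OF assms(2,1)] by simp
  then show ?thesis by (simp add: F_F_inv[OF lift_in_surface[OF assms(2,1)]])
qed

lemma F_annular_chart_inv:
  assumes "\<sigma> = 1 \<or> \<sigma> = - 1" "x \<in> annulus"
  shows "F (chart_inv (annular_chart \<sigma>) x) = lift g \<sigma> x"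
  by (simp add: annular_chart_inv[OF assms] F_F_inv[OF lift_in_surface[OF assms(2,1)]])

lemma annular_has_derivative:
  assumes \<sigma>: "\<sigma> = 1 \<or> \<sigma> = - 1" and x: "x \<in> annulus"
  shows "((\<lambda>p. F p $ 1) \<circ> chart_inv (annular_chart \<sigma>) has_derivative (\<lambda>v. v $ 1)) (at x)"
    and "((\<lambda>p. F p $ 2) \<circ> chart_inv (annular_chart \<sigma>) has_derivative (\<lambda>v. v $ 2)) (at x)"
    and "((\<lambda>p. F p $ 3) \<circ> chart_inv (annular_chart \<sigma>) has_derivative (\<lambda>v. v \<bullet> slope g \<sigma> x)) (at x)"
    and "(radius \<circ> chart_inv (annular_chart \<sigma>) has_derivative (\<lambda>v. v \<bullet> (2 *\<^sub>R x))) (at x)"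
proof -
  have n: "((\<lambda>x :: real^2. x$i) has_derivative (\<lambda>v. v$i)) (at x)" for i
    by (rule bounded_linear_imp_has_derivative[OF bounded_linear_vec_nth])
  have tr: "(f \<circ> chart_inv (annular_chart \<sigma>) has_derivative D) (at x)"
    if "(k has_derivative D) (at x)" "\<And>y. y \<in> annulus \<Longrightarrow> k y = f (chart_inv (annular_chart \<sigma>) y)"
    for f :: "'a \<Rightarrow> real" and k D
    using has_derivative_transform_within_open[OF that(1) open_annulus x] that(2) by (simp add: o_def)
  show "((\<lambda>p. F p $ 1) \<circ> chart_inv (annular_chart \<sigma>) has_derivative (\<lambda>v. v $ 1)) (at x)"
    by (rule tr[of "\<lambda>x. x$1 + 3"]) (use has_derivative_add_const[OF n] in \<open>auto simp: F_annular_chart_inv[OF \<sigma>]\<close>)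
  show "((\<lambda>p. F p $ 2) \<circ> chart_inv (annular_chart \<sigma>) has_derivative (\<lambda>v. v $ 2)) (at x)"
    by (rule tr[of "\<lambda>x. x$2"]) (use n in \<open>auto simp: F_annular_chart_inv[OF \<sigma>]\<close>)
  show "((\<lambda>p. F p $ 3) \<circ> chart_inv (annular_chart \<sigma>) has_derivative (\<lambda>v. v \<bullet> slope g \<sigma> x)) (at x)"
    by (rule tr[OF lift_third_has_derivative[OF annulus_height_pos[OF x]]]) (simp add: F_annular_chart_inv[OF \<sigma>])
  have "(radius_sq has_derivative (\<lambda>v. v \<bullet> (2 *\<^sub>R x))) (at x)"
  proof -
    have "((\<lambda>x :: real^2. x$1 * x$1 + x$2 * x$2) has_derivative (\<lambda>v. (x$1 * v$1 + v$1 * x$1) + (x$2 * v$2 + v$2 * x$2))) (at x)"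
      by (intro has_derivative_add has_derivative_mult n)
    then show ?thesis
      by (simp add: radius_sq_def[abs_def] power2_eq_square inner_vec_def sum_2 algebra_simps)
  qed
  then show "(radius \<circ> chart_inv (annular_chart \<sigma>) has_derivative (\<lambda>v. v \<bullet> (2 *\<^sub>R x))) (at x)"
    by (rule tr) (simp add: radius_def F_annular_chart_inv[OF \<sigma>])
qed

lemma annular_differentials:
  assumes \<sigma>: "\<sigma> = 1 \<or> \<sigma> = - 1" and p: "p \<in> sheet \<sigma>"
  shows "surface_differential (\<lambda>p. F p $ 1) (annular_chart \<sigma>) p = axis 1 1"
    and "surface_differential (\<lambda>p. F p $ 2) (annular_chart \<sigma>) p = axis 2 1"
    and "surface_differential (\<lambda>p. F p $ 3) (annular_chart \<sigma>) p = slope g \<sigma> (planar_part (F p))"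
    and "surface_differential radius (annular_chart \<sigma>) p = 2 *\<^sub>R planar_part (F p)"
proof -
  have x: "planar_part (F p) \<in> annulus" using p by (simp add: sheet_def)
  note D = annular_has_derivative[OF \<sigma> x, THEN partial_derivI]
  show "surface_differential (\<lambda>p. F p $ 1) (annular_chart \<sigma>) p = axis 1 1"
    "surface_differential (\<lambda>p. F p $ 2) (annular_chart \<sigma>) p = axis 2 1"
    by (simp_all add: surface_differential_def D vec_eq_iff axis_def)
  show "surface_differential (\<lambda>p. F p $ 3) (annular_chart \<sigma>) p = slope g \<sigma> (planar_part (F p))"
    by (simp add: surface_differential_def D vec_eq_iff inner_axis' )
  show "surface_differential radius (annular_chart \<sigma>) p = 2 *\<^sub>R planar_part (F p)"
    by (simp add: surface_differential_def D vec_eq_iff inner_axis')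
qed

lemma annular_F_has_derivative:
  assumes \<sigma>: "\<sigma> = 1 \<or> \<sigma> = - 1" and x: "x \<in> annulus"
  shows "(F \<circ> chart_inv (annular_chart \<sigma>) has_derivative
    (\<lambda>v. vector [v$1, v$2, v \<bullet> slope g \<sigma> x])) (at x)"
proof -
  have "((\<lambda>y. (F \<circ> chart_inv (annular_chart \<sigma>)) y $ i) has_derivative
     (\<lambda>v. (vector [v$1, v$2, v \<bullet> slope g \<sigma> x] :: real^3) $ i)) (at x)" for i
  proof -
    note D = annular_has_derivative(1-3)[OF \<sigma> x, unfolded o_def]
    consider "i = 1" | "i = 2" | "i = 3" using exhaust_3[of i] by blast
    then show ?thesis
    proof cases
      case 1 show ?thesis unfolding 1 o_def vector_3 by (rule D(1))
    next
      case 2 show ?thesis unfolding 2 o_def vector_3 by (rule D(2))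
    next
      case 3 show ?thesis unfolding 3 o_def vector_3 by (rule D(3))
    qed
  qed
  then show ?thesis
    by (subst has_derivative_componentwise_within) (auto simp: Basis_vec_def inner_axis)
qed

lemma annular_F_injective:
  assumes \<sigma>: "\<sigma> = 1 \<or> \<sigma> = - 1" and x: "x \<in> annulus"
  shows "inj (frechet_derivative (F \<circ> chart_inv (annular_chart \<sigma>)) (at x))"
  unfolding frechet_derivative_eq[OF annular_F_has_derivative[OF assms]]
proof (rule injI)
  fix v w :: "real^2"
  assume eq: "vector [v$1, v$2, v \<bullet> slope g \<sigma> x] = (vector [w$1, w$2, w \<bullet> slope g \<sigma> x] :: real^3)"
  have "v$1 = w$1" using arg_cong[OF eq, of "\<lambda>z. z$1"] by simp
  moreover have "v$2 = w$2" using arg_cong[OF eq, of "\<lambda>z. z$2"] by simp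
  ultimately show "v = w" by (simp add: vec_eq_iff forall_2)
qed

text \<open>Into the annular chart the coordinate change is the planar part of \<open>F\<close>,
  hence differentiable. Its Jacobian is invertible because \<open>F\<close> is an immersion, which
  gives the derivative of the inverse.\<close>

lemma annular_compatible:
  assumes \<sigma>: "\<sigma> = 1 \<or> \<sigma> = - 1"
  shows "compatible_chart X \<A> (annular_chart \<sigma>)"
  unfolding compatible_chart_def
proof (intro conjI ballI)
  let ?d = "annular_chart \<sigma>"
  show sd: "surface_chart X ?d" by (rule surface_chart_annular[OF \<sigma>])
  fix c p assume c: "c \<in> \<A>" and p: "p \<in> chart_dom c \<inter> chart_dom ?d"
  have sc: "surface_chart X c" by (rule smooth_atlas_chart[OF atlas c])
  have pc: "p \<in> chart_dom c" and pd: "p \<in> sheet \<sigma>" using p by auto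
  have x: "planar_part (F p) \<in> annulus" using pd by (simp add: sheet_def)
  have diff: "transition c ?d differentiable (at (chart_map c q))" if "q \<in> chart_dom c" for q
  proof -
    have dF: "(F \<circ> chart_inv c has_derivative frechet_derivative (F \<circ> chart_inv c) (at (chart_map c q))) (at (chart_map c q))"
      by (intro has_frechet_derivative smooth_function_differentiable[OF atlas F_smooth atlas_compatible[OF atlas c] that])
    have n: "((\<lambda>y. (F \<circ> chart_inv c) y $ m) has_derivative (\<lambda>v. frechet_derivative (F \<circ> chart_inv c) (at (chart_map c q)) v $ m)) (at (chart_map c q))" for m
      by (rule bounded_linear.has_derivative[OF bounded_linear_vec_nth dF])
    have "((\<lambda>y. transition c ?d y $ i) has_derivative (\<lambda>v. frechet_derivative (F \<circ> chart_inv c) (at (chart_map c q)) v $ (if i = 1 then 1 else 2))) (at (chart_map c q))" for i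
      using exhaust_2[of i] has_derivative_diff[OF n[of 1] has_derivative_const[of 3]] n[of 2]
      by (auto simp: transition_def o_def)
    then have "(transition c ?d has_derivative (\<lambda>v. \<chi> i. frechet_derivative (F \<circ> chart_inv c) (at (chart_map c q)) v $ (if i = 1 then 1 else 2))) (at (chart_map c q))"
      by (subst has_derivative_componentwise_within) (auto simp: Basis_vec_def inner_axis)
    then show ?thesis by (rule differentiableI)
  qed
  show t: "transition c ?d differentiable (at (chart_map c p))" by (rule diff[OF pc])
  let ?J = "transition_jacobian c ?d p"
  have J: "(transition c ?d has_derivative (*v) ?J) (at (chart_map c p))"
    using has_derivative_jacobian[OF t] by (simp add: transition_jacobian_def)
  have dFd: "(F \<circ> chart_inv ?d) differentiable (at (chart_map ?d p))"
    using annular_F_has_derivative[OF \<sigma> x] by (auto intro: differentiableI)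
  \<comment> \<open>By the chain rule the derivative of \<open>F\<close> in \<open>c\<close> factors
    through \<open>?J\<close>; as the composite is injective, so is the factor applied
    first.\<close>
  have "frechet_derivative (F \<circ> chart_inv c) (at (chart_map c p)) =
      (\<lambda>v. frechet_derivative (F \<circ> chart_inv ?d) (at (chart_map ?d p)) (?J *v v))"
    by (rule frechet_derivative_eq[OF change_of_chart_has_derivative[OF sc sd p t dFd]])
  then have "inj (\<lambda>v. frechet_derivative (F \<circ> chart_inv ?d) (at (chart_map ?d p)) (?J *v v))"
    using F_immersion[OF c chart_map_in_range[OF pc]] by simp
  then have "inj ((*v) ?J)" by (auto simp: inj_def)
  then have "det ?J \<noteq> 0"
    using det_nz_iff_inj[of "(*v) ?J"] by (simp add: matrix_vector_mul_linear)
  then have "invertible ?J" by (simp add: invertible_det_nz)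
  then obtain B where B: "?J ** B = mat 1" by (auto simp: invertible_def)
  let ?S = "chart_map c ` (chart_dom c \<inter> sheet \<sigma>)"
  have oS: "open ?S"
    using open_chart_image[OF sc, of "sheet \<sigma>"] sd by (simp add: surface_chart_def)
  have "(transition ?d c has_derivative (*v) B) (at (transition c ?d (chart_map c p)))"
  proof (rule has_derivative_inverse_strong[OF oS _ _ _ J])
    show "chart_map c p \<in> ?S" using pc pd by blast
    show "continuous_on ?S (transition c ?d)"
      using diff by (auto intro!: continuous_at_imp_continuous_on differentiable_imp_continuous_within)
    show "transition ?d c (transition c ?d y) = y" if y: "y \<in> ?S" for y
    proof -
      obtain q where "q \<in> chart_dom c" "q \<in> sheet \<sigma>" "y = chart_map c q" using y by blast
      then show ?thesis
        using transition_map[OF sc, of q ?d] transition_map[OF sd, of q c] by simp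
    qed
    show "(*v) ?J \<circ> (*v) B = id"
      by (simp add: fun_eq_iff matrix_vector_mul_assoc B)
  qed
  then show "transition ?d c differentiable (at (chart_map ?d p))"
    using transition_map[OF sc pc, of ?d] by (auto intro: differentiableI)
qed

end

section \<open>Mass bounds\<close>

text \<open>Compatibility promises only differentiable coordinate changes, but transport along
  circles integrates derivatives. Their continuity is recovered from an atlas chart by solving the
  transformation law.\<close>

lemma compatible_partial_deriv_continuous:
  assumes atlas: "smooth_atlas X \<A>" and u: "smooth_function \<A> u" and d: "compatible_chart X \<A> d"
    and J: "\<And>c i j. c \<in> \<A> \<Longrightarrow> continuous_on (chart_map c ` (chart_dom c \<inter> chart_dom d))
      (\<lambda>y. jacobian (transition c d) (at y) $ i $ j)"
    and nz: "\<And>c p. c \<in> \<A> \<Longrightarrow> p \<in> chart_dom c \<inter> chart_dom d \<Longrightarrow> det (transition_jacobian c d p) \<noteq> 0"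
  shows "continuous_on (chart_range d) (partial_deriv k (u \<circ> chart_inv d))"
proof -
  have sd: "surface_chart X d" by (rule compatible_surface_chart[OF d])
  have "isCont (partial_deriv k (u \<circ> chart_inv d)) y" if y: "y \<in> chart_range d" for y
  proof -
    let ?p = "chart_inv d y"
    have pd: "?p \<in> chart_dom d" by (rule chart_inv_in_dom[OF y])
    have "?p \<in> (\<Union>c\<in>\<A>. chart_dom c)"
      using atlas pd chart_dom_subset[OF sd] by (auto simp: smooth_atlas_def)
    then obtain c where c: "c \<in> \<A>" "?p \<in> chart_dom c" by blast
    have sc: "surface_chart X c" by (rule smooth_atlas_chart[OF atlas c(1)])
    let ?M = "chart_map c ` (chart_dom c \<inter> chart_dom d)"
    let ?N = "chart_map d ` (chart_dom d \<inter> chart_dom c)"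
    let ?J = "\<lambda>z. jacobian (transition c d) (at z)"
    let ?w = "\<lambda>i. partial_deriv i (u \<circ> chart_inv c)"
    \<comment> \<open>Cramer's rule for the transposed Jacobian.\<close>
    let ?G = "\<lambda>z. if k = 1 then (?J z $ 2 $ 2 *\<^sub>R ?w 1 z - ?J z $ 2 $ 1 *\<^sub>R ?w 2 z) /\<^sub>R det (?J z)
       else (?J z $ 1 $ 1 *\<^sub>R ?w 2 z - ?J z $ 1 $ 2 *\<^sub>R ?w 1 z) /\<^sub>R det (?J z)"
    have oN: "open ?N" using open_chart_image[OF sd] sc by (simp add: surface_chart_def)
    have Mr: "?M \<subseteq> chart_range c" by (auto simp: chart_range_def)
    have su: "smooth_map_on (u \<circ> chart_inv c) (chart_range c)" using u c by (simp add: smooth_function_def)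
    have dJ: "det (?J z) \<noteq> 0" if z: "z \<in> ?M" for z
    proof -
      obtain q where "q \<in> chart_dom c \<inter> chart_dom d" "z = chart_map c q" using z by blast
      then show ?thesis using nz[OF c(1), of q] by (simp add: transition_jacobian_def)
    qed
    have cw: "continuous_on ?M (?w i)" for i
      by (rule continuous_on_subset[OF smooth_map_on_continuous[OF smooth_map_on_partial_deriv[OF su]] Mr])
    have cJ: "continuous_on ?M ?J" by (intro continuous_on_vecI J c)
    have "continuous_on ?M ?G"
      using cJ cw dJ by (cases "k = 1") (auto intro!: continuous_intros continuous_on_det_2)
    moreover have "continuous_on ?N (transition d c)"
    proof (intro continuous_at_imp_continuous_on ballI)
      fix z assume "z \<in> ?N"
      then obtain q where q: "q \<in> chart_dom d" "q \<in> chart_dom c" "z = chart_map d q" by blast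
      show "isCont (transition d c) z"
        unfolding q(3) by (rule differentiable_imp_continuous_within[OF compatible_transition(2)[OF d c(1) q(2,1)]])
    qed
    moreover have tN: "transition d c ` ?N \<subseteq> ?M"
    proof
      fix z assume "z \<in> transition d c ` ?N"
      then obtain q where q: "q \<in> chart_dom d" "q \<in> chart_dom c" "z = transition d c (chart_map d q)" by blast
      then have "z = chart_map c q" using transition_map[OF sd q(1), of c] by simp
      then show "z \<in> ?M" using q by blast
    qed
    ultimately have "continuous_on ?N (\<lambda>z. ?G (transition d c z))"
      by (rule continuous_on_compose2)
    moreover have "?G (transition d c z) = partial_deriv k (u \<circ> chart_inv d) z" if zN: "z \<in> ?N" for z
    proof -
      obtain q where q: "q \<in> chart_dom d" "q \<in> chart_dom c" "z = chart_map d q" using zN by blast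
      have t: "transition d c z = chart_map c q" using transition_map[OF sd q(1), of c] q(3) by simp
      have qi: "q \<in> chart_dom c \<inter> chart_dom d" using q by blast
      let ?K = "transition_jacobian c d q"
      let ?a = "partial_deriv 1 (u \<circ> chart_inv d) z" and ?b = "partial_deriv 2 (u \<circ> chart_inv d) z"
      have w: "?w i (chart_map c q) = ?K $ 1 $ i *\<^sub>R ?a + ?K $ 2 $ i *\<^sub>R ?b" for i
        using change_of_chart_partial_deriv[OF sc sd qi compatible_transition(1)[OF d c(1) q(2,1)]
            smooth_function_differentiable[OF atlas u d q(1)], of i] by (simp add: sum_2 q(3))
      have K: "?J (chart_map c q) = ?K" by (simp add: transition_jacobian_def)
      have nz': "det ?K \<noteq> 0" by (rule nz[OF c(1) qi])
      have 1: "?K $ 2 $ 2 *\<^sub>R ?w 1 (chart_map c q) - ?K $ 2 $ 1 *\<^sub>R ?w 2 (chart_map c q) = det ?K *\<^sub>R ?a"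
        unfolding w det_2 by (simp add: algebra_simps)
      have 2: "?K $ 1 $ 1 *\<^sub>R ?w 2 (chart_map c q) - ?K $ 1 $ 2 *\<^sub>R ?w 1 (chart_map c q) = det ?K *\<^sub>R ?b"
        unfolding w det_2 by (simp add: algebra_simps)
      show ?thesis
        unfolding t K 1 2 using nz' exhaust_2[of k] by auto
    qed
    ultimately have "continuous_on ?N (partial_deriv k (u \<circ> chart_inv d))"
      by (rule continuous_on_eq)
    moreover have "y \<in> ?N"
      using pd c(2) chart_map_inv[OF y] by (metis IntI imageI)
    ultimately show ?thesis using continuous_on_eq_continuous_at[OF oN] by blast
  qed
  then show ?thesis by (simp add: continuous_at_imp_continuous_on)
qed

section \<open>The metrics and the field in annular coordinates\<close>

context handle_surface
begin

sublocale str: magnetic_surface X \<A> "stretched n" field for n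
  by unfold_locales (rule smooth compact stretched_metric field_smooth_one_form)+

abbreviation vol :: "nat \<Rightarrow> 'a measure" where
  "vol n \<equiv> riemannian_measure X \<A> (stretched n)"

abbreviation mass :: "nat \<Rightarrow> ('a \<Rightarrow> complex) \<Rightarrow> 'a set \<Rightarrow> ennreal" where
  "mass n u U \<equiv> \<integral>\<^sup>+ p. ennreal ((cmod (u p))\<^sup>2) * indicator U p \<partial>vol n"

abbreviation energy_density :: "nat \<Rightarrow> ('a \<Rightarrow> complex) \<Rightarrow> 'a \<Rightarrow> real" where
  "energy_density n u \<equiv> magnetic_energy_density \<A> (stretched n) field u"

text \<open>The metric of a graph plus the stretching; the factor 4 arises because the differential
  of \<open>radius\<close> is twice the position vector.\<close>

lemma gram_annular:
  assumes \<sigma>: "\<sigma> = 1 \<or> \<sigma> = - 1" and p: "p \<in> sheet \<sigma>"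
  defines "x \<equiv> planar_part (F p)"
  defines "\<eta> \<equiv> slope g \<sigma> x"
  shows "gram e (annular_chart \<sigma>) p $ i $ j = axis 1 1 $ i * axis 1 1 $ j + axis 2 1 $ i * axis 2 1 $ j +
    \<eta> $ i * \<eta> $ j + 4 * e * (x $ i * x $ j)"
  using annular_differentials[OF \<sigma> p] by (simp add: gram_def sum_3 x_def \<eta>_def)

lemma annular_metric_components:
  assumes \<sigma>: "\<sigma> = 1 \<or> \<sigma> = - 1"
  shows "metric_components \<A> (stretched n) (annular_chart \<sigma>)"
  unfolding metric_components_def annular_chart_range[OF \<sigma>]
proof (intro conjI ballI)
  let ?d = "annular_chart \<sigma>"
  have dF: "(F \<circ> chart_inv ?d) differentiable (at (chart_map ?d p))"
    "(radius \<circ> chart_inv ?d) differentiable (at (chart_map ?d p))" if "p \<in> sheet \<sigma>" for p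
    using smooth_function_differentiable[OF atlas F_smooth annular_compatible[OF \<sigma>], of p]
      smooth_function_differentiable[OF atlas smooth_radius annular_compatible[OF \<sigma>], of p] that by simp_all
  have cs: "continuous_on annulus (slope g \<sigma>)" by (rule slope_continuous[OF annulus_height_pos])
  show "continuous_on annulus (stretched n ?d \<circ> chart_inv ?d)"
  proof (intro continuous_on_vecI)
    fix i j
    have "continuous_on annulus (\<lambda>x. axis 1 1 $ i * axis 1 1 $ j + axis 2 1 $ i * axis 2 1 $ j +
      slope g \<sigma> x $ i * slope g \<sigma> x $ j + 4 * exp (real n * ((radius_sq x - 2) * (3 - radius_sq x))) * (x $ i * x $ j))"
      by (intro continuous_intros cs continuous_on_radius_sq)
    moreover have "axis 1 1 $ i * axis 1 1 $ j + axis 2 1 $ i * axis 2 1 $ j +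
      slope g \<sigma> x $ i * slope g \<sigma> x $ j + 4 * exp (real n * ((radius_sq x - 2) * (3 - radius_sq x))) * (x $ i * x $ j) =
      (stretched n ?d \<circ> chart_inv ?d) x $ i $ j" if x: "x \<in> annulus" for x
    proof -
      have s: "chart_inv ?d x \<in> sheet \<sigma>"
        using chart_inv_in_dom[of x ?d] x by (simp add: annular_chart_range[OF \<sigma>])
      show ?thesis
        unfolding o_def stretched_def gram_annular[OF \<sigma> s] F_annular_chart_inv[OF \<sigma> x] planar_part_lift radius_def bump_def ..
    qed
    ultimately show "continuous_on annulus (\<lambda>y. (stretched n ?d \<circ> chart_inv ?d) y $ i $ j)"
      by (rule continuous_on_eq)
  qed
  show "positive_form (stretched n ?d p)" if "p \<in> chart_dom ?d" for p
  proof -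
    have p: "p \<in> sheet \<sigma>" using that by simp
    have "planar_part (F p) \<in> annulus" using p by (simp add: sheet_def)
    from annular_F_injective[OF \<sigma> this] show ?thesis
      unfolding stretched_def
      by (intro gram_positive dF(1)[OF p] less_imp_le[OF bump_pos]) simp
  qed
  show "stretched n c p = transpose (transition_jacobian c ?d p) ** stretched n ?d p ** transition_jacobian c ?d p"
    if c: "c \<in> \<A>" and p: "p \<in> chart_dom c \<inter> chart_dom ?d" for c p
  proof -
    have pp: "p \<in> chart_dom c" "p \<in> chart_dom ?d" "p \<in> sheet \<sigma>" using p by auto
    show ?thesis
      by (rule stretched_change[OF smooth_atlas_chart[OF atlas c] surface_chart_annular[OF \<sigma>] p
            compatible_transition(1)[OF annular_compatible[OF \<sigma>] c pp(1,2)] dF[OF pp(3)]])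
  qed
qed

lemma annular_one_form_components:
  assumes \<sigma>: "\<sigma> = 1 \<or> \<sigma> = - 1"
  shows "one_form_components \<A> field (annular_chart \<sigma>)"
  unfolding one_form_components_def
proof (intro ballI)
  let ?d = "annular_chart \<sigma>"
  fix c p assume c: "c \<in> \<A>" and p: "p \<in> chart_dom c \<inter> chart_dom ?d"
  have pp: "p \<in> chart_dom c" "p \<in> chart_dom ?d" using p by auto
  show "field c p = transpose (transition_jacobian c ?d p) *v field ?d p"
    by (rule field_change[OF smooth_atlas_chart[OF atlas c] surface_chart_annular[OF \<sigma>] p
          compatible_transition(1)[OF annular_compatible[OF \<sigma>] c pp]
          smooth_function_differentiable[OF atlas F_smooth annular_compatible[OF \<sigma>] pp(2)]])
qed

text \<open>The Jacobian entries are partial derivatives of coordinates of \<open>F\<close>, hence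
  continuous. The determinant is nonzero because its square is a factor of the positive Gram
  determinant in \<open>c\<close>.\<close>

lemma annular_partial_deriv_continuous:
  assumes \<sigma>: "\<sigma> = 1 \<or> \<sigma> = - 1" and u: "smooth_function \<A> u"
  shows "continuous_on annulus (partial_deriv k (u \<circ> chart_inv (annular_chart \<sigma>)))"
  unfolding annular_chart_range[OF \<sigma>, symmetric]
proof (rule compatible_partial_deriv_continuous[OF atlas u annular_compatible[OF \<sigma>]])
  let ?d = "annular_chart \<sigma>"
  show "det (transition_jacobian c ?d p) \<noteq> 0" if c: "c \<in> \<A>" and p: "p \<in> chart_dom c \<inter> chart_dom ?d" for c p
  proof -
    have pc: "p \<in> chart_dom c" using p by blast
    have "det (stretched 0 c p) > 0"
      by (rule positive_form_det[OF metric_components_positive[OF riemannian_metric_components[OF stretched_metric c] pc]])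
    then show ?thesis unfolding metric_components_det[OF annular_metric_components[OF \<sigma>] c p] by auto
  qed
  fix c i j assume c: "c \<in> \<A>"
  let ?M = "chart_map c ` (chart_dom c \<inter> chart_dom ?d)"
  have M: "?M \<subseteq> chart_range c" by (auto simp: chart_range_def)
  have comp: "(\<lambda>y. transition c ?d y $ i) = (\<lambda>y. F (chart_inv c y) $ (if i = 1 then 1 else 2) - (if i = 1 then 3 else 0))"
    using exhaust_2[of i] by (auto simp: transition_def)
  have sm: "smooth_map_on (\<lambda>y. transition c ?d y $ i) (chart_range c)"
    unfolding comp by (intro smooth_map_on_diff smooth_map_on_const smooth_F_local open_range c)
  have "jacobian (transition c ?d) (at y) $ i $ j = partial_deriv j (\<lambda>y. transition c ?d y $ i) y" if y: "y \<in> ?M" for y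
  proof -
    obtain q where q: "q \<in> chart_dom c" "q \<in> chart_dom ?d" "y = chart_map c q" using y by blast
    have t: "transition c ?d differentiable (at y)"
      unfolding q(3) by (rule compatible_transition(1)[OF annular_compatible[OF \<sigma>] c q(1,2)])
    have "((\<lambda>y. transition c ?d y $ i) has_derivative (\<lambda>v. (jacobian (transition c ?d) (at y) *v v) $ i)) (at y)"
      by (rule bounded_linear.has_derivative[OF bounded_linear_vec_nth has_derivative_jacobian[OF t]])
    from partial_derivI[OF this, of j] show ?thesis
      by (simp add: matrix_vector_mult_basis column_def)
  qed
  moreover have "continuous_on ?M (partial_deriv j (\<lambda>y. transition c ?d y $ i))"
    by (rule continuous_on_subset[OF smooth_map_on_continuous[OF smooth_map_on_partial_deriv[OF sm]] M])
  ultimately show "continuous_on ?M (\<lambda>y. jacobian (transition c ?d) (at y) $ i $ j)"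
    by (metis (no_types, lifting) continuous_on_eq)
qed

text \<open>The position vector is orthogonal to the angular field, so the stretching drops out of
  the length of that field: the circles look the same for all \<open>n\<close>. The determinant is
  affine in the stretching factor.\<close>

lemma annular_det:
  assumes \<sigma>: "\<sigma> = 1 \<or> \<sigma> = - 1" and x: "x \<in> annulus"
  defines "\<eta> \<equiv> slope g \<sigma> x"
  shows "det (stretched n (annular_chart \<sigma>) (chart_inv (annular_chart \<sigma>) x)) =
    1 + (\<eta>$1)\<^sup>2 + (\<eta>$2)\<^sup>2 + 4 * bump n (radius_sq x) * (radius_sq x + (\<eta> \<bullet> angular_field x)\<^sup>2)"
    and "angular_field x \<bullet> (stretched n (annular_chart \<sigma>) (chart_inv (annular_chart \<sigma>) x) *v angular_field x) =
      radius_sq x + (\<eta> \<bullet> angular_field x)\<^sup>2"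
proof -
  let ?d = "annular_chart \<sigma>"
  have s: "chart_inv ?d x \<in> sheet \<sigma>"
    using chart_inv_in_dom[of x ?d] x by (simp add: annular_chart_range[OF \<sigma>])
  let ?e = "bump n (radius_sq x)"
  have H: "stretched n ?d (chart_inv ?d x) $ i $ j = axis 1 1 $ i * axis 1 1 $ j + axis 2 1 $ i * axis 2 1 $ j +
    \<eta> $ i * \<eta> $ j + 4 * ?e * (x $ i * x $ j)" for i j
    unfolding stretched_def gram_annular[OF \<sigma> s] F_annular_chart_inv[OF \<sigma> x] planar_part_lift radius_def \<eta>_def ..
  have \<eta>T: "\<eta> \<bullet> angular_field x = \<eta>$2 * x$1 - \<eta>$1 * x$2"
    by (simp add: inner_vec_def sum_2)
  define a b u v where "a = \<eta>$1" and "b = \<eta>$2" and "u = x$1" and "v = x$2"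
  have ax: "axis 1 1 $ (1::2) = (1::real)" "axis 1 1 $ (2::2) = (0::real)" "axis 2 1 $ (1::2) = (0::real)" "axis 2 1 $ (2::2) = (1::real)"
    by (simp_all add: axis_def)
  show "det (stretched n ?d (chart_inv ?d x)) =
    1 + (\<eta>$1)\<^sup>2 + (\<eta>$2)\<^sup>2 + 4 * ?e * (radius_sq x + (\<eta> \<bullet> angular_field x)\<^sup>2)"
    unfolding det_2 H \<eta>T radius_sq_def ax a_def[symmetric] b_def[symmetric] u_def[symmetric] v_def[symmetric]
    by algebra
  show "angular_field x \<bullet> (stretched n ?d (chart_inv ?d x) *v angular_field x) = radius_sq x + (\<eta> \<bullet> angular_field x)\<^sup>2"
    unfolding quadratic_form_2 H \<eta>T radius_sq_def ax angular_field_nth a_def[symmetric] b_def[symmetric] u_def[symmetric] v_def[symmetric]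
    by algebra
qed

text \<open>The differential of the polar angle is 1 on the angular field; half of it is the
  potential in \<open>circle_transport_bound\<close>.\<close>

lemma annular_field:
  assumes \<sigma>: "\<sigma> = 1 \<or> \<sigma> = - 1" and x: "x \<in> annulus"
  shows "angular_field x \<bullet> field (annular_chart \<sigma>) (chart_inv (annular_chart \<sigma>) x) = 1/2"
proof -
  let ?d = "annular_chart \<sigma>"
  have s: "chart_inv ?d x \<in> sheet \<sigma>"
    using chart_inv_in_dom[of x ?d] x by (simp add: annular_chart_range[OF \<sigma>])
  have "radius_sq x \<noteq> 0" using x by (auto simp: annulus_def)
  moreover have "angular_field x \<bullet> field ?d (chart_inv ?d x) = 1/2 * inverse (radius_sq x) * radius_sq x"
    using annular_differentials(1,2)[OF \<sigma> s]
    by (simp add: field_def inner_vec_def sum_2 F_annular_chart_inv[OF \<sigma> x] radius_def axis_def radius_sq_def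
        power2_eq_square algebra_simps)
  ultimately show ?thesis by simp
qed

text \<open>The closed ring is compact and still lies where the height is positive.\<close>

lemma slope_bound:
  obtains B where "B \<ge> 0" "\<And>x. x \<in> annulus \<Longrightarrow> (slope g \<sigma> x $ 1)\<^sup>2 + (slope g \<sigma> x $ 2)\<^sup>2 \<le> B"
proof -
  let ?K = "{x. 3/2 \<le> radius_sq x \<and> radius_sq x \<le> 7/2}"
  have "continuous_on ?K (slope g \<sigma>)" by (rule slope_continuous, rule height_pos[OF g]) auto
  then have "continuous_on ?K (\<lambda>x. (slope g \<sigma> x $ 1)\<^sup>2 + (slope g \<sigma> x $ 2)\<^sup>2)" by (intro continuous_intros)
  then have "bounded ((\<lambda>x. (slope g \<sigma> x $ 1)\<^sup>2 + (slope g \<sigma> x $ 2)\<^sup>2) ` ?K)"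
    by (intro compact_imp_bounded compact_continuous_image compact_closed_annulus)
  then obtain B where B: "\<And>x. x \<in> ?K \<Longrightarrow> \<bar>(slope g \<sigma> x $ 1)\<^sup>2 + (slope g \<sigma> x $ 2)\<^sup>2\<bar> \<le> B"
    unfolding bounded_iff real_norm_def by blast
  have "(slope g \<sigma> x $ 1)\<^sup>2 + (slope g \<sigma> x $ 2)\<^sup>2 \<le> max B 0" if "x \<in> annulus" for x
    using B[of x] that by (force simp: annulus_def)
  then show ?thesis by (intro that[of "max B 0"]) auto
qed

end

lemma continuous_on_ennreal_indicator_measurable:
  fixes q :: "'b::topological_space \<Rightarrow> real"
  assumes "S \<in> sets borel" "continuous_on S q"
  shows "(\<lambda>y. ennreal (q y) * indicator S y) \<in> borel_measurable borel"
proof -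
  have eq: "(\<lambda>y. ennreal (q y) * indicator S y) = (\<lambda>y. ennreal (indicator S y *\<^sub>R q y))"
    by (auto simp: fun_eq_iff indicator_def)
  show ?thesis
    unfolding eq by (rule measurable_compose[OF borel_measurable_continuous_on_indicator[OF assms] measurable_ennreal])
qed

context compact_riemannian_surface
begin

lemma chart_integrand_measurable:
  fixes q :: "'a \<Rightarrow> real"
  assumes d: "compatible_chart X \<A> d" and hd: "metric_components \<A> h d"
    and q: "continuous_map X euclidean q"
  shows "(\<lambda>y. ennreal (q (chart_inv d y)) * ennreal (sqrt (det (h d (chart_inv d y)))) *
    indicator (chart_range d) y) \<in> borel_measurable lborel"
proof -
  have sd: "surface_chart X d" by (rule compatible_surface_chart[OF d])
  have "continuous_map (top_of_set (chart_range d)) euclidean (q \<circ> chart_inv d)"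
    by (rule continuous_map_compose[OF continuous_chart_inv[OF sd] q])
  then have "continuous_on (chart_range d) (\<lambda>y. q (chart_inv d y))" by (simp add: o_def)
  moreover have "chart_range d \<in> sets borel" using sd by (auto simp: surface_chart_def)
  ultimately have [measurable]: "(\<lambda>y. ennreal (q (chart_inv d y)) * indicator (chart_range d) y) \<in> borel_measurable borel"
    by (intro continuous_on_ennreal_indicator_measurable)
  note [measurable] = chart_density_measurable[OF sd hd]
  have eq: "(\<lambda>y. ennreal (q (chart_inv d y)) * ennreal (sqrt (det (h d (chart_inv d y)))) * indicator (chart_range d) y) =
    (\<lambda>y. (ennreal (q (chart_inv d y)) * indicator (chart_range d) y) * ennreal (chart_density h d y))"
    by (auto simp: fun_eq_iff chart_density_def indicator_def)
  show ?thesis unfolding eq by measurable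
qed

end

context handle_surface
begin

text \<open>In the coordinates of an annular chart the density of the metric is comparable, uniformly in
  \<open>n\<close>, to a function of the radius alone. Hence the transport around circles controls the mass.\<close>

lemma sheet_mass_bound:
  assumes \<sigma>: "\<sigma> = 1 \<or> \<sigma> = - 1"
  obtains C :: real where "C > 0" "\<And>n u. smooth_function \<A> u \<Longrightarrow>
    mass n u (sheet \<sigma>) \<le> ennreal C * str.energy n u"
proof -
  let ?d = "annular_chart \<sigma>"
  note cd = annular_compatible[OF \<sigma>]
  obtain B where B: "B \<ge> 0" "\<And>x. x \<in> annulus \<Longrightarrow> (slope g \<sigma> x $ 1)\<^sup>2 + (slope g \<sigma> x $ 2)\<^sup>2 \<le> B"
    using slope_bound by blast
  \<comment> \<open>Four times \<open>7/2 * (1 + B)\<close>, a bound for the squared length of the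
    angular field; it dominates \<open>1 + B\<close> as well and so serves for both parts of the
    determinant.\<close>
  define K where "K = 14 * (1 + B)"
  have K: "K > 0" using B(1) by (simp add: K_def)
  have inner: "(slope g \<sigma> x \<bullet> angular_field x)\<^sup>2 \<le> 7/2 * B" if x: "x \<in> annulus" for x
  proof -
    let ?\<eta> = "slope g \<sigma> x"
    have r: "0 \<le> radius_sq x" "radius_sq x \<le> 7/2" using x by (auto simp: annulus_def)
    have "(?\<eta> \<bullet> angular_field x)\<^sup>2 = ((?\<eta> $ 1)\<^sup>2 + (?\<eta> $ 2)\<^sup>2) * radius_sq x - (?\<eta> $ 1 * x $ 1 + ?\<eta> $ 2 * x $ 2)\<^sup>2"
      by (simp add: inner_vec_def sum_2 radius_sq_def power2_eq_square algebra_simps)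
    also have "\<dots> \<le> ((?\<eta> $ 1)\<^sup>2 + (?\<eta> $ 2)\<^sup>2) * radius_sq x" by simp
    also have "\<dots> \<le> B * (7/2)" using B(1) B(2)[OF x] r by (intro mult_mono) auto
    finally show ?thesis by simp
  qed
  \<comment> \<open>A radial stand-in for the area density: constant along the circles, and
    comparable to the density with factors free of \<open>n\<close>.\<close>
  define j where "j n x = sqrt (1 + bump n (radius_sq x))" for n x
  have j0: "j n x \<ge> 0" for n x using bump_pos[of n "radius_sq x"] by (simp add: j_def)
  let ?det = "\<lambda>n x. sqrt (det (stretched n ?d (chart_inv ?d x)))"
  have lower: "j n x \<le> ?det n x" and upper: "?det n x \<le> sqrt K * j n x" if x: "x \<in> annulus" for n x
  proof -
    let ?e = "bump n (radius_sq x)"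
    let ?s = "(slope g \<sigma> x $ 1)\<^sup>2 + (slope g \<sigma> x $ 2)\<^sup>2"
    let ?t = "radius_sq x + (slope g \<sigma> x \<bullet> angular_field x)\<^sup>2"
    have e: "?e > 0" by (rule bump_pos)
    have d: "det (stretched n ?d (chart_inv ?d x)) = 1 + ?s + 4 * ?e * ?t"
      unfolding annular_det(1)[OF \<sigma> x] by simp
    have r: "3/2 < radius_sq x" "radius_sq x < 7/2" using x by (auto simp: annulus_def)
    have q: "0 \<le> (slope g \<sigma> x \<bullet> angular_field x)\<^sup>2" "0 \<le> ?s" by simp_all
    have t: "1/4 \<le> ?t" using q r by linarith
    have t': "4 * ?t \<le> K" using inner[OF x] r unfolding K_def by (simp add: distrib_left)
    have s: "1 + ?s \<le> K" using B(2)[OF x] B(1) by (simp add: K_def)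
    have ar: "1 + a \<le> 1 + b + 4 * a * c \<and> 1 + b + 4 * a * c \<le> K * (1 + a)"
      if "a > 0" "1/4 \<le> c" "4 * c \<le> K" "0 \<le> b" "1 + b \<le> K" for a b c :: real
    proof -
      have 1: "a * 1 \<le> a * (4 * c)" "a * (4 * c) \<le> a * K"
        using that by (intro mult_left_mono; simp)+
      have 2: "4 * a * c = a * (4 * c)" "K * (1 + a) = K + a * K"
        by (simp_all add: distrib_left mult.commute)
      show ?thesis using 1 that unfolding 2 by linarith
    qed
    note ar = ar[OF e t t' q(2) s]
    show "j n x \<le> ?det n x" unfolding j_def d using ar by simp
    show "?det n x \<le> sqrt K * j n x" unfolding j_def d real_sqrt_mult[symmetric] using ar by simp
  qed
  \<comment> \<open>\<open>sqrt K\<close> from the upper density bound, \<open>pi/2\<close> from the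
    circle estimate, \<open>2*pi\<close> from averaging, and \<open>K\<close> from the length of the
    angular field.\<close>
  define C where "C = sqrt K * (pi\<^sup>2 * K)"
  have "mass n u (sheet \<sigma>) \<le> ennreal C * str.energy n u"
    if u: "smooth_function \<A> u" for n u
  proof -
    let ?u = "u \<circ> chart_inv ?d"
    note hd = annular_metric_components[OF \<sigma>, of n]
    have cu: "continuous_map X euclidean u" by (rule smooth_function_continuous_map[OF atlas u])
    have du: "?u differentiable (at x)" if x: "x \<in> annulus" for x
    proof -
      have "chart_inv ?d x \<in> chart_dom ?d" "chart_map ?d (chart_inv ?d x) = x"
        using chart_inv_in_dom[of x ?d] chart_map_inv[of x ?d] x annular_chart_range[OF \<sigma>] by auto
      then show ?thesis using smooth_function_differentiable[OF atlas u cd, of "chart_inv ?d x"] by simp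
    qed
    \<comment> \<open>The covariant derivative along the angular field, on which the one-form takes
      the value 1/2.\<close>
    define W where "W x = frechet_derivative ?u (at x) (angular_field x) - \<i> * ?u x * of_real (1/2)" for x
    have cuA: "continuous_on annulus ?u"
      using du by (intro continuous_at_imp_continuous_on ballI differentiable_imp_continuous_within)
    have cD: "continuous_on annulus (\<lambda>x. frechet_derivative ?u (at x) (angular_field x))"
    proof (rule continuous_on_eq)
      show "continuous_on annulus (\<lambda>x. (- x$2) *\<^sub>R partial_deriv 1 ?u x + x$1 *\<^sub>R partial_deriv 2 ?u x)"
        by (intro continuous_intros annular_partial_deriv_continuous[OF \<sigma> u])
      show "(- x$2) *\<^sub>R partial_deriv 1 ?u x + x$1 *\<^sub>R partial_deriv 2 ?u x = frechet_derivative ?u (at x) (angular_field x)"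
        if "x \<in> annulus" for x
        unfolding frechet_derivative_partial[OF du[OF that]] by (simp add: sum_2)
    qed
    have cW: "continuous_on annulus W"
      unfolding W_def by (intro continuous_intros cD cuA)
    define f where "f x = ennreal (indicator annulus x * (j n x * (cmod (W x))\<^sup>2))" for x
    have cj: "continuous_on S (j n)" for S
      unfolding j_def bump_def by (intro continuous_intros continuous_on_radius_sq)
    have fm [measurable]: "f \<in> borel_measurable borel"
    proof -
      have "(\<lambda>x. indicator annulus x *\<^sub>R (j n x * (cmod (W x))\<^sup>2)) \<in> borel_measurable borel"
        using open_annulus by (intro borel_measurable_continuous_on_indicator continuous_intros cW cj) auto
      then show ?thesis unfolding f_def by simp
    qed
    have rot: "rotation t x \<in> annulus" "j n (rotation t x) = j n x" if "x \<in> annulus" for t x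
    proof -
      have "radius_sq (rotation t x) = radius_sq x" unfolding radius_sq_def by (rule rotation_radius)
      then show "rotation t x \<in> annulus" "j n (rotation t x) = j n x"
        using that by (simp_all add: annulus_def j_def)
    qed
    \<comment> \<open>Being constant along the circle through \<open>x\<close>, the weight
      \<open>j n x\<close> moves under the integral. This is why an unbounded area density does no
      harm.\<close>
    have point: "ennreal ((cmod (?u x))\<^sup>2) * ennreal (j n x) \<le>
        ennreal (pi/2) * (\<integral>\<^sup>+ t. f (rotation t x) * indicator {0..2*pi} t \<partial>lborel)" if x: "x \<in> annulus" for x
    proof -
      have crot: "continuous_on S (\<lambda>t. rotation t x)" for S
        by (intro continuous_at_imp_continuous_on ballI has_vector_derivative_continuous[OF rotation_has_vector_derivative])
      have hv: "((\<lambda>t. ?u (rotation t x)) has_vector_derivative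
          frechet_derivative ?u (at (rotation t x)) (angular_field (rotation t x))) (at t)" for t
        using vector_derivative_diff_chain_within[OF rotation_has_vector_derivative[of x t, THEN has_vector_derivative_at_within, of UNIV]
            has_derivative_at_withinI[OF has_frechet_derivative[OF du[OF rot(1)[OF x]]]]]
        by (simp add: o_def)
      have cc: "continuous_on {0..2*pi} (\<lambda>t. frechet_derivative ?u (at (rotation t x)) (angular_field (rotation t x)))"
        by (rule continuous_on_compose2[OF cD crot]) (use rot(1)[OF x] in auto)
      have "ennreal ((cmod (?u (rotation 0 x)))\<^sup>2) \<le> ennreal (pi/2) *
        (\<integral>\<^sup>+ t. ennreal ((cmod (W (rotation t x)))\<^sup>2) * indicator {0..2*pi} t \<partial>lborel)"
        unfolding W_def by (rule circle_transport_bound[OF hv cc]) simp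
      then have "ennreal ((cmod (?u x))\<^sup>2) * ennreal (j n x) \<le> ennreal (pi/2) *
        ((\<integral>\<^sup>+ t. ennreal ((cmod (W (rotation t x)))\<^sup>2) * indicator {0..2*pi} t \<partial>lborel) * ennreal (j n x))"
        by (simp add: mult_right_mono mult.assoc[symmetric])
      also have "(\<integral>\<^sup>+ t. ennreal ((cmod (W (rotation t x)))\<^sup>2) * indicator {0..2*pi} t \<partial>lborel) * ennreal (j n x) =
        (\<integral>\<^sup>+ t. ennreal ((cmod (W (rotation t x)))\<^sup>2) * indicator {0..2*pi} t * ennreal (j n x) \<partial>lborel)"
      proof (rule nn_integral_multc[symmetric])
        have "continuous_on {0..2*pi} (\<lambda>t. (cmod (W (rotation t x)))\<^sup>2)"
          by (intro continuous_intros continuous_on_compose2[OF cW crot]) (use rot(1)[OF x] in auto)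
        then have "(\<lambda>t. ennreal ((cmod (W (rotation t x)))\<^sup>2) * indicator {0..2*pi} t) \<in> borel_measurable borel"
          by (intro continuous_on_ennreal_indicator_measurable) simp_all
        then show "(\<lambda>t. ennreal ((cmod (W (rotation t x)))\<^sup>2) * indicator {0..2*pi} t) \<in> borel_measurable lborel"
          by simp
      qed
      also have "\<dots> = (\<integral>\<^sup>+ t. f (rotation t x) * indicator {0..2*pi} t \<partial>lborel)"
        using rot[OF x] j0
        by (intro nn_integral_cong) (simp add: f_def ennreal_mult mult.commute mult.left_commute)
      finally show ?thesis .
    qed
    have um: "(\<lambda>p. ennreal ((cmod (u p))\<^sup>2)) \<in> borel_measurable (vol n)"
      using str.continuous_measurable[OF cu, of n] by measurable
    have em: "(\<lambda>p. ennreal (energy_density n u p)) \<in> borel_measurable (vol n)"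
      using str.continuous_measurable[OF str.energy_density_continuous[OF u, of n]] by measurable
    have "mass n u (sheet \<sigma>) =
      (\<integral>\<^sup>+ x. ennreal ((cmod (?u x))\<^sup>2) * ennreal (?det n x) * indicator annulus x \<partial>lborel)"
      using str.nn_integral_chart[OF cd hd um] by (simp add: annular_chart_range[OF \<sigma>])
    also have "\<dots> \<le> (\<integral>\<^sup>+ x. ennreal (sqrt K * (pi/2)) * (\<integral>\<^sup>+ t. f (rotation t x) * indicator {0..2*pi} t \<partial>lborel) \<partial>lborel)"
    proof (rule nn_integral_mono)
      fix x
      show "ennreal ((cmod (?u x))\<^sup>2) * ennreal (?det n x) * indicator annulus x \<le>
         ennreal (sqrt K * (pi/2)) * (\<integral>\<^sup>+ t. f (rotation t x) * indicator {0..2*pi} t \<partial>lborel)"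
      proof (cases "x \<in> annulus")
        case True
        have "ennreal ((cmod (?u x))\<^sup>2) * ennreal (?det n x) \<le> ennreal ((cmod (?u x))\<^sup>2) * (ennreal (sqrt K) * ennreal (j n x))"
          using upper[OF True, of n] j0 K by (intro mult_left_mono) (simp_all add: ennreal_mult[symmetric] ennreal_leI)
        also have "\<dots> = ennreal (sqrt K) * (ennreal ((cmod (?u x))\<^sup>2) * ennreal (j n x))" by (simp add: mult.left_commute)
        also have "\<dots> \<le> ennreal (sqrt K) * (ennreal (pi/2) * (\<integral>\<^sup>+ t. f (rotation t x) * indicator {0..2*pi} t \<partial>lborel))"
          by (intro mult_left_mono point[OF True]) simp
        also have "\<dots> = ennreal (sqrt K * (pi/2)) * (\<integral>\<^sup>+ t. f (rotation t x) * indicator {0..2*pi} t \<partial>lborel)"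
          using K by (subst ennreal_mult) (simp_all add: mult.assoc)
        finally show ?thesis using True by simp
      qed simp
    qed
    also have "\<dots> = ennreal (sqrt K * (pi/2)) * (ennreal (2*pi) * (\<integral>\<^sup>+ x. f x \<partial>lborel))"
    proof -
      have mr: "(\<lambda>(x, t). rotation t x) \<in> borel_measurable (borel \<Otimes>\<^sub>M borel)"
        unfolding borel_prod by (rule borel_measurable_continuous_onI[OF rotation_continuous])
      have mi: "(\<lambda>x. \<integral>\<^sup>+ t. f (rotation t x) * indicator {0..2*pi} t \<partial>lborel) \<in> borel_measurable lborel"
      proof -
        have [measurable]: "(\<lambda>p. rotation (snd p) (fst p)) \<in> borel_measurable (borel \<Otimes>\<^sub>M borel)"
          using mr by (simp add: case_prod_beta')
        have "(\<lambda>(x, t). f (rotation t x) * indicator {0..2*pi} t) \<in> borel_measurable (lborel \<Otimes>\<^sub>M lborel)"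
          unfolding measurable_cong_sets[OF sets_pair_measure_cong[OF sets_lborel sets_lborel] refl] case_prod_beta'
          by measurable
        then show ?thesis by (rule lborel.borel_measurable_nn_integral)
      qed
      show ?thesis
        unfolding nn_integral_cmult[OF mi]
        by (subst nn_integral_flow_average[OF rotation_measure_preserving mr fm]) auto
    qed
    also have "(\<integral>\<^sup>+ x. f x \<partial>lborel) \<le> ennreal K * str.energy n u"
    proof -
      \<comment> \<open>From the covariant derivative back to the energy: Cauchy-Schwarz with the
        angular field, whose length is bounded independently of \<open>n\<close>, and the lower
        density bound.\<close>
      have fx: "f x \<le> ennreal K * (ennreal (energy_density n u (chart_inv ?d x)) *
          ennreal (?det n x) * indicator annulus x)" for x
      proof (cases "x \<in> annulus")
        case True
        let ?p = "chart_inv ?d x"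
        have p: "?p \<in> chart_dom ?d" "chart_map ?d ?p = x"
          using chart_inv_in_dom[of x ?d] chart_map_inv[of x ?d] True annular_chart_range[OF \<sigma>] by auto
        let ?E = "energy_density n u ?p"
        have E: "?E = covector_norm_sq (stretched n ?d ?p) (magnetic_differential field u ?d ?p)"
          by (rule str.energy_density_chart[OF u cd hd annular_one_form_components[OF \<sigma>] p(1)])
        have W: "(\<Sum>i\<in>UNIV. of_real (angular_field x $ i) * magnetic_differential field u ?d ?p $ i) = W x"
        proof -
          have "(\<Sum>i\<in>UNIV. of_real (angular_field x $ i) * magnetic_differential field u ?d ?p $ i) =
            frechet_derivative ?u (at x) (angular_field x) - \<i> * ?u x * of_real (angular_field x \<bullet> field ?d ?p)"
            unfolding frechet_derivative_partial[OF du[OF True]]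
            by (simp add: magnetic_differential_def p(2) sum_2 inner_vec_def scaleR_conv_of_real algebra_simps
                del: annular_chart_simps)
          then show ?thesis by (simp only: W_def annular_field[OF \<sigma> True])
        qed
        have pos: "positive_form (stretched n ?d ?p)" by (rule metric_components_positive[OF hd p(1)])
        have E0: "?E \<ge> 0" unfolding E by (rule covector_norm_sq_nonneg[OF pos])
        have "(cmod (W x))\<^sup>2 \<le> ?E * (radius_sq x + (slope g \<sigma> x \<bullet> angular_field x)\<^sup>2)"
          using covector_norm_sq_ge[OF pos, of "angular_field x" "magnetic_differential field u ?d ?p"]
          unfolding W E annular_det(2)[OF \<sigma> True] .
        also have "\<dots> \<le> ?E * K"
          using inner[OF True] True B(1) E0 by (intro mult_left_mono) (auto simp: annulus_def K_def)
        finally have "j n x * (cmod (W x))\<^sup>2 \<le> ?det n x * (?E * K)"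
          using lower[OF True, of n] j0[of n x] E0 K positive_form_det[OF pos] by (intro mult_mono) auto
        then have "f x \<le> ennreal (?det n x * (?E * K))"
          using True by (simp add: f_def ennreal_leI)
        also have "\<dots> = ennreal K * (ennreal ?E * ennreal (?det n x))"
        proof -
          have "?det n x \<ge> 0" using lower[OF True, of n] j0[of n x] by linarith
          then show ?thesis using E0 K by (simp add: ennreal_mult mult.commute mult.left_commute)
        qed
        finally show ?thesis using True by simp
      qed (simp add: f_def)
      have dm: "(\<lambda>x. ennreal (energy_density n u (chart_inv ?d x)) *
          ennreal (?det n x) * indicator annulus x) \<in> borel_measurable lborel"
        using str.chart_integrand_measurable[OF cd hd str.energy_density_continuous[OF u, of n]]
        by (simp only: annular_chart_range[OF \<sigma>])
      have "(\<integral>\<^sup>+ x. f x \<partial>lborel) \<le> (\<integral>\<^sup>+ x. ennreal K * (ennreal (energy_density n u (chart_inv ?d x)) *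
          ennreal (?det n x) * indicator annulus x) \<partial>lborel)"
        by (intro nn_integral_mono fx)
      also have "\<dots> = ennreal K * (\<integral>\<^sup>+ x. ennreal (energy_density n u (chart_inv ?d x)) *
          ennreal (?det n x) * indicator annulus x \<partial>lborel)"
        by (rule nn_integral_cmult[OF dm])
      also have "\<dots> = ennreal K * (\<integral>\<^sup>+ p. ennreal (energy_density n u p) * indicator (sheet \<sigma>) p \<partial>vol n)"
        using str.nn_integral_chart[OF cd hd em] by (simp add: annular_chart_range[OF \<sigma>])
      also have "\<dots> \<le> ennreal K * str.energy n u"
        by (intro mult_left_mono nn_integral_mono) (auto simp: indicator_def)
      finally show ?thesis .
    qed
    finally have "mass n u (sheet \<sigma>) \<le>
      ennreal (sqrt K * (pi/2)) * (ennreal (2*pi) * (ennreal K * str.energy n u))"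
      by (simp add: mult_left_mono)
    also have "\<dots> = ennreal C * str.energy n u"
    proof -
      have "C = sqrt K * (pi/2) * (2*pi * K)" by (simp add: C_def power2_eq_square)
      then have "ennreal C = ennreal (sqrt K * (pi/2)) * (ennreal (2*pi) * ennreal K)"
        using K by (simp add: ennreal_mult[symmetric])
      then show ?thesis by (simp add: mult.assoc)
    qed
    finally show ?thesis .
  qed
  moreover have "C > 0" using K by (simp add: C_def)
  ultimately show ?thesis using that by blast
qed

end

text \<open>The Cauchy-Binet formula for four covectors with weights 1, 1, 1 and \<open>e\<close>: a
  sum of squared minors. In particular the determinant does not decrease with
  \<open>e\<close>.\<close>

lemma gram_det_expansion:
  fixes a b c d :: "real^2"
  shows "(a$1*a$1 + b$1*b$1 + c$1*c$1 + e*(d$1*d$1)) * (a$2*a$2 + b$2*b$2 + c$2*c$2 + e*(d$2*d$2)) -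
     (a$1*a$2 + b$1*b$2 + c$1*c$2 + e*(d$1*d$2)) * (a$2*a$1 + b$2*b$1 + c$2*c$1 + e*(d$2*d$1)) =
     ((a$1*b$2 - a$2*b$1)\<^sup>2 + (a$1*c$2 - a$2*c$1)\<^sup>2 + (b$1*c$2 - b$2*c$1)\<^sup>2) +
     e * ((a$1*d$2 - a$2*d$1)\<^sup>2 + (b$1*d$2 - b$2*d$1)\<^sup>2 + (c$1*d$2 - c$2*d$1)\<^sup>2)"
  by algebra

section \<open>Propagation of mass bounds through charts\<close>

context handle_surface
begin

text \<open>The energy on the right is that of the whole surface, so bounds can be carried from set
  to set without localising it. A negative \<open>C\<close> counts as zero under
  \<open>ennreal\<close>.\<close>

definition good :: "'a set \<Rightarrow> bool" where
  "good U \<longleftrightarrow> (\<exists>C::real. \<forall>n u. smooth_function \<A> u \<longrightarrow>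
     mass n u U \<le> ennreal C * str.energy n u)"

lemma gram_det_mono:
  assumes "e \<le> e'" shows "det (gram e c p) \<le> det (gram e' c p)"
  using mult_right_mono[OF assms] by (simp add: det_2 gram_def sum_3 gram_det_expansion)

lemma gram_quadratic_mono:
  assumes "e \<le> e'" shows "v \<bullet> (gram e c p *v v) \<le> v \<bullet> (gram e' c p *v v)"
  unfolding gram_form using mult_right_mono[OF assms] by simp

lemma gram_local_continuous:
  assumes c: "c \<in> \<A>"
  shows "continuous_on (chart_range c) (\<lambda>y. gram e c (chart_inv c y))"
proof (intro continuous_on_vecI)
  fix i j
  have sF: "smooth_map_on ((\<lambda>p. F p $ m) \<circ> chart_inv c) (chart_range c)" for m
    using smooth_F_nth c by (simp add: smooth_function_def)
  have sr: "smooth_map_on (radius \<circ> chart_inv c) (chart_range c)"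
    using smooth_radius c by (simp add: smooth_function_def)
  have "continuous_on (chart_range c) (\<lambda>y. (\<Sum>m\<in>UNIV. partial_deriv i ((\<lambda>p. F p $ m) \<circ> chart_inv c) y * partial_deriv j ((\<lambda>p. F p $ m) \<circ> chart_inv c) y) +
     e * (partial_deriv i (radius \<circ> chart_inv c) y * partial_deriv j (radius \<circ> chart_inv c) y))"
    by (intro continuous_intros smooth_map_on_continuous smooth_map_on_partial_deriv sF sr)
  then show "continuous_on (chart_range c) (\<lambda>y. gram e c (chart_inv c y) $ i $ j)"
    by (rule continuous_on_eq) (simp add: gram_def differential_local)
qed

lemma gram_positive_atlas:
  assumes "c \<in> \<A>" "p \<in> chart_dom c" "e \<ge> 0"
  shows "positive_form (gram e c p)"
  by (rule gram_positive[OF F_immersion[OF assms(1) chart_map_in_range[OF assms(2)]]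
        smooth_function_differentiable[OF atlas F_smooth atlas_compatible[OF atlas assms(1)] assms(2)] assms(3)])

text \<open>Away from the stretched region the metrics lie between two fixed ones, and translating balls
  in a chart propagates mass bounds.\<close>

lemma good_propagates:
  assumes p: "p \<in> topspace X" "radius p \<notin> {2..3}"
  shows "\<exists>N. openin X N \<and> p \<in> N \<and>
    (\<forall>q\<in>N. \<forall>U. openin X U \<and> q \<in> U \<and> good U \<longrightarrow> (\<exists>V. openin X V \<and> p \<in> V \<and> good V))"
proof -
  obtain c where c: "c \<in> \<A>" "p \<in> chart_dom c" "surface_chart X c" by (rule str.chart_at[OF p(1)])
  let ?r = "chart_range c" let ?inv = "chart_inv c"
  have or: "open ?r" by (rule open_range[OF c(1)])
  let ?y0 = "chart_map c p"
  have cr: "continuous_on ?r (\<lambda>y. radius (?inv y))"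
    by (rule smooth_map_on_continuous[OF smooth_radius_local[OF c(1)]])
  have o: "open (?r \<inter> (\<lambda>y. radius (?inv y)) -` (- {2..3}))"
    using continuous_on_open_vimage[OF or, of "\<lambda>y. radius (?inv y)"] cr by (auto simp: open_Compl Int_commute)
  have y0: "?y0 \<in> ?r \<inter> (\<lambda>y. radius (?inv y)) -` (- {2..3})"
    using p(2) chart_map_in_range[OF c(2)] chart_inv_map[OF c(3,2)] by simp
  obtain R where R: "R > 0" "cball ?y0 R \<subseteq> ?r \<inter> (\<lambda>y. radius (?inv y)) -` (- {2..3})"
    using o y0 unfolding open_contains_cball by blast
  let ?K = "cball ?y0 R" let ?B = "ball ?y0 R"
  have Kr: "?K \<subseteq> ?r" and Br: "?B \<subseteq> ?r" using R(2) by auto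
  \<comment> \<open>Off the stretched ring the exponent is not positive, so on this ball all metrics
    lie between \<open>gram 0\<close> and \<open>gram 1\<close>.\<close>
  have bump: "bump n (radius (?inv y)) \<le> 1" if y: "y \<in> ?K" for y n
  proof -
    have "radius (?inv y) \<notin> {2..3}" using R(2) y by auto
    then have "(radius (?inv y) - 2) * (3 - radius (?inv y)) \<le> 0"
      by (auto simp: mult_le_0_iff)
    then show ?thesis by (simp add: bump_def mult_nonneg_nonpos)
  qed
  have cdet: "continuous_on ?K (\<lambda>y. det (gram e c (?inv y)))" for e
    by (intro continuous_on_det_2 continuous_on_subset[OF gram_local_continuous[OF c(1)] Kr])
  have ne: "?K \<noteq> {}" using R(1) by simp
  obtain ym where ym: "ym \<in> ?K" "\<And>y. y \<in> ?K \<Longrightarrow> det (gram 0 c (?inv ym)) \<le> det (gram 0 c (?inv y))"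
    using continuous_attains_inf[OF compact_cball ne cdet[of 0]] by blast
  obtain yM where yM: "yM \<in> ?K" "\<And>y. y \<in> ?K \<Longrightarrow> det (gram 1 c (?inv y)) \<le> det (gram 1 c (?inv yM))"
    using continuous_attains_sup[OF compact_cball ne cdet[of 1]] by blast
  \<comment> \<open>Density bounds for all \<open>n\<close> at once, taken from the two enclosing
    metrics on a compact ball.\<close>
  define c0 where "c0 = sqrt (det (gram 0 c (?inv ym)))"
  define C0 where "C0 = sqrt (det (gram 1 c (?inv yM)))"
  have c0: "c0 > 0"
    unfolding c0_def using positive_form_det[OF gram_positive_atlas[OF c(1) chart_inv_in_dom[OF subsetD[OF Kr ym(1)]], of 0]] by simp
  have C0: "C0 > 0"
    unfolding C0_def using positive_form_det[OF gram_positive_atlas[OF c(1) chart_inv_in_dom[OF subsetD[OF Kr yM(1)]], of 1]] by simp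
  let ?det = "\<lambda>n y. sqrt (det (stretched n c (?inv y)))"
  have lower: "c0 \<le> ?det n y" and upper: "?det n y \<le> C0" if y: "y \<in> ?K" for n y
  proof -
    have "det (gram 0 c (?inv ym)) \<le> det (stretched n c (?inv y))"
      using ym(2)[OF y] gram_det_mono[of 0 "bump n (radius (?inv y))" c "?inv y"] bump_pos[of n "radius (?inv y)"]
      unfolding stretched_def by linarith
    then show "c0 \<le> ?det n y" unfolding c0_def by simp
    have "det (stretched n c (?inv y)) \<le> det (gram 1 c (?inv yM))"
      using yM(2)[OF y] gram_det_mono[OF bump[OF y, of n], of c "?inv y"] unfolding stretched_def by linarith
    then show "?det n y \<le> C0" unfolding C0_def by simp
  qed
  have comp: "compatible_chart X \<A> c" by (rule atlas_compatible[OF atlas c(1)])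
  \<comment> \<open>Half of the radius leaves room: a small ball about a point of \<open>N\<close>
    can be translated to \<open>?y0\<close> without leaving \<open>?B\<close>. It is fixed before
    \<open>q\<close> and \<open>U\<close> are given, as the argument by connectedness
    requires.\<close>
  define N where "N = chart_dom c \<inter> chart_map c -` ball ?y0 (R/2)"
  have oN: "openin X N" unfolding N_def by (rule openin_chart_preimage[OF c(3) open_ball])
  have pN: "p \<in> N" unfolding N_def using c(2) R(1) by simp
  have "\<exists>V. openin X V \<and> p \<in> V \<and> good V" if q: "q \<in> N" and U: "openin X U" "q \<in> U" "good U" for q U
  proof -
    let ?a = "chart_map c q"
    have qc: "q \<in> chart_dom c" and aB: "?a \<in> ball ?y0 (R/2)" using q by (auto simp: N_def)
    have "open (chart_map c ` (chart_dom c \<inter> U))" by (rule open_chart_image[OF c(3) U(1)])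
    moreover have "?a \<in> chart_map c ` (chart_dom c \<inter> U)" using qc U(2) by blast
    ultimately obtain s' where s': "s' > 0" "ball ?a s' \<subseteq> chart_map c ` (chart_dom c \<inter> U)"
      unfolding open_contains_ball by blast
    \<comment> \<open>Small enough for the ball about \<open>?a\<close> to come from
      \<open>U\<close>, and at most \<open>R/2\<close> for the sake of the translates.\<close>
    define s where "s = min s' (R/2)"
    have s: "s > 0" "s \<le> R/2" "ball ?a s \<subseteq> chart_map c ` (chart_dom c \<inter> U)"
      using s' R(1) by (auto simp: s_def)
    have UB: "?inv y \<in> U" if yb: "y \<in> ball ?a s" for y
    proof -
      obtain z where "z \<in> chart_dom c" "z \<in> U" "y = chart_map c z" using s(3) yb by blast
      then show ?thesis by (simp add: chart_inv_map[OF c(3)])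
    qed
    define v where "v = ?y0 - ?a"
    have seg: "y + t *\<^sub>R v \<in> ?B" if y: "y \<in> ball ?a s" and t: "0 \<le> t" "t \<le> 1" for y t
    proof -
      have "?y0 - (y + t *\<^sub>R v) = (?a - y) + (1 - t) *\<^sub>R v" by (simp add: v_def algebra_simps)
      then have "norm (?y0 - (y + t *\<^sub>R v)) \<le> norm (?a - y) + norm ((1 - t) *\<^sub>R v)"
        using norm_triangle_ineq by metis
      also have "norm ((1 - t) *\<^sub>R v) \<le> 1 * norm v" unfolding norm_scaleR using t by (intro mult_right_mono) auto
      also have "norm v < R/2" using aB by (simp add: v_def dist_norm)
      also have "norm (?a - y) < R/2" using y s(2) by (simp add: dist_norm)
      finally show ?thesis by (simp add: dist_norm)
    qed
    define V where "V = chart_dom c \<inter> chart_map c -` ball ?y0 s"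
    have oV: "openin X V" unfolding V_def by (rule openin_chart_preimage[OF c(3) open_ball])
    have pV: "p \<in> V" unfolding V_def using c(2) s(1) by simp
    have sB: "ball ?y0 s \<subseteq> ?B" "ball ?a s \<subseteq> ?B"
      using s(2) R(1) seg[of _ 0] by auto
    have cv: "continuous_on ?K (\<lambda>y. v \<bullet> (gram 1 c (?inv y) *v v))"
      unfolding quadratic_form_2 by (intro continuous_intros continuous_on_subset[OF gram_local_continuous[OF c(1)] Kr])
    obtain yv where yv: "\<And>y. y \<in> ?K \<Longrightarrow> v \<bullet> (gram 1 c (?inv y) *v v) \<le> v \<bullet> (gram 1 c (?inv yv) *v v)"
      using continuous_attains_sup[OF compact_cball ne cv] by blast
    \<comment> \<open>A bound for the squared length of \<open>v\<close> in all the metrics on the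
      ball; the maximum makes its sign evident.\<close>
    define C1 where "C1 = max 0 (v \<bullet> (gram 1 c (?inv yv) *v v))"
    obtain CU :: real where CU0: "\<And>n u. smooth_function \<A> u \<Longrightarrow>
     mass n u U \<le> ennreal CU * str.energy n u"
      using U(3) unfolding good_def by blast
    have M: "mass n u V \<le>
        ennreal C0 * (ennreal (exp 1) * (ennreal (1 / c0) * (ennreal CU * str.energy n u) + ennreal (C1 / c0) * str.energy n u))"
      if u: "smooth_function \<A> u" for n u
    proof -
      let ?u = "u \<circ> ?inv"
      have hc: "metric_components \<A> (stretched n) c" by (rule riemannian_metric_components[OF stretched_metric c(1)])
      have cu: "continuous_map X euclidean u" by (rule smooth_function_continuous_map[OF atlas u])
      have su: "smooth_map_on ?u ?r" using u c(1) by (simp add: smooth_function_def)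
      have sf: "smooth_map_on (field c \<circ> ?inv) ?r"
        using field_smooth_one_form c(1) by (simp add: smooth_one_form_def)
      have um: "(\<lambda>p. ennreal ((cmod (u p))\<^sup>2) * indicator S p) \<in> borel_measurable (vol n)"
        if "openin X S" for S
        using str.continuous_measurable[OF cu, of n] str.openin_sets[OF that, of n] by measurable
      let ?b = "\<lambda>y. v \<bullet> field c (?inv y)"
      \<comment> \<open>The covariant derivative along the constant vector \<open>v\<close>; the
        real function \<open>?b\<close> is the potential to which
        \<open>segment_transport_bound\<close> is insensitive.\<close>
      define W where "W y = frechet_derivative ?u (at y) v - \<i> * ?u y * of_real (?b y)" for y
      have cD: "continuous_on ?r (\<lambda>y. frechet_derivative ?u (at y) v)"
        by (rule smooth_map_on_continuous[OF smooth_map_on_frechet_derivative[OF su]])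
      have cb: "continuous_on ?r ?b"
        using smooth_map_on_continuous[OF sf] by (intro continuous_intros) (simp add: o_def)
      have cW: "continuous_on ?r W"
        unfolding W_def by (intro continuous_intros cD cb smooth_map_on_continuous[OF su])
      have meas: "(\<lambda>y. ennreal (q y) * indicator (ball z t) y) \<in> borel_measurable borel"
        if "ball z t \<subseteq> ?r" "continuous_on ?r q" for q :: "real^2 \<Rightarrow> real" and z t
        by (intro continuous_on_ennreal_indicator_measurable continuous_on_subset[OF that(2,1)]) simp
      define f where "f y = ennreal ((cmod (W y))\<^sup>2) * indicator ?B y" for y
      have fm [measurable]: "f \<in> borel_measurable borel"
        unfolding f_def by (intro meas Br continuous_intros cW)
      define m where "m z y = ennreal ((cmod (?u y))\<^sup>2) * indicator (ball z s) y" for z y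
      have mm [measurable]: "m z \<in> borel_measurable borel" if "ball z s \<subseteq> ?B" for z
        unfolding m_def using that Br by (intro meas continuous_intros smooth_map_on_continuous[OF su]) auto
      \<comment> \<open>Translation by \<open>v\<close> carries the ball about \<open>?a\<close>
        onto the ball about \<open>?y0\<close>. For other \<open>y\<close> the left-hand side is
        zero, so the estimate holds in the whole plane and can be integrated.\<close>
      have point: "m ?y0 (y + v) \<le> ennreal (exp 1) * (m ?a y + (\<integral>\<^sup>+ t. f (y + t *\<^sub>R v) * indicator {0..1} t \<partial>lborel))" for y
      proof (cases "y \<in> ball ?a s")
        case True
        have lr: "y + t *\<^sub>R v \<in> ?r" if "t \<in> {0..1}" for t using seg[OF True, of t] Br that by auto
        have cl: "continuous_on S (\<lambda>t. y + t *\<^sub>R v)" for S by (intro continuous_intros)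
        have "ennreal ((cmod (?u (y + 1 *\<^sub>R v)))\<^sup>2) \<le> ennreal (exp 1) * (ennreal ((cmod (?u (y + 0 *\<^sub>R v)))\<^sup>2) +
          (\<integral>\<^sup>+ t. ennreal ((cmod (W (y + t *\<^sub>R v)))\<^sup>2) * indicator {0..1} t \<partial>lborel))"
          unfolding W_def
        proof (rule segment_transport_bound)
          show "((\<lambda>t. ?u (y + t *\<^sub>R v)) has_vector_derivative frechet_derivative ?u (at (y + t *\<^sub>R v)) v) (at t)"
            if "t \<in> {0..1}" for t
            by (rule has_vector_derivative_along_line[OF smooth_map_on_differentiable[OF su lr[OF that]]])
          show "continuous_on {0..1} (\<lambda>t. frechet_derivative ?u (at (y + t *\<^sub>R v)) v)"
            by (rule continuous_on_compose2[OF cD cl]) (use lr in auto)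
          show "continuous_on {0..1} (\<lambda>t. ?b (y + t *\<^sub>R v))"
            by (rule continuous_on_compose2[OF cb cl]) (use lr in auto)
        qed
        moreover have "(\<integral>\<^sup>+ t. ennreal ((cmod (W (y + t *\<^sub>R v)))\<^sup>2) * indicator {0..1} t \<partial>lborel) =
          (\<integral>\<^sup>+ t. f (y + t *\<^sub>R v) * indicator {0..1} t \<partial>lborel)"
          using seg[OF True] by (intro nn_integral_cong) (auto simp: f_def indicator_def)
        moreover have "m ?y0 (y + v) = ennreal ((cmod (?u (y + v)))\<^sup>2)"
        proof -
          have "?y0 - (y + v) = ?a - y" by (simp add: v_def)
          then have "y + v \<in> ball ?y0 s" using True by (simp only: mem_ball dist_norm)
          then show ?thesis by (simp add: m_def)
        qed
        moreover have "m ?a y = ennreal ((cmod (?u y))\<^sup>2)" using True by (simp add: m_def)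
        ultimately show ?thesis by simp
      next
        case False
        have "?y0 - (y + v) = ?a - y" by (simp add: v_def)
        then have "y + v \<notin> ball ?y0 s" using False by (simp only: mem_ball dist_norm not_False_eq_True)
        then show ?thesis by (simp add: m_def)
      qed
      have mp: "distr lborel borel (\<lambda>y. y + w) = lborel" for w :: "real^2"
      proof -
        have "(\<lambda>y. y + w) = (+) w" by (simp add: fun_eq_iff add.commute)
        then show ?thesis by (simp only: lborel_distr_plus)
      qed
      have fl: "(\<lambda>(y, t). y + t *\<^sub>R v) \<in> borel_measurable (borel \<Otimes>\<^sub>M borel)" by measurable
      have fi: "(\<lambda>y. \<integral>\<^sup>+ t. f (y + t *\<^sub>R v) * indicator {0..1} t \<partial>lborel) \<in> borel_measurable borel"
      proof -
        have "(\<lambda>(y, t). f (y + t *\<^sub>R v) * indicator {0..1} t) \<in> borel_measurable (borel \<Otimes>\<^sub>M lborel)"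
          unfolding measurable_cong_sets[OF sets_pair_measure_cong[OF refl sets_lborel] refl] by measurable
        then show ?thesis by (rule lborel.borel_measurable_nn_integral)
      qed
      have "(\<integral>\<^sup>+ y. m ?y0 y \<partial>lborel) = (\<integral>\<^sup>+ y. m ?y0 (y + v) \<partial>lborel)"
        by (rule nn_integral_measure_preserving[OF mp _ mm[OF sB(1)], symmetric]) measurable
      also have "\<dots> \<le> (\<integral>\<^sup>+ y. ennreal (exp 1) * (m ?a y + (\<integral>\<^sup>+ t. f (y + t *\<^sub>R v) * indicator {0..1} t \<partial>lborel)) \<partial>lborel)"
        by (intro nn_integral_mono point)
      also have "\<dots> = ennreal (exp 1) * ((\<integral>\<^sup>+ y. m ?a y \<partial>lborel) +
          (\<integral>\<^sup>+ y. (\<integral>\<^sup>+ t. f (y + t *\<^sub>R v) * indicator {0..1} t \<partial>lborel) \<partial>lborel))"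
        using mm[OF sB(2)] fi by (subst nn_integral_cmult, simp, subst nn_integral_add) simp_all
      also have "(\<integral>\<^sup>+ y. (\<integral>\<^sup>+ t. f (y + t *\<^sub>R v) * indicator {0..1} t \<partial>lborel) \<partial>lborel) = (\<integral>\<^sup>+ y. f y \<partial>lborel)"
        using nn_integral_flow_average[OF mp fl fm, of 1] by simp
      finally have transl: "(\<integral>\<^sup>+ y. m ?y0 y \<partial>lborel) \<le> ennreal (exp 1) * ((\<integral>\<^sup>+ y. m ?a y \<partial>lborel) + (\<integral>\<^sup>+ y. f y \<partial>lborel))" .
      have em: "(\<lambda>p. ennreal (energy_density n u p)) \<in> borel_measurable (vol n)"
        using str.continuous_measurable[OF str.energy_density_continuous[OF u, of n]] by measurable
      \<comment> \<open>Three estimates now exchange Lebesgue measure for the Riemannian one: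
        \<open>C0\<close> bounds the density from above and \<open>c0\<close> from below, while
        \<open>C1\<close> controls the length of \<open>v\<close>.\<close>
      have 1: "mass n u V \<le> ennreal C0 * (\<integral>\<^sup>+ y. m ?y0 y \<partial>lborel)"
      proof -
        have "mass n u V =
          (\<integral>\<^sup>+ p. ennreal ((cmod (u p))\<^sup>2) * indicator V p * indicator (chart_dom c) p \<partial>vol n)"
          by (intro nn_integral_cong) (auto simp: V_def indicator_def)
        also have "\<dots> = (\<integral>\<^sup>+ y. ennreal ((cmod (u (?inv y)))\<^sup>2) * indicator V (?inv y) * ennreal (?det n y) * indicator ?r y \<partial>lborel)"
          by (rule str.nn_integral_chart[OF comp hc um[OF oV]])
        also have "\<dots> \<le> (\<integral>\<^sup>+ y. ennreal C0 * m ?y0 y \<partial>lborel)"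
        proof (rule nn_integral_mono)
          fix y
          show "ennreal ((cmod (u (?inv y)))\<^sup>2) * indicator V (?inv y) * ennreal (?det n y) * indicator ?r y \<le> ennreal C0 * m ?y0 y"
          proof (cases "y \<in> ?r \<and> ?inv y \<in> V")
            case True
            then have y: "y \<in> ball ?y0 s" using chart_map_inv[of y c] by (auto simp: V_def)
            then have "?det n y \<le> C0" using upper[of y n] sB(1) by auto
            then have "ennreal ((cmod (u (?inv y)))\<^sup>2) * ennreal (?det n y) \<le> ennreal ((cmod (u (?inv y)))\<^sup>2) * ennreal C0"
              by (intro mult_left_mono ennreal_leI) auto
            then show ?thesis using True y by (simp add: m_def mult.commute)
          qed auto
        qed
        also have "\<dots> = ennreal C0 * (\<integral>\<^sup>+ y. m ?y0 y \<partial>lborel)"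
          using mm[OF sB(1)] by (intro nn_integral_cmult) simp
        finally show ?thesis .
      qed
      have 2: "(\<integral>\<^sup>+ y. m ?a y \<partial>lborel) \<le> ennreal (1 / c0) * mass n u U"
      proof -
        have "c0 > 0" by (rule c0)
        have "ennreal c0 * (\<integral>\<^sup>+ y. m ?a y \<partial>lborel) = (\<integral>\<^sup>+ y. ennreal c0 * m ?a y \<partial>lborel)"
          using mm[OF sB(2)] by (intro nn_integral_cmult[symmetric]) simp
        also have "\<dots> \<le> (\<integral>\<^sup>+ y. ennreal ((cmod (u (?inv y)))\<^sup>2) * indicator U (?inv y) * ennreal (?det n y) * indicator ?r y \<partial>lborel)"
        proof (rule nn_integral_mono)
          fix y
          show "ennreal c0 * m ?a y \<le> ennreal ((cmod (u (?inv y)))\<^sup>2) * indicator U (?inv y) * ennreal (?det n y) * indicator ?r y"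
          proof (cases "y \<in> ball ?a s")
            case True
            have yB: "y \<in> ?B" using True sB(2) by blast
            then have "c0 \<le> ?det n y" using lower[of y n] by simp
            then have "ennreal ((cmod (u (?inv y)))\<^sup>2) * ennreal c0 \<le> ennreal ((cmod (u (?inv y)))\<^sup>2) * ennreal (?det n y)"
              by (intro mult_left_mono ennreal_leI) auto
            moreover have "y \<in> ?r" using yB Br by blast
            ultimately show ?thesis using True UB[OF True] by (simp add: m_def mult.commute)
          qed (simp add: m_def)
        qed
        also have "\<dots> = (\<integral>\<^sup>+ p. ennreal ((cmod (u p))\<^sup>2) * indicator U p * indicator (chart_dom c) p \<partial>vol n)"
          by (rule str.nn_integral_chart[OF comp hc um[OF U(1)], symmetric])
        also have "\<dots> \<le> mass n u U"
          by (intro nn_integral_mono) (auto simp: indicator_def)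
        finally have le: "ennreal c0 * (\<integral>\<^sup>+ y. m ?a y \<partial>lborel) \<le> mass n u U" .
        have "(\<integral>\<^sup>+ y. m ?a y \<partial>lborel) = ennreal (1 / c0) * (ennreal c0 * (\<integral>\<^sup>+ y. m ?a y \<partial>lborel))"
          using c0 by (simp add: mult.assoc[symmetric] ennreal_mult[symmetric])
        also have "\<dots> \<le> ennreal (1 / c0) * mass n u U"
          by (intro mult_left_mono le) simp
        finally show ?thesis .
      qed
      have 3: "(\<integral>\<^sup>+ y. f y \<partial>lborel) \<le> ennreal (C1 / c0) * str.energy n u"
      proof -
        have fx: "f y \<le> ennreal (C1 / c0) * (ennreal (energy_density n u (?inv y)) *
            ennreal (?det n y) * indicator ?r y)" for y
        proof (cases "y \<in> ?B")
          case True
          have yr: "y \<in> ?r" and yK: "y \<in> ?K" using True Br by auto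
          let ?p = "?inv y"
          have pd: "?p \<in> chart_dom c" "chart_map c ?p = y" using chart_inv_in_dom[OF yr] chart_map_inv[OF yr] by auto
          let ?E = "energy_density n u ?p"
          have E: "?E = covector_norm_sq (stretched n c ?p) (magnetic_differential field u c ?p)"
            by (rule str.energy_density_atlas[OF u c(1) pd(1)])
          have W: "(\<Sum>i\<in>UNIV. of_real (v $ i) * magnetic_differential field u c ?p $ i) = W y"
            unfolding W_def frechet_derivative_partial[OF smooth_map_on_differentiable[OF su yr]]
            by (simp add: magnetic_differential_def pd(2) sum_2 inner_vec_def scaleR_conv_of_real algebra_simps)
          have pos: "positive_form (stretched n c ?p)" by (rule metric_components_positive[OF hc pd(1)])
          have E0: "?E \<ge> 0" unfolding E by (rule covector_norm_sq_nonneg[OF pos])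
          have "(cmod (W y))\<^sup>2 \<le> ?E * (v \<bullet> (stretched n c ?p *v v))"
            using covector_norm_sq_ge[OF pos, of v "magnetic_differential field u c ?p"] unfolding W E .
          also have "\<dots> \<le> ?E * C1"
            using gram_quadratic_mono[OF bump[OF yK, of n], of v c ?p] yv[OF yK] E0
            unfolding stretched_def C1_def by (intro mult_left_mono) linarith+
          also have "\<dots> \<le> ?E * C1 * (?det n y / c0)"
          proof -
            have r: "1 \<le> ?det n y / c0" using lower[OF yK, of n] c0 by simp
            have "0 \<le> ?E * C1" using E0 by (simp add: C1_def)
            from mult_left_mono[OF r this] show ?thesis by simp
          qed
          finally have "(cmod (W y))\<^sup>2 \<le> C1 / c0 * (?E * ?det n y)" by (simp add: field_simps)
          then have "f y \<le> ennreal (C1 / c0 * (?E * ?det n y))" using True by (simp add: f_def ennreal_leI)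
          also have "\<dots> = ennreal (C1 / c0) * (ennreal ?E * ennreal (?det n y))"
          proof -
            have "0 \<le> ?det n y" using lower[OF yK, of n] c0 by linarith
            moreover have "0 \<le> C1 / c0" using c0 by (simp add: C1_def)
            ultimately show ?thesis using E0 by (simp only: ennreal_mult mult_nonneg_nonneg)
          qed
          finally show ?thesis using yr by simp
        qed (simp add: f_def)
        have "(\<integral>\<^sup>+ y. f y \<partial>lborel) \<le> (\<integral>\<^sup>+ y. ennreal (C1 / c0) * (ennreal (energy_density n u (?inv y)) *
            ennreal (?det n y) * indicator ?r y) \<partial>lborel)"
          by (intro nn_integral_mono fx)
        also have "\<dots> = ennreal (C1 / c0) * (\<integral>\<^sup>+ y. ennreal (energy_density n u (?inv y)) *
            ennreal (?det n y) * indicator ?r y \<partial>lborel)"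
          by (rule nn_integral_cmult[OF str.chart_integrand_measurable[OF comp hc str.energy_density_continuous[OF u]]])
        also have "\<dots> = ennreal (C1 / c0) * (\<integral>\<^sup>+ p. ennreal (energy_density n u p) *
            indicator (chart_dom c) p \<partial>vol n)"
          by (simp only: str.nn_integral_chart[OF comp hc em])
        also have "\<dots> \<le> ennreal (C1 / c0) * str.energy n u"
          by (intro mult_left_mono nn_integral_mono) (auto simp: indicator_def)
        finally show ?thesis .
      qed
      show ?thesis
        by (rule order_trans[OF 1], rule mult_left_mono, rule order_trans[OF transl], rule mult_left_mono,
            rule add_mono, rule order_trans[OF 2], rule mult_left_mono[OF CU0[OF u]])
          (use 3 in simp_all)
    qed
    \<comment> \<open>\<open>CU\<close> may be negative, whereas products and sums pass through
      \<open>ennreal\<close> for nonnegative reals; \<open>max 0 CU\<close> has the same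
      \<open>ennreal\<close> value.\<close>
    have E: "ennreal C0 * (ennreal (exp 1) * (ennreal (1 / c0) * (ennreal CU * e) + ennreal (C1 / c0) * e)) =
      ennreal (C0 * (exp 1 * (1 / c0 * max 0 CU + C1 / c0))) * e" for e
    proof -
      have p: "0 \<le> C1 / c0" "0 \<le> 1 / c0" "0 \<le> max 0 CU" "0 \<le> C0" using c0 C0 by (simp_all add: C1_def)
      have "ennreal CU = ennreal (max 0 CU)" by (simp add: max_def ennreal_neg)
      moreover have "ennreal (C0 * (exp 1 * (1 / c0 * max 0 CU + C1 / c0))) =
        ennreal C0 * (ennreal (exp 1) * (ennreal (1 / c0) * ennreal (max 0 CU) + ennreal (C1 / c0)))"
        using p by (simp only: ennreal_mult ennreal_plus mult_nonneg_nonneg add_nonneg_nonneg exp_ge_zero)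
      ultimately show ?thesis by (simp only: distrib_left distrib_right mult.assoc)
    qed
    have "good V"
      unfolding good_def
      by (intro exI[of _ "C0 * (exp 1 * (1 / c0 * max 0 CU + C1 / c0))"] allI impI) (unfold E[symmetric], rule M)
    then show ?thesis using oV pV by blast
  qed
  then show ?thesis using oN pN by blast
qed

section \<open>From local mass bounds to a uniform spectral gap\<close>

lemma openin_sheet:
  assumes \<sigma>: "\<sigma> = 1 \<or> \<sigma> = - 1" shows "openin X (sheet \<sigma>)"
  using surface_chart_annular[OF \<sigma>] by (simp add: surface_chart_def)

lemma good_sheet:
  assumes \<sigma>: "\<sigma> = 1 \<or> \<sigma> = - 1" shows "good (sheet \<sigma>)"
proof -
  show ?thesis
    by (rule sheet_mass_bound[OF \<sigma>]) (unfold good_def, blast)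
qed

text \<open>Over this ring the height is positive, so the third coordinate does not vanish and its
  sign selects the sheet.\<close>

lemma stretched_region_in_sheet:
  assumes p: "p \<in> topspace X" "radius p \<in> {2..3}"
  shows "p \<in> sheet 1 \<or> p \<in> sheet (- 1)"
proof -
  have x: "planar_part (F p) \<in> annulus" using p(2) by (auto simp: annulus_def radius_def)
  have "F p $ 3 \<noteq> 0" using F_height[OF p(1)] annulus_height_pos[OF x] by auto
  then show ?thesis using x p(1) by (auto simp: sheet_def)
qed

text \<open>A point in the middle of the stretched ring; it shows that the sheets are nonempty and
  is the centre of the ball in the area bound.\<close>

definition base_point :: "real^2" where "base_point = vector [sqrt (5/2), 0]"

lemma radius_base_point: "radius_sq base_point = 5/2"
  by (simp add: base_point_def radius_sq_def)

lemma base_point_in_annulus: "base_point \<in> annulus"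
  by (simp add: annulus_def radius_base_point)

text \<open>Connectedness: away from the stretched ring \<open>good_propagates\<close> makes every
  limit point of the good set good, and the ring itself is covered by the two sheets.\<close>

lemma everywhere_good:
  assumes con: "connected_space X" and p: "p \<in> topspace X"
  shows "\<exists>U. openin X U \<and> p \<in> U \<and> good U"
proof -
  define G where "G = \<Union>{U. openin X U \<and> good U}"
  have oG: "openin X G" unfolding G_def by (rule openin_Union) blast
  have "openin X (topspace X - G)"
  proof (subst openin_subopen, intro ballI)
    fix q assume q: "q \<in> topspace X - G"
    have "radius q \<notin> {2..3}"
    proof
      assume "radius q \<in> {2..3}"
      then have "q \<in> sheet 1 \<or> q \<in> sheet (- 1)" using stretched_region_in_sheet q by blast
      then have "q \<in> G"
        unfolding G_def using openin_sheet[of 1] openin_sheet[of "- 1"] good_sheet[of 1] good_sheet[of "- 1"] by auto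
      then show False using q by blast
    qed
    then obtain N where N: "openin X N" "q \<in> N"
      "\<forall>r\<in>N. \<forall>U. openin X U \<and> r \<in> U \<and> good U \<longrightarrow> (\<exists>V. openin X V \<and> q \<in> V \<and> good V)"
      using good_propagates[of q] q by blast
    \<comment> \<open>A point of \<open>N\<close> with a good neighbourhood would provide one for
      \<open>q\<close>.\<close>
    have "N \<inter> G = {}" using N(3) q unfolding G_def by blast
    then have "N \<subseteq> topspace X - G" using openin_subset[OF N(1)] by blast
    then show "\<exists>T. openin X T \<and> q \<in> T \<and> T \<subseteq> topspace X - G" using N by blast
  qed
  then have "closedin X G" using openin_subset[OF oG] by (simp add: closedin_def)
  then have "G = {} \<or> G = topspace X"
    using con oG unfolding connected_space_clopen_in by blast
  moreover have "F_inv (lift g 1 base_point) \<in> G"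
    unfolding G_def using F_inv_lift_in_sheet[OF base_point_in_annulus, of 1] openin_sheet[of 1] good_sheet[of 1] by auto
  ultimately have "p \<in> G" using p by blast
  then show ?thesis unfolding G_def by blast
qed

text \<open>The constants of a finite good cover are independent of \<open>n\<close>, and overlaps
  only enlarge the sum of the masses; so one constant serves the whole sequence.\<close>

lemma uniform_spectral_gap:
  assumes con: "connected_space X"
  shows "\<exists>C>0. \<forall>n u. smooth_function \<A> u \<longrightarrow>
    (\<integral>\<^sup>+ p. ennreal ((cmod (u p))\<^sup>2) \<partial>vol n) \<le> ennreal C * str.energy n u"
proof -
  have "\<exists>F. finite F \<and> (\<forall>U\<in>F. openin X U \<and> good U) \<and> \<Union>F = topspace X"
    by (rule str.compact_cover) (rule everywhere_good[OF con])
  then obtain Us where Us: "finite Us" "\<forall>U\<in>Us. openin X U \<and> good U" "\<Union>Us = topspace X"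
    by (elim exE conjE) (rule that)
  have "\<forall>U\<in>Us. \<exists>C::real. \<forall>n u. smooth_function \<A> u \<longrightarrow>
     mass n u U \<le> ennreal C * str.energy n u"
    using Us(2) unfolding good_def by blast
  then obtain C :: "'a set \<Rightarrow> real" where C: "\<And>U n u. U \<in> Us \<Longrightarrow> smooth_function \<A> u \<Longrightarrow>
     mass n u U \<le> ennreal (C U) * str.energy n u"
    unfolding bchoice_iff by blast
  \<comment> \<open>The summand 1 makes the constant positive, so that its reciprocal bounds the
    eigenvalue.\<close>
  define D where "D = 1 + (\<Sum>U\<in>Us. max 0 (C U))"
  have D: "D > 0" unfolding D_def by (intro add_pos_nonneg sum_nonneg) auto
  have "(\<integral>\<^sup>+ p. ennreal ((cmod (u p))\<^sup>2) \<partial>vol n) \<le> ennreal D * str.energy n u"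
    if u: "smooth_function \<A> u" for n u
  proof -
    have [measurable]: "u \<in> borel_measurable (vol n)"
      by (rule str.continuous_measurable[OF smooth_function_continuous_map[OF atlas u]])
    have m: "(\<lambda>p. ennreal ((cmod (u p))\<^sup>2) * indicator U p) \<in> borel_measurable (vol n)" if "U \<in> Us" for U
    proof -
      have "openin X U" using Us(2) that by blast
      then have [measurable]: "U \<in> sets (vol n)" by (rule str.openin_sets)
      show ?thesis by measurable
    qed
    have "(\<integral>\<^sup>+ p. ennreal ((cmod (u p))\<^sup>2) \<partial>vol n) \<le> (\<integral>\<^sup>+ p. (\<Sum>U\<in>Us. ennreal ((cmod (u p))\<^sup>2) * indicator U p) \<partial>vol n)"
    proof (rule nn_integral_mono)
      fix p assume "p \<in> space (vol n)"
      then obtain U where U: "U \<in> Us" "p \<in> U" using Us(3) str.space_measure[of n] by blast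
      have "ennreal ((cmod (u p))\<^sup>2) * indicator U p \<le> (\<Sum>U\<in>Us. ennreal ((cmod (u p))\<^sup>2) * indicator U p)"
        using Us(1) U(1) by (intro member_le_sum) auto
      then show "ennreal ((cmod (u p))\<^sup>2) \<le> (\<Sum>U\<in>Us. ennreal ((cmod (u p))\<^sup>2) * indicator U p)"
        using U(2) by simp
    qed
    also have "\<dots> = (\<Sum>U\<in>Us. \<integral>\<^sup>+ p. ennreal ((cmod (u p))\<^sup>2) * indicator U p \<partial>vol n)"
      using m by (rule nn_integral_sum)
    also have "\<dots> \<le> (\<Sum>U\<in>Us. ennreal (max 0 (C U)) * str.energy n u)"
    proof (rule sum_mono)
      fix U assume "U \<in> Us"
      from C[OF this u, of n]
      show "mass n u U \<le> ennreal (max 0 (C U)) * str.energy n u"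
        by (rule order_trans) (intro mult_right_mono ennreal_leI; simp)
    qed
    also have "\<dots> = ennreal (\<Sum>U\<in>Us. max 0 (C U)) * str.energy n u"
      by (simp add: sum_distrib_right[symmetric] sum_ennreal)
    also have "\<dots> \<le> ennreal D * str.energy n u"
      by (intro mult_right_mono ennreal_leI) (simp_all add: D_def)
    finally show ?thesis .
  qed
  then show ?thesis using D by blast
qed

text \<open>One fixed ball in the upper sheet suffices: its density is at least
  \<open>exp (3/32 * n)\<close>, of which only the linear part is kept.\<close>

lemma area_growth: "\<exists>b>0. \<forall>n. area X \<A> (stretched n) \<ge> (1 + 3/32 * real n) * b"
proof -
  \<comment> \<open>The middle half of the stretched ring, where the exponent of the stretching is
    at least \<open>3/16 * n\<close>.\<close>
  have "open {x. 9/4 < radius_sq x \<and> radius_sq x < 11/4}"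
    by (intro open_Collect_conj open_Collect_less continuous_on_const continuous_on_radius_sq)
  moreover have "base_point \<in> {x. 9/4 < radius_sq x \<and> radius_sq x < 11/4}" by (simp add: radius_base_point)
  ultimately obtain r where r: "r > 0" "ball base_point r \<subseteq> {x. 9/4 < radius_sq x \<and> radius_sq x < 11/4}"
    unfolding open_contains_ball by blast
  let ?B = "ball base_point r"
  have BA: "?B \<subseteq> annulus" using r(2) by (force simp: annulus_def)
  define b where "b = measure lborel ?B"
  have eb: "emeasure lborel ?B = ennreal b"
    unfolding b_def using emeasure_bounded_finite[OF bounded_ball, of base_point r]
    by (intro emeasure_eq_ennreal_measure) simp
  have "emeasure lborel ?B \<noteq> 0"
  proof
    assume "emeasure lborel ?B = 0"
    then have "?B \<in> null_sets lborel" by (simp add: null_sets_def)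
    then have "negligible ?B" by (simp add: negligible_iff_null_sets null_sets_completionI)
    then show False using open_not_negligible[OF open_ball] r(1) by (metis ball_eq_empty linorder_not_le)
  qed
  then have b: "b > 0" unfolding eb by (simp add: b_def zero_less_measure_iff)
  have "area X \<A> (stretched n) \<ge> (1 + 3/32 * real n) * b" for n
  proof -
    let ?d = "annular_chart 1"
    have 1: "(1::real) = 1 \<or> (1::real) = - 1" by simp
    let ?E = "chart_dom ?d \<inter> chart_map ?d -` ?B"
    have sd: "surface_chart X ?d" by (rule surface_chart_annular[OF 1])
    have oE: "openin X ?E" by (rule openin_chart_preimage[OF sd open_ball])
    have im: "y \<in> chart_map ?d ` ?E" if y: "y \<in> ?B" for y
    proof -
      have yr: "y \<in> chart_range ?d" using BA y annular_chart_range[OF 1] by blast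
      then have "chart_inv ?d y \<in> ?E" using chart_inv_in_dom[OF yr] chart_map_inv[OF yr] y by simp
      then have "chart_map ?d (chart_inv ?d y) \<in> chart_map ?d ` ?E" by (rule imageI)
      then show ?thesis by (simp only: chart_map_inv[OF yr])
    qed
    have dens: "1 + 3/32 * real n \<le> chart_density (stretched n) ?d y" if y: "y \<in> ?B" for y
    proof -
      have ya: "y \<in> annulus" and rad: "9/4 < radius_sq y" "radius_sq y < 11/4" using y BA r(2) by auto
      let ?e = "bump n (radius_sq y)"
      let ?x = "real n * ((radius_sq y - 2) * (3 - radius_sq y))"
      have "1/4 * (3/4) \<le> (radius_sq y - 2) * (3 - radius_sq y)"
      proof -
        \<comment> \<open>This product is the excess of
          \<open>(radius_sq y - 2) * (3 - radius_sq y)\<close> over 3/16.\<close>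
        have "0 \<le> (radius_sq y - 9/4) * (11/4 - radius_sq y)" using rad by (intro mult_nonneg_nonneg) auto
        then show ?thesis by (simp add: algebra_simps)
      qed
      then have "real n * (3/16) \<le> ?x" by (intro mult_left_mono) auto
      then have "1 + 3/32 * real n \<le> 1 + ?x / 2" by simp
      also have "\<dots> \<le> exp (?x / 2)" by (rule exp_ge_add_one_self)
      also have "exp (?x / 2) = sqrt (exp ?x)"
        by (rule real_sqrt_unique[symmetric]) (simp_all add: exp_double[symmetric] power2_eq_square flip: exp_add)
      also have "\<dots> = sqrt ?e" by (simp add: bump_def)
      also have "\<dots> \<le> sqrt (det (stretched n ?d (chart_inv ?d y)))"
      proof -
        \<comment> \<open>The squared length of the angular field; it exceeds 1 here, so the
          determinant dominates the stretching factor.\<close>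
        let ?t = "radius_sq y + (slope g 1 y \<bullet> angular_field y)\<^sup>2"
        have "0 \<le> (slope g 1 y \<bullet> angular_field y)\<^sup>2" by simp
        then have "1 \<le> ?t" using rad(1) by linarith
        then have "1 \<le> 4 * ?t" using mult_mono[of 1 4 1 ?t] by simp
        then have "?e * 1 \<le> ?e * (4 * ?t)"
          by (rule mult_left_mono) (rule less_imp_le[OF bump_pos])
        then have "?e \<le> 4 * ?e * ?t" by (simp only: mult_1_right mult.assoc mult.left_commute)
        also have "\<dots> \<le> det (stretched n ?d (chart_inv ?d y))" unfolding annular_det(1)[OF 1 ya] by simp
        finally show ?thesis by simp
      qed
      also have "\<dots> = chart_density (stretched n) ?d y"
        using ya by (simp add: chart_density_def annular_chart_range[OF 1])
      finally show ?thesis .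
    qed
    have "ennreal ((1 + 3/32 * real n) * b) = ennreal (1 + 3/32 * real n) * emeasure lborel ?B"
      unfolding eb using b by (intro ennreal_mult) simp_all
    also have "\<dots> = (\<integral>\<^sup>+ y. ennreal (1 + 3/32 * real n) * indicator ?B y \<partial>lborel)"
      by (simp add: nn_integral_cmult_indicator)
    also have "\<dots> \<le> chart_volume (stretched n) ?d ?E"
      unfolding chart_volume_def
    proof (rule nn_integral_mono)
      fix y
      show "ennreal (1 + 3/32 * real n) * indicator ?B y \<le>
          ennreal (chart_density (stretched n) ?d y) * indicator (chart_map ?d ` ?E) y"
      proof (cases "y \<in> ?B")
        case True
        have "ennreal (1 + 3/32 * real n) \<le> ennreal (chart_density (stretched n) ?d y)"
          by (rule ennreal_leI[OF dens[OF True]])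
        then show ?thesis
          by (simp only: indicator_simps(1)[OF True] indicator_simps(1)[OF im[OF True]] mult_1_right)
      next
        case False
        show ?thesis by (simp only: indicator_simps(2)[OF False] mult_zero_right zero_le)
      qed
    qed
    also have "\<dots> = emeasure (vol n) ?E"
      by (rule str.emeasure_chart[OF annular_compatible[OF 1] annular_metric_components[OF 1] str.openin_sets[OF oE], symmetric]) simp
    also have "\<dots> \<le> emeasure (vol n) (topspace X)"
      using openin_subset[OF oE] str.openin_sets[of "topspace X" n] by (intro emeasure_mono) auto
    also have "\<dots> = ennreal (area X \<A> (stretched n))"
      unfolding area_def by (rule finite_measure.emeasure_eq_measure[OF str.finite_measure_surface])
    finally show ?thesis by (simp add: area_def)
  qed
  then show ?thesis using b by blast
qed

text \<open>\<open>1 / C\<close> bounds the eigenvalue from below for all \<open>n\<close>, so the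
  product inherits the growth of the area.\<close>

lemma area_lambda1_at_top:
  assumes con: "connected_space X"
  shows "filterlim (\<lambda>n. area X \<A> (stretched n) * magnetic_lambda1 X \<A> (stretched n) field) at_top sequentially"
proof -
  obtain C where C: "C > 0" "\<forall>n u. smooth_function \<A> u \<longrightarrow>
    (\<integral>\<^sup>+ p. ennreal ((cmod (u p))\<^sup>2) \<partial>vol n) \<le> ennreal C * str.energy n u"
    using uniform_spectral_gap[OF con] by blast
  obtain b where b: "b > 0" "\<forall>n. area X \<A> (stretched n) \<ge> (1 + 3/32 * real n) * b"
    using area_growth by blast
  have ne: "topspace X \<noteq> {}"
    using F_inv_lift_in_sheet[OF base_point_in_annulus, of 1] by (auto simp: sheet_def)
  have l: "1 / C \<le> magnetic_lambda1 X \<A> (stretched n) field" for n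
    using str.magnetic_lambda1_ge[OF C(1) ne, of n] C(2) by blast
  have le: "(1 + 3/32 * real n) * b * (1 / C) \<le> area X \<A> (stretched n) * magnetic_lambda1 X \<A> (stretched n) field" for n
  proof (rule mult_mono)
    show "(1 + 3/32 * real n) * b \<le> area X \<A> (stretched n)" using b(2) by blast
    show "0 \<le> area X \<A> (stretched n)" by (simp add: area_def)
  qed (use l C(1) in auto)
  have lim: "filterlim (\<lambda>n. (1 + 3/32 * real n) * b * (1 / C)) at_top sequentially"
  proof -
    have "filterlim (\<lambda>n. 3/32 * real n) at_top sequentially"
      by (rule filterlim_tendsto_pos_mult_at_top[OF tendsto_const _ filterlim_real_sequentially]) simp
    then have "filterlim (\<lambda>n. 1 + 3/32 * real n) at_top sequentially"
      by (rule filterlim_tendsto_add_at_top[OF tendsto_const])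
    then have "filterlim (\<lambda>n. (1 + 3/32 * real n) * (b * (1 / C))) at_top sequentially"
      using b(1) C(1) by (intro filterlim_at_top_mult_tendsto_pos[OF tendsto_const]) auto
    then show ?thesis by (simp only: mult.assoc)
  qed
  show ?thesis
    by (rule filterlim_at_top_mono[OF lim always_eventually[OF allI[OF le]]])
qed

end

theorem theorem27:
  fixes g :: nat and X :: "'a topology" and \<A> :: "'a chart set"
  assumes "g \<ge> 1"
    and "smooth_surface X \<A>"
    and "compact_space X"
    and "connected_space X"
    and "orientable X \<A>"
    and "has_genus X \<A> g"
  shows "\<exists>(A :: 'a one_form) (h :: nat \<Rightarrow> 'a metric_tensor).
           closed_one_form \<A> A \<and>
           (\<forall>n. riemannian_metric \<A> (h n)) \<and>
           filterlim (\<lambda>n. area X \<A> (h n) * magnetic_lambda1 X \<A> (h n) A) at_top sequentially"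
proof -
  obtain F :: "'a \<Rightarrow> real^3" where F: "homeomorphic_map X (top_of_set (standard_surface g)) F"
    "smooth_function \<A> F" "\<forall>c\<in>\<A>. \<forall>y\<in>chart_range c. inj (frechet_derivative (F \<circ> chart_inv c) (at y))"
    using assms(6) unfolding has_genus_def by (elim exE conjE) (rule that)
  \<comment> \<open>The immersion \<open>F\<close> supplies the functions from which the field and
    the metrics on \<open>X\<close> are built.\<close>
  interpret handle_surface X \<A> g F
    by (rule handle_surface.intro[OF assms(1-3) F(1,2)]) (rule bspec[OF bspec[OF F(3)]])
  show ?thesis
    by (rule exI[of _ field], rule exI[of _ stretched])
      (intro conjI allI field_closed stretched_metric area_lambda1_at_top assms(4))
qed

end
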